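(* Assume that $u\not\equiv0$, that there are constants $C,\alpha>0$ with $|u(k)|\le Ce^{-\alpha\|k\|_1}$ for all $k\in\mathbb{Z}^d$, and that $\mu$ has a density $\rho\in BV(\mathbb{R})$. Then there exist $C_{\rm W}=C_{\rm W}(u)>0$ and $N=N(u)$ (namely $N=\|I_0\|_1$) such that for any $l>0$ and any bounded interval $I\subset\mathbb{R}$ we have, with $\Gamma=\mathfrak{C}_{R_l}$, $$\mathbb{E}_\Gamma\bigl\{\operatorname{Tr}\bigl(P_I(h_\omega^l)\bigr)\bigr\}\le C_{\rm W}\,\|\rho\|_{\rm Var}\,|I|\,(2l+1)^{2d+N},$$ for every fixed choice of the remaining coupling constants $\omega_k$, $k\in\mathbb{Z}^d\setminus\Gamma$.
   Context: Fix the dimension $d\ge1$. Model: $\mu$ is a probability measure on $\mathbb{R}$ with bounded support; $\Omega=\prod_{k\in\mathbb{Z}^d}\operatorname{supp}\mu$ carries the product $\sigma$-algebra and $\mathbb{P}=\bigotimes_{k\in\mathbb{Z}^d}\mu$, so the coordinates $\omega_k$ are i.i.d. Let $u\in\ell^1(\mathbb{Z}^d;\mathbb{R})$ (single-site potential). On $\ell^2(\mathbb{Z}^d)$ let $(h_0\psi)(x)=\sum_{\|x-y\|_1=1}(\psi(x)-\psi(y))$, let $v_\omega$ be multiplication by $v_\omega(x)=\sum_{k\in\mathbb{Z}^d}\omega_ku(x-k)$, and $h_\omega=h_0+v_\omega$ (discrete alloy-type model). $\mathfrak{C}_R=[-R,R]^d\cap\mathbb{Z}^d$. For finite $\mathfrak{C}\subset\mathbb{Z}^d$,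 $h_\omega^{\mathfrak{C}}=\pi_{\mathfrak{C}}h_\omega\iota_{\mathfrak{C}}$ on $\ell^2(\mathfrak{C})$, with $\iota_{\mathfrak{C}}:\ell^2(\mathfrak{C})\to\ell^2(\mathbb{Z}^d)$ the inclusion and $\pi_{\mathfrak{C}}$ its adjoint; $h_\omega^l=h_\omega^{\mathfrak{C}_l}$. $P_I(\cdot)$ denotes the spectral projection onto $I$. For $\Gamma\subset\mathbb{Z}^d$, $\mathbb{E}_\Gamma$ is the expectation with respect to the variables $\omega_k$, $k\in\Gamma$, only (the others being held fixed). $\|\rho\|_{\rm Var}=\sup\{\int\rho v'\,dx: v\in C_c^\infty(\mathbb{R}),|v|\le1\}$ is the total variation, and $BV(\mathbb{R})$ is the set of $f\in L^1(\mathbb{R})$ with $\|f\|_{\rm Var}<\infty$. Constants attached to $u$: the generating function $F(z)=\sum_{k\in\mathbb{Z}^d}u(-k)z^k$ is holomorphic near $\mathbf{1}=(1,\dots,1)\in\mathbb{C}^d$. For multi-indices $I,J\in\mathbb{N}_0^d$, $J<I$ means $J\le I$ componentwise and $\|J\|_1<\|I\|_1$. Fix a multi-index $I_0\in\mathbb{N}_0^d$ with $(D_z^{I_0}F)(\mathbf{1})=:c_u\ne0$ and $(D_z^IF)(\mathbf{1})=0$ for all $I<I_0$ (such $I_0$ exists). For $l>0$ put $$R_l=\max\Bigl\{2l+\frac2\alpha\ln\frac{2\cdot3^d\,C}{|c_u|(1-e^{-\alpha/2})},\ \frac{8(d+\|I_0\|_1)^2}{\alpha^2}\Bigr\}.$$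 *)

theory Defs
  imports "HOL-Probability.Probability"
begin

text \<open>
  The lattice \<open>\<int>\<^sup>d\<close> is \<^typ>\<open>int ^ 'd\<close> for a finite index type \<open>'d\<close>, so \<open>d = CARD('d)\<close>; multi-indices
  in \<open>\<nat>\<^sub>0\<^sup>d\<close> have type \<^typ>\<open>nat ^ 'd\<close>.
\<close>

definition lattice_norm :: "int ^ 'd::finite \<Rightarrow> int"
  where "lattice_norm x = (\<Sum>i\<in>UNIV. \<bar>x $ i\<bar>)"

definition cube :: "real \<Rightarrow> (int ^ 'd::finite) set"
  where "cube R = {x. \<forall>i. \<bar>real_of_int (x $ i)\<bar> \<le> R}"


section \<open>The discrete alloy-type model\<close>

definition h0 :: "(int ^ 'd::finite \<Rightarrow> complex) \<Rightarrow> (int ^ 'd \<Rightarrow> complex)"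
  where "h0 \<psi> = (\<lambda>x. \<Sum>y\<in>{y. lattice_norm (x - y) = 1}. \<psi> x - \<psi> y)"

definition alloy_potential :: "(int ^ 'd::finite \<Rightarrow> real) \<Rightarrow> (int ^ 'd \<Rightarrow> real) \<Rightarrow> int ^ 'd \<Rightarrow> real"
  where "alloy_potential u \<omega> x = (\<Sum>\<^sub>\<infinity>k\<in>UNIV. \<omega> k * u (x - k))"

definition alloy_hamiltonian ::
    "(int ^ 'd::finite \<Rightarrow> real) \<Rightarrow> (int ^ 'd \<Rightarrow> real) \<Rightarrow> (int ^ 'd \<Rightarrow> complex) \<Rightarrow> (int ^ 'd \<Rightarrow> complex)"
  where "alloy_hamiltonian u \<omega> \<psi> = (\<lambda>x. h0 \<psi> x + of_real (alloy_potential u \<omega> x) * \<psi> x)"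


section \<open>Operators on \<open>\<ell>\<^sup>2\<close> of a finite set\<close>

text \<open>
  For finite \<open>X\<close>, \<open>\<ell>\<^sup>2(X)\<close> is represented by the functions that vanish outside \<open>X\<close>. Under this
  identification the inclusion \<open>\<iota>\<^sub>X\<close> is the identity, and its adjoint \<open>\<pi>\<^sub>X\<close> is the truncation of a
  function to \<open>X\<close>.
\<close>

definition l2_space :: "'a set \<Rightarrow> ('a \<Rightarrow> complex) set"
  where "l2_space X = {\<psi>. \<forall>x. x \<notin> X \<longrightarrow> \<psi> x = 0}"

definition l2_inner :: "'a set \<Rightarrow> ('a \<Rightarrow> complex) \<Rightarrow> ('a \<Rightarrow> complex) \<Rightarrow> complex"
  where "l2_inner X \<phi> \<psi> = (\<Sum>x\<in>X. cnj (\<phi> x) * \<psi> x)"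

definition truncate_to :: "'a set \<Rightarrow> ('a \<Rightarrow> complex) \<Rightarrow> ('a \<Rightarrow> complex)"
  where "truncate_to X \<psi> = (\<lambda>x. if x \<in> X then \<psi> x else 0)"

definition alloy_restricted ::
    "(int ^ 'd::finite) set \<Rightarrow> (int ^ 'd \<Rightarrow> real) \<Rightarrow> (int ^ 'd \<Rightarrow> real)
      \<Rightarrow> (int ^ 'd \<Rightarrow> complex) \<Rightarrow> (int ^ 'd \<Rightarrow> complex)"
  where "alloy_restricted X u \<omega> \<psi> = truncate_to X (alloy_hamiltonian u \<omega> (truncate_to X \<psi>))"

definition eigenspace ::
    "'a set \<Rightarrow> (('a \<Rightarrow> complex) \<Rightarrow> ('a \<Rightarrow> complex)) \<Rightarrow> real \<Rightarrow> ('a \<Rightarrow> complex) set"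
  where "eigenspace X A E = {\<psi> \<in> l2_space X. A \<psi> = (\<lambda>x. of_real E * \<psi> x)}"

text \<open>Only used for self-adjoint operators, whose spectrum is real.\<close>

definition point_spectrum :: "'a set \<Rightarrow> (('a \<Rightarrow> complex) \<Rightarrow> ('a \<Rightarrow> complex)) \<Rightarrow> real set"
  where "point_spectrum X A = {E. \<exists>\<psi>\<in>eigenspace X A E. \<psi> \<noteq> (\<lambda>x. 0)}"

definition orth_projection ::
    "'a set \<Rightarrow> ('a \<Rightarrow> complex) set \<Rightarrow> ('a \<Rightarrow> complex) \<Rightarrow> ('a \<Rightarrow> complex)"
  where "orth_projection X V \<psi> =
    (THE \<phi>. \<phi> \<in> V \<and> (\<forall>\<theta>\<in>V. l2_inner X \<theta> (\<lambda>x. \<psi> x - \<phi> x) = 0))"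

text \<open>
  \<open>P\<^sub>I(A) = \<chi>\<^sub>I(A)\<close>: in finite dimension the spectral measure of a self-adjoint \<open>A\<close> assigns to \<open>I\<close>
  the sum of the orthogonal projections onto \<open>ker (A - E)\<close>, \<open>E \<in> \<sigma>(A) \<inter> I\<close>.
\<close>

definition spectral_projection ::
    "'a set \<Rightarrow> (('a \<Rightarrow> complex) \<Rightarrow> ('a \<Rightarrow> complex)) \<Rightarrow> real set \<Rightarrow> ('a \<Rightarrow> complex) \<Rightarrow> ('a \<Rightarrow> complex)"
  where "spectral_projection X A I \<psi> =
    (\<lambda>x. \<Sum>E\<in>point_spectrum X A \<inter> I. orth_projection X (eigenspace X A E) \<psi> x)"

definition op_trace :: "'a set \<Rightarrow> (('a \<Rightarrow> complex) \<Rightarrow> ('a \<Rightarrow> complex)) \<Rightarrow> complex"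
  where "op_trace X T =
    (\<Sum>x\<in>X. l2_inner X (\<lambda>y. if y = x then 1 else 0) (T (\<lambda>y. if y = x then 1 else 0)))"

text \<open>
  \<open>Tr P\<^sub>I(h\<^sub>\<omega>\<^sup>l)\<close>; the trace of an orthogonal projection is real, so \<open>Re\<close> only changes the type.
\<close>

definition trace_spectral_projection ::
    "(int ^ 'd::finite \<Rightarrow> real) \<Rightarrow> real \<Rightarrow> real set \<Rightarrow> (int ^ 'd \<Rightarrow> real) \<Rightarrow> real"
  where "trace_spectral_projection u l I \<omega> =
    Re (op_trace (cube l) (spectral_projection (cube l) (alloy_restricted (cube l) u \<omega>) I))"


section \<open>The coupling constants\<close>

definition measure_support :: "real measure \<Rightarrow> real set"
  where "measure_support \<mu> = {x. \<forall>e>0. emeasure \<mu> (ball x e) > 0}"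

text \<open>
  The coupling constants in \<open>\<Gamma>\<close> are drawn from \<open>\<mu>\<close> independently, those outside \<open>\<Gamma>\<close> keep their
  value under \<open>\<omega>\<close>. The product is formed over \<open>\<real>\<close> instead of \<open>supp \<mu>\<close>, whose complement
  is a \<open>\<mu>\<close>-null set.
\<close>

definition partial_expectation ::
    "real measure \<Rightarrow> 'k set \<Rightarrow> (('k \<Rightarrow> real) \<Rightarrow> real) \<Rightarrow> ('k \<Rightarrow> real) \<Rightarrow> real"
  where "partial_expectation \<mu> \<Gamma> X \<omega> = (\<integral>\<eta>. X (override_on \<omega> \<eta> \<Gamma>) \<partial>(PiM \<Gamma> (\<lambda>_. \<mu>)))"

definition test_functions :: "(real \<Rightarrow> real) set"
  where "test_functions = {v. (\<forall>n x. (deriv ^^ n) v field_differentiable (at x)) \<and>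
    compact (closure {x. v x \<noteq> 0})}"

definition variation_integrals :: "(real \<Rightarrow> real) \<Rightarrow> real set"
  where "variation_integrals \<rho> =
    {\<integral>x. \<rho> x * deriv v x \<partial>lborel |v. v \<in> test_functions \<and> (\<forall>x. \<bar>v x\<bar> \<le> 1)}"

text \<open>The real supremum is meaningful only on \<open>BV\<close>, where the set is bounded.\<close>

definition var_norm :: "(real \<Rightarrow> real) \<Rightarrow> real"
  where "var_norm \<rho> = Sup (variation_integrals \<rho>)"

definition BV :: "(real \<Rightarrow> real) set"
  where "BV = {\<rho>. integrable lborel \<rho> \<and> bdd_above (variation_integrals \<rho>)}"

definition has_density :: "real measure \<Rightarrow> (real \<Rightarrow> real) \<Rightarrow> bool"
  where "has_density \<mu> \<rho> \<longleftrightarrow> \<rho> \<in> borel_measurable borel \<and> (AE x in lborel. 0 \<le> \<rho> x) \<and>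
    \<mu> = density lborel (\<lambda>x. ennreal (\<rho> x))"


section \<open>Constants attached to the single-site potential\<close>

definition gen_fun :: "(int ^ 'd::finite \<Rightarrow> real) \<Rightarrow> complex ^ 'd \<Rightarrow> complex"
  where "gen_fun u z = (\<Sum>\<^sub>\<infinity>k\<in>UNIV. of_real (u (- k)) * (\<Prod>i\<in>UNIV. (z $ i) powi (k $ i)))"

definition partial_deriv ::
    "'d::finite \<Rightarrow> (complex ^ 'd \<Rightarrow> complex) \<Rightarrow> (complex ^ 'd \<Rightarrow> complex)"
  where "partial_deriv i f = (\<lambda>z. deriv (\<lambda>w. f (\<chi> j. if j = i then w else z $ j)) (z $ i))"

text \<open>
  The iterated partial derivative is taken in the order of some enumeration of the coordinates. For
  functions holomorphic near the point in question, partial derivatives commute and the choice does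
  not matter.
\<close>

definition coordinates :: "'d::finite list"
  where "coordinates = (SOME is. distinct is \<and> set is = UNIV)"

definition multi_deriv ::
    "nat ^ 'd::finite \<Rightarrow> (complex ^ 'd \<Rightarrow> complex) \<Rightarrow> (complex ^ 'd \<Rightarrow> complex)"
  where "multi_deriv I f = fold (\<lambda>i. partial_deriv i ^^ (I $ i)) coordinates f"

definition mi_norm :: "nat ^ 'd::finite \<Rightarrow> nat"
  where "mi_norm I = (\<Sum>i\<in>UNIV. I $ i)"

definition mi_less :: "nat ^ 'd::finite \<Rightarrow> nat ^ 'd \<Rightarrow> bool"
  where "mi_less J I \<longleftrightarrow> (\<forall>i. J $ i \<le> I $ i) \<and> mi_norm J < mi_norm I"

definition c_const :: "(int ^ 'd::finite \<Rightarrow> real) \<Rightarrow> nat ^ 'd \<Rightarrow> complex"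
  where "c_const u I\<^sub>0 = multi_deriv I\<^sub>0 (gen_fun u) 1"

definition leading_index :: "(int ^ 'd::finite \<Rightarrow> real) \<Rightarrow> nat ^ 'd \<Rightarrow> bool"
  where "leading_index u I\<^sub>0 \<longleftrightarrow> c_const u I\<^sub>0 \<noteq> 0 \<and>
    (\<forall>I. mi_less I I\<^sub>0 \<longrightarrow> multi_deriv I (gen_fun u) 1 = 0)"

definition R_const ::
    "(int ^ 'd::finite \<Rightarrow> real) \<Rightarrow> nat ^ 'd \<Rightarrow> real \<Rightarrow> real \<Rightarrow> real \<Rightarrow> real"
  where "R_const u I\<^sub>0 C \<alpha> l =
    max (2 * l + 2 / \<alpha> * ln (2 * 3 ^ CARD('d) * C / (cmod (c_const u I\<^sub>0) * (1 - exp (- \<alpha> / 2)))))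
        (8 * (real CARD('d) + real (mi_norm I\<^sub>0))\<^sup>2 / \<alpha>\<^sup>2)"

end

theory Submission
  imports Defs
    "HOL-Computational_Algebra.Fundamental_Theorem_Algebra"
    "HOL-Real_Asymp.Real_Asymp"
    "HOL-Complex_Analysis.Cauchy_Integral_Formula"
begin

text \<open>
  The monomial weights \<open>t k = \<plusminus>k\<^sup>I\<close>, \<open>I\<close> the leading index, turn the single-site potentials into a
  potential \<open>\<Sum>\<^sub>k t k * u (x - k)\<close> that is constant on the lattice, because all lower moments of \<open>u\<close>
  vanish. Restricting the sum to \<open>\<Gamma>\<close> costs at most half of the constant on the cube, so that moving the
  coupling constants along \<open>-t\<close> for a time \<open>s\<close> lowers the operator by at least \<open>s\<delta>\<close>, \<open>\<delta> = |c|/2\<close>.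
  Once \<open>s\<delta>\<close> exceeds the length of the interval with end points \<open>a \<le> b\<close>, the Weyl inequality shows that all
  eigenvalues up to \<open>b\<close> have passed below \<open>a\<close>. The number of eigenvalues in the interval is therefore at most the
  increment of the number of eigenvalues below \<open>a\<close> under the shift. The expectation of this increment
  is controlled by the total variation distance between the law of the coupling constants and its
  translate, which a density of bounded variation bounds linearly in \<open>s\<close>.
\<close>

section \<open>Spectral theorem and eigenvalue counting\<close>

text \<open>The obstacle is the sign of \<open>u\<close>: if \<open>u\<close> changes sign, the
  eigenvalues need not be monotone in any single coupling constant, so monotonicity has to come from
  a joint motion of all constants in \<Gamma>. The lower moments vanish by the choice of the index,
  since the derivatives of the generating function at 1 are the factorial moments of the reflected
  potential. That some moment is nonzero rests on the identity theorem for Laurent series, applied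
  in one coordinate after the other.

  With N the total degree of the index, the term 8(d + N)^2 / \<alpha>^2 in R lets exp(\<alpha> r /
  2) dominate both the r^d lattice points of a shell and the weights r^N; the logarithm in R then
  presses the remaining geometric tail below |c|/2.

  The exponent 2d + N collects d from the number of eigenvalues on the cube, d from the number of
  coupling constants that move, and N from the size R^N of their displacement, as R grows at most
  linearly in l.

  Only the count below a fixed level is ever translated. It is a bounded function of the coupling
  constants, and no regularity of it beyond measurability is needed.\<close>

lemma exists_nontrivial_kernel:
  fixes M :: "'t \<Rightarrow> 's \<Rightarrow> 'f::field"
  assumes "finite T" "finite S" "card T < card S"
  shows "\<exists>c. (\<exists>s\<in>S. c s \<noteq> 0) \<and> (\<forall>t\<in>T. (\<Sum>s\<in>S. M t s * c s) = 0)"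
  using assms
proof (induction T arbitrary: S M rule: finite_induct)
  case empty
  then obtain s where "s \<in> S"
    by fastforce
  then show ?case
    by (intro exI[of _ "\<lambda>_. 1"]) auto
next
  case (insert t T)
  show ?case
  proof (cases "\<exists>s\<in>S. M t s \<noteq> 0")
    case False
    then show ?thesis
      using insert.IH[of S M] insert by auto
  next
    case True
    then obtain s0 where s0: "s0 \<in> S" "M t s0 \<noteq> 0"
      by blast
    \<comment> \<open>Gaussian elimination with pivot \<open>M t s0\<close>: the unknown
      \<open>s0\<close> disappears from the other equations, and equation \<open>t\<close> is
      satisfied afterwards by the choice of the value at \<open>s0\<close>.\<close>
    define M' where "M' t' s = M t' s - M t' s0 / M t s0 * M t s" for t' s
    have "card T < card (S - {s0})"
      using insert s0 by (simp add: card_Diff_singleton)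
    then obtain c where c: "\<exists>s\<in>S - {s0}. c s \<noteq> 0"
        "\<And>t. t \<in> T \<Longrightarrow> (\<Sum>s\<in>S - {s0}. M' t s * c s) = 0"
      using insert.IH[of "S - {s0}" M'] insert.prems(1) by auto
    define r where "r = (\<Sum>s\<in>S - {s0}. M t s * c s)"
    define c' where "c' = c(s0 := - r / M t s0)"
    have split: "(\<Sum>s\<in>S. M t' s * c' s) = M t' s0 * (- r / M t s0) + (\<Sum>s\<in>S - {s0}. M t' s * c s)" for t'
      using insert.prems(1) s0 by (subst sum.remove[of S s0]) (auto simp: c'_def intro!: sum.cong)
    have "(\<Sum>s\<in>S. M t' s * c' s) = 0" if "t' \<in> insert t T" for t'
    proof (cases "t' = t")
      case True
      then show ?thesis
        unfolding split using s0 by (simp add: r_def)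
    next
      case False
      then have "0 = (\<Sum>s\<in>S - {s0}. M' t' s * c s)"
        using c(2) that by auto
      also have "\<dots> = (\<Sum>s\<in>S - {s0}. M t' s * c s) - M t' s0 / M t s0 * r"
        by (simp add: M'_def r_def algebra_simps sum_subtractf sum_distrib_left)
      finally show ?thesis
        unfolding split by simp
    qed
    moreover have "\<exists>s\<in>S. c' s \<noteq> 0"
      using c(1) by (auto simp: c'_def)
    ultimately show ?thesis
      by blast
  qed
qed

section \<open>Hermitian operators and their orthonormal eigenbases\<close>

definition l2_hermitian :: "'a set \<Rightarrow> (('a \<Rightarrow> complex) \<Rightarrow> ('a \<Rightarrow> complex)) \<Rightarrow> bool"
  where "l2_hermitian X A \<longleftrightarrow> (\<forall>\<psi>\<in>l2_space X. A \<psi> \<in> l2_space X) \<and>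
    (\<forall>\<phi>\<in>l2_space X. \<forall>\<psi>\<in>l2_space X. \<forall>c. A (\<lambda>x. \<phi> x + c * \<psi> x) = (\<lambda>x. A \<phi> x + c * A \<psi> x)) \<and>
    (\<forall>\<phi>\<in>l2_space X. \<forall>\<psi>\<in>l2_space X. l2_inner X \<phi> (A \<psi>) = l2_inner X (A \<phi>) \<psi>)"

text \<open>Completeness is not demanded: for \<open>J = X\<close> it follows from the number of
  vectors. The free index type allows an induction over initial segments of the naturals before the
  indices are moved to \<open>X\<close>.\<close>

definition eigenbasis ::
    "'a set \<Rightarrow> (('a \<Rightarrow> complex) \<Rightarrow> ('a \<Rightarrow> complex)) \<Rightarrow> ('i \<Rightarrow> 'a \<Rightarrow> complex) \<Rightarrow> ('i \<Rightarrow> real) \<Rightarrow> 'i set \<Rightarrow> bool"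
  where "eigenbasis X A e \<nu> J \<longleftrightarrow>
    (\<forall>j\<in>J. e j \<in> l2_space X \<and> A (e j) = (\<lambda>x. of_real (\<nu> j) * e j x)) \<and>
    (\<forall>i\<in>J. \<forall>j\<in>J. l2_inner X (e i) (e j) = (if i = j then 1 else 0))"

lemma l2_inner_add_right:
  "l2_inner X \<phi> (\<lambda>x. f x + c * g x) = l2_inner X \<phi> f + c * l2_inner X \<phi> g"
  by (simp add: l2_inner_def algebra_simps sum.distrib sum_distrib_left)

lemma l2_inner_scale_right: "l2_inner X \<phi> (\<lambda>x. c * g x) = c * l2_inner X \<phi> g"
  by (simp add: l2_inner_def algebra_simps sum_distrib_left)

lemma l2_inner_scale_left: "l2_inner X (\<lambda>x. c * g x) \<phi> = cnj c * l2_inner X g \<phi>"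
  by (simp add: l2_inner_def algebra_simps sum_distrib_left)

lemma l2_inner_diff_right:
  "l2_inner X \<phi> (\<lambda>x. f x - g x) = l2_inner X \<phi> f - l2_inner X \<phi> g"
  by (simp add: l2_inner_def algebra_simps sum_subtractf)

lemma l2_inner_sum_right:
  "l2_inner X \<phi> (\<lambda>x. \<Sum>j\<in>J. f j x) = (\<Sum>j\<in>J. l2_inner X \<phi> (f j))"
  unfolding l2_inner_def sum_distrib_left by (rule sum.swap)

lemma l2_inner_sum_left:
  "l2_inner X (\<lambda>x. \<Sum>j\<in>J. f j x) \<phi> = (\<Sum>j\<in>J. l2_inner X (f j) \<phi>)"
  unfolding l2_inner_def cnj_sum sum_distrib_right by (rule sum.swap)

lemma cnj_l2_inner: "cnj (l2_inner X \<phi> \<psi>) = l2_inner X \<psi> \<phi>"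
  by (simp add: l2_inner_def mult.commute)

lemma l2_inner_self: "l2_inner X \<psi> \<psi> = of_real (\<Sum>x\<in>X. (cmod (\<psi> x))\<^sup>2)"
  unfolding l2_inner_def of_real_sum
  by (intro sum.cong) (auto simp: complex_norm_square mult.commute simp del: of_real_power)

lemma l2_inner_self_eq_0:
  assumes "finite X" "\<psi> \<in> l2_space X" "l2_inner X \<psi> \<psi> = 0"
  shows "\<psi> = (\<lambda>x. 0)"
proof -
  have "(\<Sum>x\<in>X. (cmod (\<psi> x))\<^sup>2) = 0"
    using assms(3) unfolding l2_inner_self by (simp only: of_real_eq_0_iff)
  then have "\<forall>x\<in>X. \<psi> x = 0"
    using assms(1) by (simp add: sum_nonneg_eq_0_iff)
  then show ?thesis
    using assms(2) by (auto simp: l2_space_def fun_eq_iff)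
qed

lemma l2_hermitian_add_scale:
  assumes "l2_hermitian X A" "\<phi> \<in> l2_space X" "\<psi> \<in> l2_space X"
  shows "A (\<lambda>x. \<phi> x + c * \<psi> x) = (\<lambda>x. A \<phi> x + c * A \<psi> x)"
  using assms by (simp add: l2_hermitian_def)

lemma l2_inner_delta_left:
  assumes "finite X" "x \<in> X"
  shows "l2_inner X (\<lambda>y. if y = x then 1 else 0) f = f x"
proof -
  have "l2_inner X (\<lambda>y. if y = x then 1 else 0) f = (\<Sum>y\<in>X. if y = x then f y else 0)"
    unfolding l2_inner_def by (intro sum.cong) auto
  then show ?thesis using assms by simp
qed

lemma l2_inner_delta_right:
  assumes "finite X" "x \<in> X"
  shows "l2_inner X f (\<lambda>y. if y = x then 1 else 0) = cnj (f x)"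
  using l2_inner_delta_left[OF assms, of f] cnj_l2_inner by metis

text \<open>Krylov argument without determinants: some nonzero polynomial p satisfies p(A) v = 0. If
  p has least degree and is split as (X - z) q, then q(A) v is nonzero by minimality and is an
  eigenvector for z.\<close>

lemma eigenvector_in_invariant_subspace:
  fixes A :: "('a \<Rightarrow> complex) \<Rightarrow> ('a \<Rightarrow> complex)"
  assumes X: "finite X" and V: "V \<subseteq> l2_space X" "(\<lambda>x. 0) \<in> V"
    and V_add: "\<And>\<phi> \<psi> c. \<phi> \<in> V \<Longrightarrow> \<psi> \<in> V \<Longrightarrow> (\<lambda>x. \<phi> x + c * \<psi> x) \<in> V"
    and A_V: "\<And>\<psi>. \<psi> \<in> V \<Longrightarrow> A \<psi> \<in> V"
    and A_lin: "\<And>\<phi> \<psi> c. \<phi> \<in> V \<Longrightarrow> \<psi> \<in> V \<Longrightarrow> A (\<lambda>x. \<phi> x + c * \<psi> x) = (\<lambda>x. A \<phi> x + c * A \<psi> x)"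
    and v: "v \<in> V" "v \<noteq> (\<lambda>x. 0)"
  obtains w z where "w \<in> V" "w \<noteq> (\<lambda>x. 0)" "A w = (\<lambda>x. z * w x)"
proof -
  have A0: "A (\<lambda>x. 0) = (\<lambda>x. 0)"
    using A_lin[OF V(2) V(2), of "-1"] by (simp add: fun_eq_iff)
  \<comment> \<open>\<open>P p\<close> is the vector p(A) v, evaluated by Horner's scheme.\<close>
  define P where "P p = fold_coeffs (\<lambda>a w x. a * v x + A w x) p (\<lambda>x. 0)" for p
  have P0: "P 0 = (\<lambda>x. 0)"
    by (simp add: P_def)
  have P_pCons: "P (pCons a p) = (\<lambda>x. a * v x + A (P p) x)" for a p
    by (cases "a = 0 \<and> p = 0") (auto simp: P_def A0)
  have PV: "P p \<in> V" for p
  proof (induction p)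
    case 0
    then show ?case by (simp add: P0 V)
  next
    case (pCons a p)
    show ?case
      unfolding P_pCons using V_add[OF A_V[OF pCons.IH] v(1), of a] by (simp add: add.commute)
  qed
  have P_add: "P (p + smult c q) = (\<lambda>x. P p x + c * P q x)" for p q c
  proof (induction p arbitrary: q)
    case 0
    then show ?case
    proof (induction q)
      case 0
      then show ?case by (simp add: P0)
    next
      case (pCons a q)
      have "P (smult c (pCons a q)) = (\<lambda>x. c * a * v x + A (\<lambda>x. 0 + c * P q x) x)"
        using pCons.IH by (simp add: P_pCons P0)
      then show ?case
        unfolding A_lin[OF V(2) PV] by (simp add: P0 P_pCons A0 algebra_simps)
    qed
  next
    case (pCons a p)
    obtain b q' where q: "q = pCons b q'"
      by (cases q)
    show ?case
      unfolding q by (simp add: P_pCons pCons.IH A_lin[OF PV PV] algebra_simps)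
  qed
  have P_monom: "P (monom c i) = (\<lambda>x. c * (A ^^ i) v x)" for c i
  proof (induction i)
    case 0
    then show ?case by (simp add: monom_0 P_pCons P0 A0)
  next
    case (Suc i)
    have "(A ^^ i) v \<in> V" for i
      by (induction i) (auto simp: v A_V)
    then show ?case
      using A_lin[OF V(2), of "(A ^^ i) v" c] by (simp add: monom_Suc P_pCons Suc A0)
  qed
  define n where "n = card X"
  \<comment> \<open>The n + 1 vectors v, A v, ..., A^n v live on n points, hence they are linearly
    dependent.\<close>
  obtain c where c: "\<exists>i\<in>{..n}. c i \<noteq> 0" "\<And>x. x \<in> X \<Longrightarrow> (\<Sum>i\<in>{..n}. (A ^^ i) v x * c i) = 0"
    using exists_nontrivial_kernel[of X "{..n}" "\<lambda>x i. (A ^^ i) v x"] X n_def by auto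
  define p where "p = (\<Sum>i\<le>n. monom (c i) i)"
  have P_sum: "P (\<Sum>i\<le>m. monom (c i) i) = (\<lambda>x. \<Sum>i\<le>m. (A ^^ i) v x * c i)" for m
  proof (induction m)
    case 0
    then show ?case by (simp add: P_monom mult.commute)
  next
    case (Suc m)
    then show ?case
      using P_add[of "\<Sum>i\<le>m. monom (c i) i" 1] by (simp add: P_monom mult.commute)
  qed
  have "P p x = 0" for x
  proof (cases "x \<in> X")
    case True
    then show ?thesis using c(2) by (simp add: p_def P_sum)
  next
    case False
    then show ?thesis using PV[of p] V(1) by (auto simp: l2_space_def)
  qed
  moreover have "p \<noteq> 0"
  proof
    assume "p = 0"
    obtain i where i: "i \<le> n" "c i \<noteq> 0" using c(1) by auto
    have "coeff p i = c i"
      using i by (simp add: p_def coeff_sum if_distrib cong: if_cong)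
    with \<open>p = 0\<close> i show False by simp
  qed
  ultimately have "\<exists>p. p \<noteq> 0 \<and> P p = (\<lambda>x. 0)" by blast
  then obtain p where p: "p \<noteq> 0" "P p = (\<lambda>x. 0)"
    and min: "\<And>q. q \<noteq> 0 \<Longrightarrow> P q = (\<lambda>x. 0) \<Longrightarrow> degree p \<le> degree q"
    using ex_has_least_nat[of "\<lambda>p. p \<noteq> 0 \<and> P p = (\<lambda>x. 0)" _ degree] by blast
  have "degree p \<noteq> 0"
  proof
    assume "degree p = 0"
    then obtain a where a: "p = [:a:]"
      by (rule degree_eq_zeroE)
    then show False
      using p v(2) by (auto simp: P_pCons P0 A0 fun_eq_iff)
  qed
  then obtain z where "poly p z = 0"
    using alg_closed_imp_poly_has_root[of p] by auto
  then obtain q where q: "p = [:- z, 1:] * q"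
    by (auto simp: poly_eq_0_iff_dvd)
  then have "q \<noteq> 0" using p by auto
  have "degree p = Suc (degree q)"
    using \<open>q \<noteq> 0\<close> unfolding q by (subst degree_mult_eq) auto
  then have "P q \<noteq> (\<lambda>x. 0)"
    using min[of q] \<open>q \<noteq> 0\<close> by auto
  moreover have "P p = (\<lambda>x. A (P q) x - z * P q x)"
    using P_add[of "pCons 0 q" "-z" q] by (simp add: q P_pCons add.commute)
  then have "A (P q) = (\<lambda>x. z * P q x)"
    using p(2) by (simp add: fun_eq_iff)
  ultimately show thesis
    using that PV by blast
qed

text \<open>The orthogonal complement \<open>V\<close> of the vectors found so far is invariant
  because A is hermitian, and it is nonzero because n linear conditions on more than n values have a
  nontrivial solution. A normalized eigenvector in \<open>V\<close> extends the family.\<close>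

lemma eigenbasis_extend:
  assumes X: "finite X" and A: "l2_hermitian X A" and "n \<le> card X"
  shows "\<exists>e \<nu>. eigenbasis X A e \<nu> {..<n}"
  using assms(3)
proof (induction n)
  case 0
  then show ?case by (auto simp: eigenbasis_def)
next
  case (Suc n)
  then obtain e \<nu> where e: "eigenbasis X A e \<nu> {..<n}" by auto
  define V where "V = {\<psi> \<in> l2_space X. \<forall>i<n. l2_inner X (e i) \<psi> = 0}"
  obtain c where c: "\<exists>x\<in>X. c x \<noteq> 0" "\<And>i. i < n \<Longrightarrow> (\<Sum>x\<in>X. cnj (e i x) * c x) = 0"
    using exists_nontrivial_kernel[of "{..<n}" X "\<lambda>i x. cnj (e i x)"] X Suc.prems by auto
  define v where "v = truncate_to X c"
  have v: "v \<in> V" "v \<noteq> (\<lambda>x. 0)"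
    using c by (auto simp: v_def V_def truncate_to_def l2_space_def l2_inner_def fun_eq_iff)
  have add: "(\<lambda>x. \<phi> x + c * \<psi> x) \<in> V" if "\<phi> \<in> V" "\<psi> \<in> V" for \<phi> \<psi> c
    using that by (auto simp: V_def l2_space_def l2_inner_add_right)
  have AV: "A \<psi> \<in> V" if "\<psi> \<in> V" for \<psi>
  proof -
    have "l2_inner X (e i) (A \<psi>) = 0" if "i < n" for i
    proof -
      have "l2_inner X (e i) (A \<psi>) = l2_inner X (A (e i)) \<psi>"
        using A \<open>\<psi> \<in> V\<close> e that unfolding l2_hermitian_def V_def eigenbasis_def by auto
      also have "A (e i) = (\<lambda>x. of_real (\<nu> i) * e i x)"
        using e that by (simp add: eigenbasis_def)
      finally show ?thesis
        using \<open>\<psi> \<in> V\<close> that by (simp add: V_def l2_inner_scale_left)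
    qed
    then show ?thesis
      using A that by (auto simp: V_def l2_hermitian_def)
  qed
  obtain w z where w: "w \<in> V" "w \<noteq> (\<lambda>x. 0)" "A w = (\<lambda>x. z * w x)"
  proof (rule eigenvector_in_invariant_subspace[OF X _ _ add AV _ v])
    show "V \<subseteq> l2_space X" "(\<lambda>x. 0) \<in> V"
      by (auto simp: V_def l2_space_def l2_inner_def)
    show "A (\<lambda>x. \<phi> x + c * \<psi> x) = (\<lambda>x. A \<phi> x + c * A \<psi> x)" if "\<phi> \<in> V" "\<psi> \<in> V" for \<phi> \<psi> c
      using that A by (auto simp: V_def l2_hermitian_def)
  qed auto
  have wX: "w \<in> l2_space X" using w by (simp add: V_def)
  define s where "s = (\<Sum>x\<in>X. (cmod (w x))\<^sup>2)"
  have ws: "l2_inner X w w = of_real s"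
    by (simp add: s_def l2_inner_self del: of_real_sum)
  have "s \<noteq> 0" using l2_inner_self_eq_0[OF X wX] w(2) ws by auto
  moreover have "s \<ge> 0" by (simp add: s_def sum_nonneg)
  ultimately have "s > 0" by simp
  \<comment> \<open>Symmetry forces the eigenvalue to be real, as the real-valued family \<nu>
    requires.\<close>
  have "l2_inner X w (A w) = l2_inner X (A w) w"
    using A wX by (simp add: l2_hermitian_def)
  then have "z * l2_inner X w w = cnj z * l2_inner X w w"
    by (simp only: w(3) l2_inner_scale_left l2_inner_scale_right)
  then have "z = cnj z" using \<open>s \<noteq> 0\<close> ws by simp
  then obtain r where r: "z = of_real r"
    by (metis Reals_cnj_iff Reals_cases)
  define f where "f x = of_real (1 / sqrt s) * w x" for x
  have fV: "f \<in> V"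
    using add[OF _ w(1), of "\<lambda>x. 0" "of_real (1 / sqrt s)"]
    by (auto simp: f_def[abs_def] V_def l2_space_def l2_inner_def)
  have ff: "l2_inner X f f = 1"
  proof -
    have "1 / sqrt s * (1 / sqrt s * s) = 1"
      using \<open>s > 0\<close> by (simp add: real_div_sqrt)
    then show ?thesis
      unfolding f_def[abs_def] l2_inner_scale_left l2_inner_scale_right ws
      by (simp only: complex_cnj_complex_of_real flip: of_real_mult) simp
  qed
  have Af: "A f = (\<lambda>x. of_real r * f x)"
  proof -
    have 0: "(\<lambda>x. 0) \<in> l2_space X" by (simp add: l2_space_def)
    have A0: "A (\<lambda>x. 0) = (\<lambda>x. 0)"
      using l2_hermitian_add_scale[OF A wX wX, of "-1"] by simp
    have "A f = (\<lambda>x. A (\<lambda>x. 0) x + of_real (1 / sqrt s) * A w x)"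
      using l2_hermitian_add_scale[OF A 0 wX, of "of_real (1 / sqrt s)"] by (simp add: f_def[abs_def])
    then show ?thesis
      by (simp add: A0 w(3) r f_def[abs_def] mult.left_commute)
  qed
  have orth: "l2_inner X f (e i) = 0" if "i < n" for i
    using fV that cnj_l2_inner[of X "e i" f] by (simp add: V_def)
  have "eigenbasis X A (e(n := f)) (\<nu>(n := r)) {..<Suc n}"
    using e fV ff Af orth unfolding eigenbasis_def V_def by (auto simp: less_Suc_eq)
  then show ?case by blast
qed

theorem eigenbasis_exists:
  assumes "finite X" "l2_hermitian X A"
  obtains e \<nu> where "eigenbasis X A e \<nu> X"
proof -
  obtain e :: "nat \<Rightarrow> 'a \<Rightarrow> complex" and \<nu> where e: "eigenbasis X A e \<nu> {..<card X}"
    using eigenbasis_extend[OF assms, of "card X"] by auto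
  obtain h where "bij_betw h X {0..<card X}"
    using ex_bij_betw_finite_nat[OF assms(1)] by blast
  then have "inj_on h X" "h x < card X" if "x \<in> X" for x
    using that by (auto simp: bij_betw_def)
  then have "eigenbasis X A (e \<circ> h) (\<nu> \<circ> h) X"
    using e by (auto simp: eigenbasis_def inj_on_def)
  then show thesis by (rule that)
qed

text \<open>The remainder \<open>r\<close> is orthogonal to every \<open>e j\<close>. Were it
  nonzero, there would be one more pairwise orthogonal nonzero vectors than points of
  \<open>X\<close>, although so many vectors must be linearly dependent.\<close>

lemma eigenbasis_expansion:
  assumes X: "finite X" and e: "eigenbasis X A e \<nu> X" and \<psi>: "\<psi> \<in> l2_space X"
  shows "\<psi> = (\<lambda>x. \<Sum>j\<in>X. l2_inner X (e j) \<psi> * e j x)"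
proof -
  define r where "r x = \<psi> x - (\<Sum>j\<in>X. l2_inner X (e j) \<psi> * e j x)" for x
  have orth: "l2_inner X (e i) r = 0" if "i \<in> X" for i
  proof -
    have "(\<Sum>j\<in>X. l2_inner X (e j) \<psi> * l2_inner X (e i) (e j)) = (\<Sum>j\<in>X. if i = j then l2_inner X (e i) \<psi> else 0)"
      using e that by (intro sum.cong) (auto simp: eigenbasis_def)
    then show ?thesis
      unfolding r_def[abs_def] l2_inner_diff_right l2_inner_sum_right l2_inner_scale_right
      using X that by simp
  qed
  have orth': "l2_inner X r (e i) = 0" if "i \<in> X" for i
    using orth[OF that] cnj_l2_inner[of X "e i" r] by simp
  have rX: "r \<in> l2_space X"
    using \<psi> e by (auto simp: r_def l2_space_def eigenbasis_def)
  have "l2_inner X r r = 0"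
  proof (rule ccontr)
    assume nz: "l2_inner X r r \<noteq> 0"
    \<comment> \<open>\<open>None\<close> stands for the additional vector \<open>r\<close>,
      \<open>Some j\<close> for the basis vector \<open>e j\<close>.\<close>
    define g where "g k = (case k of None \<Rightarrow> r | Some j \<Rightarrow> e j)" for k
    define S where "S = insert None (Some ` X)"
    have S: "finite S" "card X < card S"
      using X by (auto simp: S_def card_image)
    obtain c where c: "\<exists>s\<in>S. c s \<noteq> 0" "\<And>x. x \<in> X \<Longrightarrow> (\<Sum>s\<in>S. g s x * c s) = 0"
      using exists_nontrivial_kernel[of X S "\<lambda>x s. g s x"] X S by auto
    have "c t = 0" if t: "t \<in> S" for t
    proof -
      have "0 = l2_inner X (g t) (\<lambda>x. \<Sum>s\<in>S. c s * g s x)"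
        using c(2) by (simp add: l2_inner_def mult.commute)
      also have "\<dots> = (\<Sum>s\<in>S. c s * l2_inner X (g t) (g s))"
        by (simp add: l2_inner_sum_right l2_inner_scale_right)
      also have "\<dots> = (\<Sum>s\<in>S. if t = s then c t * l2_inner X (g t) (g t) else 0)"
        using t e orth orth' by (intro sum.cong) (auto simp: S_def g_def eigenbasis_def split: if_splits, blast)
      also have "\<dots> = c t * l2_inner X (g t) (g t)"
        using S t by simp
      finally show ?thesis
        using nz t e by (auto simp: S_def g_def eigenbasis_def)
    qed
    then show False using c(1) by auto
  qed
  then have "r = (\<lambda>x. 0)"
    using l2_inner_self_eq_0[OF X rX] by simp
  then show ?thesis
    by (simp add: r_def fun_eq_iff)
qed

lemma parseval:
  assumes "finite X" "eigenbasis X A e \<nu> X" "\<psi> \<in> l2_space X"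
  shows "l2_inner X \<psi> \<phi> = (\<Sum>j\<in>X. cnj (l2_inner X (e j) \<psi>) * l2_inner X (e j) \<phi>)"
  by (subst eigenbasis_expansion[OF assms]) (simp add: l2_inner_sum_left l2_inner_scale_left)

lemma eigenbasis_inner_image:
  assumes A: "l2_hermitian X A" and e: "eigenbasis X A e \<nu> X" and "\<psi> \<in> l2_space X" "j \<in> X"
  shows "l2_inner X (e j) (A \<psi>) = of_real (\<nu> j) * l2_inner X (e j) \<psi>"
proof -
  have "l2_inner X (e j) (A \<psi>) = l2_inner X (A (e j)) \<psi>"
    using assms by (auto simp: l2_hermitian_def eigenbasis_def)
  then show ?thesis
    using e \<open>j \<in> X\<close> by (simp add: eigenbasis_def l2_inner_scale_left)
qed

lemma quadratic_form:
  assumes "finite X" "l2_hermitian X A" "eigenbasis X A e \<nu> X" "\<psi> \<in> l2_space X"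
  shows "Re (l2_inner X \<psi> (A \<psi>)) = (\<Sum>j\<in>X. \<nu> j * (cmod (l2_inner X (e j) \<psi>))\<^sup>2)"
proof -
  have "l2_inner X \<psi> (A \<psi>) = (\<Sum>j\<in>X. of_real (\<nu> j * (cmod (l2_inner X (e j) \<psi>))\<^sup>2))"
    unfolding parseval[OF assms(1,3,4)]
    by (intro sum.cong refl, subst eigenbasis_inner_image[OF assms(2-4)])
      (auto simp: complex_norm_square mult_ac simp del: of_real_power)
  then show ?thesis by simp
qed

lemma norm_square_form:
  assumes "finite X" "eigenbasis X A e \<nu> X" "\<psi> \<in> l2_space X"
  shows "Re (l2_inner X \<psi> \<psi>) = (\<Sum>j\<in>X. (cmod (l2_inner X (e j) \<psi>))\<^sup>2)"
  unfolding parseval[OF assms]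
  by (simp only: mult.commute[of "cnj _"] complex_norm_square[symmetric] Re_sum Re_complex_of_real)

section \<open>Spectral projections, their traces, and the comparison of counts\<close>

lemma eigenspace_coefficient:
  assumes A: "l2_hermitian X A" and e: "eigenbasis X A e \<nu> X" and \<psi>: "\<psi> \<in> eigenspace X A E"
    and "j \<in> X" "\<nu> j \<noteq> E"
  shows "l2_inner X (e j) \<psi> = 0"
proof -
  have "l2_inner X (e j) (A \<psi>) = of_real E * l2_inner X (e j) \<psi>"
    using \<psi> by (simp add: eigenspace_def l2_inner_scale_right)
  moreover have "l2_inner X (e j) (A \<psi>) = of_real (\<nu> j) * l2_inner X (e j) \<psi>"
    using \<psi> by (intro eigenbasis_inner_image[OF A e _ \<open>j \<in> X\<close>]) (simp add: eigenspace_def)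
  ultimately have "(of_real (\<nu> j) - of_real E) * l2_inner X (e j) \<psi> = 0"
    by (metis left_diff_distrib right_minus_eq)
  then show ?thesis using assms(5) by (simp flip: of_real_diff)
qed

lemma point_spectrum_eq:
  assumes X: "finite X" and A: "l2_hermitian X A" and e: "eigenbasis X A e \<nu> X"
  shows "point_spectrum X A = \<nu> ` X"
proof (intro equalityI subsetI)
  fix E assume "E \<in> point_spectrum X A"
  then obtain \<psi> where \<psi>: "\<psi> \<in> eigenspace X A E" "\<psi> \<noteq> (\<lambda>x. 0)"
    by (auto simp: point_spectrum_def)
  show "E \<in> \<nu> ` X"
  proof (rule ccontr)
    assume "E \<notin> \<nu> ` X"
    then have "\<forall>j\<in>X. l2_inner X (e j) \<psi> = 0"
      using eigenspace_coefficient[OF A e \<psi>(1)] by blast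
    then have "\<psi> = (\<lambda>x. 0)"
      using eigenbasis_expansion[OF X e, of \<psi>] \<psi>(1) by (simp add: eigenspace_def)
    with \<psi>(2) show False by simp
  qed
next
  fix E assume "E \<in> \<nu> ` X"
  then obtain j where j: "j \<in> X" "E = \<nu> j" by blast
  have "l2_inner X (e j) (e j) = 1"
    using e j by (simp add: eigenbasis_def)
  then have "e j \<noteq> (\<lambda>x. 0)"
    by (auto simp: l2_inner_def)
  moreover have "e j \<in> eigenspace X A E"
    using e j by (auto simp: eigenspace_def eigenbasis_def)
  ultimately show "E \<in> point_spectrum X A"
    by (auto simp: point_spectrum_def)
qed

text \<open>\<open>orth_projection\<close> is a definite description, so existence and uniqueness
  are both due. The part of the expansion with eigenvalue \<open>E\<close> is a solution, and the
  difference of two solutions lies in the eigenspace and is orthogonal to itself.\<close>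

lemma orth_projection_eigenspace:
  assumes X: "finite X" and A: "l2_hermitian X A" and e: "eigenbasis X A e \<nu> X"
  shows "orth_projection X (eigenspace X A E) \<psi> =
    (\<lambda>x. \<Sum>j\<in>{j\<in>X. \<nu> j = E}. l2_inner X (e j) \<psi> * e j x)"
proof -
  define J where "J = {j\<in>X. \<nu> j = E}"
  define \<phi> where "\<phi> x = (\<Sum>j\<in>J. l2_inner X (e j) \<psi> * e j x)" for x
  have J: "finite J" "J \<subseteq> X" using X by (auto simp: J_def)
  have \<phi>X: "\<phi> \<in> l2_space X"
    using e by (auto simp: \<phi>_def l2_space_def eigenbasis_def J_def)
  have coeff: "l2_inner X (e j) \<phi> = (if j \<in> J then l2_inner X (e j) \<psi> else 0)" if "j \<in> X" for j
  proof -
    have "l2_inner X (e j) \<phi> = (\<Sum>i\<in>J. if i = j then l2_inner X (e i) \<psi> else 0)"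
      unfolding \<phi>_def[abs_def] l2_inner_sum_right l2_inner_scale_right
      using e that J by (intro sum.cong) (auto simp: eigenbasis_def)
    then show ?thesis using J by simp
  qed
  have \<phi>E: "\<phi> \<in> eigenspace X A E"
  proof -
    have AX: "A \<phi> \<in> l2_space X" using A \<phi>X by (simp add: l2_hermitian_def)
    have "A \<phi> = (\<lambda>x. \<Sum>j\<in>X. l2_inner X (e j) (A \<phi>) * e j x)"
      by (rule eigenbasis_expansion[OF X e AX])
    also have "\<dots> = (\<lambda>x. \<Sum>j\<in>X. of_real E * (l2_inner X (e j) \<phi> * e j x))"
      by (intro ext sum.cong refl) (auto simp: eigenbasis_inner_image[OF A e \<phi>X] coeff J_def)
    also have "\<dots> = (\<lambda>x. of_real E * \<phi> x)"
      by (subst (2) eigenbasis_expansion[OF X e \<phi>X]) (simp add: sum_distrib_left)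
    finally show ?thesis using \<phi>X by (simp add: eigenspace_def)
  qed
  have orth: "l2_inner X \<theta> (\<lambda>x. \<psi> x - \<phi> x) = 0" if \<theta>: "\<theta> \<in> eigenspace X A E" for \<theta>
  proof -
    have "\<theta> \<in> l2_space X" using \<theta> by (simp add: eigenspace_def)
    have "cnj (l2_inner X (e j) \<theta>) * (l2_inner X (e j) \<psi> - l2_inner X (e j) \<phi>) = 0" if "j \<in> X" for j
      using eigenspace_coefficient[OF A e \<theta> that] that by (auto simp: coeff J_def)
    then show ?thesis
      by (subst parseval[OF X e \<open>\<theta> \<in> l2_space X\<close>]) (auto simp: l2_inner_diff_right intro!: sum.neutral)
  qed
  have "orth_projection X (eigenspace X A E) \<psi> = \<phi>"
    unfolding orth_projection_def
  proof (rule the_equality)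
    fix \<phi>' assume \<phi>': "\<phi>' \<in> eigenspace X A E \<and>
      (\<forall>\<theta>\<in>eigenspace X A E. l2_inner X \<theta> (\<lambda>x. \<psi> x - \<phi>' x) = 0)"
    define d where "d x = \<phi> x - \<phi>' x" for x
    have dX: "d \<in> l2_space X"
      using \<phi>' \<phi>X by (auto simp: d_def eigenspace_def l2_space_def)
    have "A (\<lambda>x. \<phi> x + -1 * \<phi>' x) = (\<lambda>x. A \<phi> x + -1 * A \<phi>' x)"
      using A \<phi>' \<phi>E unfolding l2_hermitian_def eigenspace_def by blast
    then have "d \<in> eigenspace X A E"
      using \<phi>' \<phi>E dX by (auto simp: eigenspace_def d_def[abs_def] algebra_simps)
    then have "l2_inner X d (\<lambda>x. \<psi> x - \<phi>' x) - l2_inner X d (\<lambda>x. \<psi> x - \<phi> x) = 0"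
      using \<phi>' orth by simp
    then have "l2_inner X d d = 0"
      by (simp add: d_def[abs_def] l2_inner_diff_right[of X "d"] flip: l2_inner_diff_right)
    then have "d = (\<lambda>x. 0)"
      by (rule l2_inner_self_eq_0[OF X dX])
    then show "\<phi>' = \<phi>" by (simp add: d_def fun_eq_iff)
  qed (use \<phi>E orth in auto)
  then show ?thesis by (simp add: \<phi>_def[abs_def] J_def)
qed

text \<open>Distinct eigenvalues use disjoint sets of indices, so the projections add up to a sum of
  rank-one projections onto the \<open>e j\<close>. Exchanging the sums in the trace leaves the
  squared norm 1 of each of them.\<close>

lemma trace_spectral_projection_eq_card:
  assumes X: "finite X" and A: "l2_hermitian X A" and e: "eigenbasis X A e \<nu> X"
  shows "op_trace X (spectral_projection X A I) = of_nat (card {j\<in>X. \<nu> j \<in> I})"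
proof -
  define J where "J = {j\<in>X. \<nu> j \<in> I}"
  have J: "finite J" "J \<subseteq> X" using X by (auto simp: J_def)
  have img: "\<nu> ` X \<inter> I = \<nu> ` J" by (auto simp: J_def)
  have "spectral_projection X A I \<psi> = (\<lambda>x. \<Sum>j\<in>J. l2_inner X (e j) \<psi> * e j x)" for \<psi>
  proof
    fix x
    have "spectral_projection X A I \<psi> x =
        (\<Sum>E\<in>\<nu> ` J. \<Sum>j\<in>{j\<in>X. \<nu> j = E}. l2_inner X (e j) \<psi> * e j x)"
      unfolding spectral_projection_def point_spectrum_eq[OF assms] img
        orth_projection_eigenspace[OF assms] ..
    also have "\<dots> = (\<Sum>E\<in>\<nu> ` J. \<Sum>j\<in>{j\<in>J. \<nu> j = E}. l2_inner X (e j) \<psi> * e j x)"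
      by (intro sum.cong) (auto simp: J_def)
    also have "\<dots> = (\<Sum>j\<in>J. l2_inner X (e j) \<psi> * e j x)"
      by (rule sum.image_gen[symmetric, OF J(1)])
    finally show "spectral_projection X A I \<psi> x = (\<Sum>j\<in>J. l2_inner X (e j) \<psi> * e j x)" .
  qed
  then have "op_trace X (spectral_projection X A I) = (\<Sum>x\<in>X. \<Sum>j\<in>J. cnj (e j x) * e j x)"
    unfolding op_trace_def
    by (intro sum.cong refl) (simp only: l2_inner_delta_left[OF X] l2_inner_delta_right[OF X])
  also have "\<dots> = (\<Sum>j\<in>J. l2_inner X (e j) (e j))"
    unfolding l2_inner_def by (rule sum.swap)
  also have "\<dots> = (\<Sum>j\<in>J. 1)"
    using e J by (intro sum.cong) (auto simp: eigenbasis_def)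
  finally show ?thesis by (simp add: J_def)
qed

text \<open>Dimension count: otherwise the span of the \<open>e j\<close> with
  \<open>\<nu> j \<le> b\<close> meets the span of the \<open>e' j\<close> with
  \<open>\<nu>' j \<ge> a\<close> in a nonzero vector, whose form is at most b under
  \<open>A\<close> and at least a under \<open>A'\<close>, relative to its squared norm. The sign of
  \<open>d\<close> is free; the measurability proofs use negative values.\<close>

lemma weyl_counting:
  assumes X: "finite X" and A: "l2_hermitian X A" "l2_hermitian X A'"
    and e: "eigenbasis X A e \<nu> X" "eigenbasis X A' e' \<nu>' X"
    and le: "\<And>\<psi>. \<psi> \<in> l2_space X \<Longrightarrow>
      Re (l2_inner X \<psi> (A' \<psi>)) \<le> Re (l2_inner X \<psi> (A \<psi>)) - d * Re (l2_inner X \<psi> \<psi>)"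
    and "b - d < a"
  shows "card {j\<in>X. \<nu> j \<le> b} \<le> card {j\<in>X. \<nu>' j < a}"
proof (rule ccontr)
  assume less: "\<not> ?thesis"
  \<comment> \<open>Each element of \<open>T\<close> is one linear condition; together they say that
    a vector lies in both spans, and there are fewer of them than points of
    \<open>X\<close>.\<close>
  define T where "T = Inl ` {j\<in>X. \<nu> j > b} \<union> Inr ` {j\<in>X. \<nu>' j < a}"
  have T: "finite T" using X by (auto simp: T_def)
  have "card T = card {j\<in>X. \<nu> j > b} + card {j\<in>X. \<nu>' j < a}"
    unfolding T_def using X by (subst card_Un_disjoint) (auto simp: card_image)
  also have "\<dots> < card {j\<in>X. \<nu> j > b} + card {j\<in>X. \<nu> j \<le> b}"
    using less by simp
  also have "\<dots> = card ({j\<in>X. \<nu> j > b} \<union> {j\<in>X. \<nu> j \<le> b})"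
    using X by (subst card_Un_disjoint) auto
  also have "{j\<in>X. \<nu> j > b} \<union> {j\<in>X. \<nu> j \<le> b} = X" by auto
  finally have "card T < card X" .
  from exists_nontrivial_kernel[OF T X this, of "\<lambda>t x. cnj (case t of Inl j \<Rightarrow> e j x | Inr j \<Rightarrow> e' j x)"]
  obtain c where c: "\<exists>x\<in>X. c x \<noteq> 0"
    "\<And>t. t \<in> T \<Longrightarrow> (\<Sum>x\<in>X. cnj (case t of Inl j \<Rightarrow> e j x | Inr j \<Rightarrow> e' j x) * c x) = 0"
    by auto
  define v where "v = truncate_to X c"
  have v: "v \<in> l2_space X" "v \<noteq> (\<lambda>x. 0)"
    using c(1) by (auto simp: v_def truncate_to_def l2_space_def fun_eq_iff)
  have 1: "l2_inner X (e j) v = 0" if "j \<in> X" "\<nu> j > b" for j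
    using c(2)[of "Inl j"] that by (simp add: T_def v_def truncate_to_def l2_inner_def)
  have 2: "l2_inner X (e' j) v = 0" if "j \<in> X" "\<nu>' j < a" for j
    using c(2)[of "Inr j"] that by (simp add: T_def v_def truncate_to_def l2_inner_def)
  define N where "N = Re (l2_inner X v v)"
  have N: "N = (\<Sum>x\<in>X. (cmod (v x))\<^sup>2)"
    by (simp add: N_def l2_inner_self del: of_real_sum)
  then have "N \<ge> 0" by (simp add: sum_nonneg)
  moreover have "N \<noteq> 0"
    using l2_inner_self_eq_0[OF X v(1)] v(2) N by (auto simp: l2_inner_self simp del: of_real_sum)
  ultimately have "N > 0" by simp
  have "Re (l2_inner X v (A v)) \<le> (\<Sum>j\<in>X. b * (cmod (l2_inner X (e j) v))\<^sup>2)"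
    unfolding quadratic_form[OF X A(1) e(1) v(1)]
    using 1 by (intro sum_mono) (metis (no_types, opaque_lifting) linorder_not_le mult_right_mono
      mult_zero_right norm_zero order_refl power_zero_numeral zero_le_power2)
  also have "\<dots> = b * N"
    by (simp add: N_def norm_square_form[OF X e(1) v(1)] sum_distrib_left)
  finally have "Re (l2_inner X v (A' v)) \<le> (b - d) * N"
    using le[OF v(1)] by (simp add: N_def algebra_simps)
  also have "\<dots> < a * N" using \<open>N > 0\<close> assms(7) by simp
  also have "a * N = (\<Sum>j\<in>X. a * (cmod (l2_inner X (e' j) v))\<^sup>2)"
    by (simp add: N_def norm_square_form[OF X e(2) v(1)] sum_distrib_left)
  also have "\<dots> \<le> Re (l2_inner X v (A' v))"
    unfolding quadratic_form[OF X A(2) e(2) v(1)]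
    using 2 by (intro sum_mono) (metis (no_types, opaque_lifting) linorder_not_le mult_right_mono
      mult_zero_right norm_zero order_refl power_zero_numeral zero_le_power2)
  finally show False by simp
qed

section \<open>Smooth approximation and translates of BV densities\<close>

text \<open>Smoothness is witnessed by a set of functions that is closed under differentiation.
  Closure properties then only require a suitable set, and no formula for iterated
  derivatives.\<close>

definition smooth_fun :: "(real \<Rightarrow> real) \<Rightarrow> bool"
  where "smooth_fun f \<longleftrightarrow>
    (\<exists>S. f \<in> S \<and> (\<forall>g\<in>S. \<exists>g'\<in>S. \<forall>x. (g has_field_derivative g' x) (at x)))"

lemma smooth_fun_higher_deriv:
  assumes "smooth_fun f"
  shows "(deriv ^^ n) f field_differentiable (at x)"
proof -
  obtain S where S: "f \<in> S" "\<And>g. g \<in> S \<Longrightarrow> \<exists>g'\<in>S. \<forall>x. (g has_field_derivative g' x) (at x)"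
    using assms unfolding smooth_fun_def by blast
  have "(deriv ^^ n) f \<in> S"
  proof (induction n)
    case (Suc n)
    then obtain g' where "g' \<in> S" "\<forall>x. ((deriv ^^ n) f has_field_derivative g' x) (at x)"
      using S(2) by blast
    moreover from this have "deriv ((deriv ^^ n) f) = g'"
      by (auto intro!: ext DERIV_imp_deriv)
    ultimately show ?case by simp
  qed (use S in simp)
  then show ?thesis
    using S(2) field_differentiable_def by blast
qed

lemma smooth_fun_has_derivative:
  assumes "smooth_fun f"
  shows "(f has_field_derivative deriv f x) (at x)"
  using smooth_fun_higher_deriv[OF assms, of 0 x] by (simp add: field_differentiable_derivI)

lemma smooth_fun_continuous:
  assumes "smooth_fun f"
  shows "continuous_on A f"
  by (intro continuous_at_imp_continuous_on ballI DERIV_isCont[OF smooth_fun_has_derivative[OF assms]])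

text \<open>By the Leibniz rule the sums of products of members of \<open>S\<close> and
  \<open>T\<close> are again closed under differentiation.\<close>

inductive_set product_span :: "(real \<Rightarrow> real) set \<Rightarrow> (real \<Rightarrow> real) set \<Rightarrow> (real \<Rightarrow> real) set"
  for S T where
  prod: "f \<in> S \<Longrightarrow> g \<in> T \<Longrightarrow> (\<lambda>x. f x * g x) \<in> product_span S T"
| sum: "f \<in> product_span S T \<Longrightarrow> g \<in> product_span S T \<Longrightarrow> (\<lambda>x. f x + g x) \<in> product_span S T"

lemma smooth_fun_mult:
  assumes "smooth_fun f" "smooth_fun g"
  shows "smooth_fun (\<lambda>x. f x * g x)"
proof -
  obtain S where S: "f \<in> S" "\<And>g. g \<in> S \<Longrightarrow> \<exists>g'\<in>S. \<forall>x. (g has_field_derivative g' x) (at x)"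
    using assms(1) unfolding smooth_fun_def by blast
  obtain T where T: "g \<in> T" "\<And>g. g \<in> T \<Longrightarrow> \<exists>g'\<in>T. \<forall>x. (g has_field_derivative g' x) (at x)"
    using assms(2) unfolding smooth_fun_def by blast
  have "\<exists>h'\<in>product_span S T. \<forall>x. (h has_field_derivative h' x) (at x)"
    if "h \<in> product_span S T" for h
    using that
  proof induction
    case (prod f g)
    then obtain f' g' where 1: "f' \<in> S" "g' \<in> T"
      "\<forall>x. (f has_field_derivative f' x) (at x)" "\<forall>x. (g has_field_derivative g' x) (at x)"
      using S(2) T(2) by metis
    then have "\<forall>x. ((\<lambda>x. f x * g x) has_field_derivative f' x * g x + f x * g' x) (at x)"
      by (auto intro!: derivative_eq_intros)
    moreover have "(\<lambda>x. f' x * g x + f x * g' x) \<in> product_span S T"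
      using prod 1 by (intro product_span.intros)
    ultimately show ?case by (rule_tac bexI)
  next
    case (sum f g)
    then obtain f' g' where 1: "f' \<in> product_span S T" "g' \<in> product_span S T"
      "\<forall>x. (f has_field_derivative f' x) (at x)" "\<forall>x. (g has_field_derivative g' x) (at x)"
      by metis
    then have "\<forall>x. ((\<lambda>x. f x + g x) has_field_derivative f' x + g' x) (at x)"
      by (auto intro!: derivative_eq_intros)
    moreover have "(\<lambda>x. f' x + g' x) \<in> product_span S T"
      using 1 by (intro product_span.sum)
    ultimately show ?case by (rule_tac bexI)
  qed
  moreover have "(\<lambda>x. f x * g x) \<in> product_span S T"
    using S T by (intro product_span.prod)
  ultimately show ?thesis
    unfolding smooth_fun_def by blast
qed

lemma smooth_fun_polynomial: "real_polynomial_function p \<Longrightarrow> smooth_fun p"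
  unfolding smooth_fun_def
  by (intro exI[of _ "Collect real_polynomial_function"] conjI ballI)
    (simp, metis has_real_derivative_polynomial_function mem_Collect_eq)

lemma smooth_fun_const: "smooth_fun (\<lambda>x. c)"
  by (rule smooth_fun_polynomial) (rule real_polynomial_function.intros(2))

lemma smooth_fun_affine_comp:
  assumes "smooth_fun f"
  shows "smooth_fun (\<lambda>x. f (a + b * x))"
proof -
  obtain S where S: "f \<in> S" "\<And>g. g \<in> S \<Longrightarrow> \<exists>g'\<in>S. \<forall>x. (g has_field_derivative g' x) (at x)"
    using assms(1) unfolding smooth_fun_def by blast
  \<comment> \<open>The free factor \<open>c\<close> absorbs the powers of \<open>b\<close> that the
    chain rule produces.\<close>
  define T where "T = {\<lambda>x. c * g (a + b * x) |c g. g \<in> S}"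
  have "\<exists>h'\<in>T. \<forall>x. (h has_field_derivative h' x) (at x)" if h: "h \<in> T" for h
  proof -
    obtain c g where g: "g \<in> S" and hg: "h = (\<lambda>x. c * g (a + b * x))"
      using h by (auto simp: T_def)
    obtain g' where g': "g' \<in> S" "\<And>x. (g has_field_derivative g' x) (at x)"
      using S(2)[OF g] by blast
    have "(h has_field_derivative (c * b) * g' (a + b * x)) (at x)" for x
      unfolding hg by (auto intro!: derivative_eq_intros DERIV_chain2[OF g'(2)])
    moreover have "(\<lambda>x. (c * b) * g' (a + b * x)) \<in> T"
      using g'(1) unfolding T_def by blast
    ultimately show ?thesis by (rule_tac bexI) auto
  qed
  moreover have "(\<lambda>x. f (a + b * x)) \<in> T"
    using S(1) unfolding T_def by (auto intro!: exI[of _ 1] exI[of _ f])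
  ultimately show ?thesis
    unfolding smooth_fun_def by blast
qed

lemma smooth_fun_antiderivative:
  assumes "smooth_fun f'" "\<And>x. (f has_field_derivative f' x) (at x)"
  shows "smooth_fun f"
proof -
  obtain S where "f' \<in> S" "\<And>g. g \<in> S \<Longrightarrow> \<exists>g'\<in>S. \<forall>x. (g has_field_derivative g' x) (at x)"
    using assms(1) unfolding smooth_fun_def by blast
  then show ?thesis
    unfolding smooth_fun_def using assms(2) by (intro exI[of _ "insert f S"]) blast
qed

lemma poly_mult_exp_minus_tendsto_0:
  "((\<lambda>y. poly p y * exp (- y)) \<longlongrightarrow> (0::real)) at_top"
proof -
  have "((\<lambda>y. \<Sum>i\<le>degree p. coeff p i * (y ^ i / exp y)) \<longlongrightarrow> (\<Sum>i\<le>degree p. coeff p i * 0)) at_top"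
    by (intro tendsto_intros tendsto_power_div_exp_0)
  then show ?thesis
    by (simp add: poly_altdef sum_distrib_right exp_minus divide_inverse mult.assoc)
qed

definition flat_exp :: "real \<Rightarrow> real"
  where "flat_exp x = (if x > 0 then exp (- (1 / x)) else 0)"

text \<open>Every derivative has the form p(1/x) exp(-1/x) on the positive axis and 0 elsewhere,
  with a polynomial p; these functions \<open>G p\<close> form the witness set.\<close>

lemma smooth_fun_flat_exp: "smooth_fun flat_exp"
proof -
  define G where "G p x = (if x > 0 then poly p (1 / x) * exp (- (1 / x)) else 0)" for p and x :: real
  \<comment> \<open>With y = 1/x, the derivative of p(y) exp(-y) in x is y^2 (p(y) - p'(y))
    exp(-y).\<close>
  define D where "D p = monom 1 2 * (p - pderiv p)" for p :: "real poly"
  have "(G p has_field_derivative G (D p) x) (at x)" for p x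
  proof (cases x "0 :: real" rule: linorder_cases)
    case less
    have "((\<lambda>_. 0) has_field_derivative 0) (at x)" by simp
    then have "(G p has_field_derivative 0) (at x)"
      by (rule has_field_derivative_transform_within_open[of _ _ _ "{..<0}"])
        (use less in \<open>auto simp: G_def\<close>)
    then show ?thesis using less by (simp add: G_def)
  next
    case greater
    have "((\<lambda>x. poly p (1 / x) * exp (- (1 / x))) has_field_derivative
        poly (D p) (1 / x) * exp (- (1 / x))) (at x)"
      using greater
      by (auto intro!: derivative_eq_intros DERIV_chain2[OF poly_DERIV]
          simp: D_def poly_monom field_simps power2_eq_square)
    then have "(G p has_field_derivative poly (D p) (1 / x) * exp (- (1 / x))) (at x)"
      by (rule has_field_derivative_transform_within_open[of _ _ _ "{0<..}"])
        (use greater in \<open>auto simp: G_def\<close>)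
    then show ?thesis using greater by (simp add: G_def)
  next
    case equal
    \<comment> \<open>The right-hand difference quotient at 0 is y p(y) exp(-y) with y = 1/h, which
      tends to 0 as y grows.\<close>
    have "((\<lambda>h. poly (monom 1 1 * p) (1 / h) * exp (- (1 / h))) \<longlongrightarrow> 0) (at_right 0)"
      by (rule filterlim_compose[OF poly_mult_exp_minus_tendsto_0])
        (simp add: divide_inverse filterlim_inverse_at_top_right)
    then have "((\<lambda>h. (G p h - G p 0) / h) \<longlongrightarrow> 0) (at_right 0)"
      by (rule Lim_transform_eventually)
        (auto simp: eventually_at_filter G_def poly_monom field_simps)
    moreover have "((\<lambda>h. (G p h - G p 0) / h) \<longlongrightarrow> 0) (at_left 0)"
      by (rule tendsto_eventually) (auto simp: eventually_at_filter G_def)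
    ultimately have "((\<lambda>h. (G p h - G p 0) / h) \<longlongrightarrow> 0) (at 0)"
      by (simp add: filterlim_split_at)
    then show ?thesis
      using equal by (simp add: DERIV_def G_def)
  qed
  moreover have "flat_exp = G 1"
    by (auto simp: flat_exp_def G_def)
  ultimately show ?thesis
    unfolding smooth_fun_def by (intro exI[of _ "range G"]) auto
qed

definition smooth_compact :: "(real \<Rightarrow> real) \<Rightarrow> bool"
  where "smooth_compact w \<longleftrightarrow> smooth_fun w \<and> (\<exists>m. \<forall>x. m < \<bar>x\<bar> \<longrightarrow> w x = 0)"

lemma smooth_compact_test_function:
  assumes "smooth_compact w"
  shows "w \<in> test_functions"
proof -
  obtain m where m: "\<And>x. m < \<bar>x\<bar> \<Longrightarrow> w x = 0"
    using assms unfolding smooth_compact_def by blast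
  have "{x. w x \<noteq> 0} \<subseteq> {-m..m}"
    using m by (force simp: abs_le_iff not_less[symmetric])
  then have "bounded {x. w x \<noteq> 0}"
    using bounded_closed_interval bounded_subset by blast
  then show ?thesis
    using assms by (simp add: test_functions_def smooth_fun_higher_deriv smooth_compact_def compact_closure)
qed

text \<open>The variation norm tests only against smooth functions of compact support, while
  eigenvalue counts are merely bounded and measurable. The chain is measurable, continuous,
  polynomial on growing intervals, smoothly cut off, with the bound 1 preserved exactly.\<close>

lemma smooth_compact_approximation:
  fixes w :: "real \<Rightarrow> real"
  assumes w[measurable]: "w \<in> borel_measurable borel" and w1: "\<And>x. \<bar>w x\<bar> \<le> 1"
  obtains f where "\<And>n. smooth_compact (f n)" "\<And>n x. \<bar>f n x\<bar> \<le> 1"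
    "AE x in lborel. (\<lambda>n. f n x) \<longlonglongrightarrow> w x"
proof -
  have "w \<in> borel_measurable (lebesgue_on UNIV)"
    by (simp add: borel_measurable_if_D measurable_completion)
  then have "w measurable_on UNIV"
    by (subst measurable_on_iff_borel_measurable) auto
  then obtain N g where N: "negligible N" and g: "\<And>n. continuous_on UNIV (g n)"
    and lim: "\<And>x. x \<notin> N \<Longrightarrow> (\<lambda>n. g n x) \<longlonglongrightarrow> w x"
    unfolding measurable_on_def by auto
  \<comment> \<open>Clipping restores the bound 1 and does not change the limit, which obeys it
    already.\<close>
  define h where "h n x = max (-1) (min 1 (g n x))" for n x
  have h_cont: "continuous_on A (h n)" for n A
    unfolding h_def[abs_def] by (intro continuous_intros continuous_on_subset[OF g]) auto
  have h1: "\<bar>h n x\<bar> \<le> 1" for n x by (auto simp: h_def)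
  have h_lim: "(\<lambda>n. h n x) \<longlonglongrightarrow> w x" if "x \<notin> N" for x
  proof -
    have "(\<lambda>n. h n x) \<longlonglongrightarrow> max (-1) (min 1 (w x))"
      unfolding h_def by (intro tendsto_intros lim that)
    also have "max (-1) (min 1 (w x)) = w x" using w1[of x] by (auto simp: abs_le_iff)
    finally show ?thesis .
  qed
  have "\<exists>p. real_polynomial_function p \<and> (\<forall>x\<in>{-real (Suc n)..real (Suc n)}. \<bar>h n x - p x\<bar> < 1 / real (Suc n))" for n
    by (rule Stone_Weierstrass_real_polynomial_function[OF _ h_cont]) auto
  then obtain p where p: "\<And>n. real_polynomial_function (p n)"
    and ph: "\<And>n x. \<bar>x\<bar> \<le> real (Suc n) \<Longrightarrow> \<bar>h n x - p n x\<bar> < 1 / real (Suc n)"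
    by (metis abs_le_iff atLeastAtMost_iff minus_le_iff)
  \<comment> \<open>A smooth cutoff that vanishes for |x| \<ge> n + 1. It tends to 1 at every fixed
    point because both arguments of \<open>flat_exp\<close> grow without bound.\<close>
  define c where "c n x = flat_exp (real (Suc n) + (-1) * x) * flat_exp (real (Suc n) + 1 * x)" for n x
  have flat01: "0 \<le> flat_exp x" "flat_exp x \<le> 1" for x by (auto simp: flat_exp_def)
  have c01: "0 \<le> c n x" "c n x \<le> 1" for n x
    unfolding c_def using flat01 by (auto intro: mult_le_one)
  have c0: "c n x = 0" if "real (Suc n) < \<bar>x\<bar>" for n x
    using that by (auto simp: c_def flat_exp_def)
  have c_lim: "(\<lambda>n. c n x) \<longlonglongrightarrow> 1" for x
  proof -
    have f: "(\<lambda>n. flat_exp (real (Suc n) + y)) \<longlonglongrightarrow> 1" for y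
    proof -
      have "(\<lambda>n. exp (- (1 / (real (Suc n) + y)))) \<longlonglongrightarrow> 1"
        by real_asymp
      moreover have "eventually (\<lambda>n. exp (- (1 / (real (Suc n) + y))) = flat_exp (real (Suc n) + y)) sequentially"
        using eventually_ge_at_top[of "nat \<lceil>\<bar>y\<bar>\<rceil>"] 
        by eventually_elim (auto simp: flat_exp_def nat_le_iff ceiling_le_iff, linarith?)
      ultimately show ?thesis by (rule Lim_transform_eventually)
    qed
    show ?thesis
      unfolding c_def using tendsto_mult[OF f[of "-x"] f[of x]] by simp
  qed
  \<comment> \<open>On the interval the polynomial exceeds the bound 1 by at most 1/(n + 1); the
    factor in front compensates for this and tends to 1.\<close>
  define f where "f n x = (1 / (1 + 1 / real (Suc n))) * (p n x * c n x)" for n x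
  have "smooth_fun (c n)" for n
    unfolding c_def[abs_def] by (intro smooth_fun_mult smooth_fun_affine_comp smooth_fun_flat_exp)
  then have "smooth_fun (f n)" for n
    unfolding f_def[abs_def] using p
    by (intro smooth_fun_mult smooth_fun_const) (auto intro: smooth_fun_polynomial)
  moreover have "\<forall>x. real (Suc n) < \<bar>x\<bar> \<longrightarrow> f n x = 0" for n
    by (simp add: f_def c0)
  ultimately have 1: "smooth_compact (f n)" for n
    unfolding smooth_compact_def by blast
  have 2: "\<bar>f n x\<bar> \<le> 1" for n x
  proof (cases "\<bar>x\<bar> \<le> real (Suc n)")
    case False
    then show ?thesis by (simp add: f_def c0)
  next
    case True
    define q where "q = 1 + 1 / real (Suc n)"
    have "q > 0" by (simp add: q_def add_pos_pos)
    have "\<bar>p n x\<bar> \<le> q" using ph[OF True] h1[of n x] unfolding q_def by linarith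
    then have "\<bar>p n x\<bar> * c n x \<le> q * 1" using c01[of n x] \<open>q > 0\<close> by (intro mult_mono) auto
    then show ?thesis
      using \<open>q > 0\<close> c01[of n x] unfolding f_def q_def[symmetric] by (simp add: abs_mult field_simps)
  qed
  have 3: "(\<lambda>n. f n x) \<longlonglongrightarrow> w x" if "x \<notin> N" for x
  proof -
    have "(\<lambda>n. h n x - p n x) \<longlonglongrightarrow> 0"
    proof (rule Lim_null_comparison)
      show "eventually (\<lambda>n. norm (h n x - p n x) \<le> 1 / real (Suc n)) sequentially"
        using eventually_ge_at_top[of "nat \<lceil>\<bar>x\<bar>\<rceil>"]
      proof eventually_elim
        case (elim n)
        then have "\<bar>x\<bar> \<le> real (Suc n)" by linarith
        then show ?case using ph[of x n] by simp
      qed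
      show "(\<lambda>n. 1 / real (Suc n)) \<longlonglongrightarrow> 0" by real_asymp
    qed
    from tendsto_diff[OF h_lim[OF that] this] have p_lim: "(\<lambda>n. p n x) \<longlonglongrightarrow> w x" by simp
    have "(\<lambda>n. 1 / (1 + 1 / real (Suc n))) \<longlonglongrightarrow> 1" by real_asymp
    from tendsto_mult[OF this tendsto_mult[OF p_lim c_lim]] show ?thesis
      unfolding f_def by simp
  qed
  obtain N' where "N' \<in> null_sets lborel" "N \<subseteq> N'"
    using N unfolding negligible_iff_null_sets null_sets_completion_iff2 by blast
  then have "AE x in lborel. (\<lambda>n. f n x) \<longlonglongrightarrow> w x"
    using 3 by (intro AE_I'[of N']) auto
  with 1 2 show thesis by (rule that)
qed

section \<open>The variation norm controls translates\<close>

lemma var_norm_nonneg: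
  assumes "\<rho> \<in> BV"
  shows "0 \<le> var_norm \<rho>"
proof -
  have "smooth_compact (\<lambda>x. 0)"
    unfolding smooth_compact_def by (simp add: smooth_fun_const)
  then have "(\<lambda>x. 0) \<in> test_functions"
    by (rule smooth_compact_test_function)
  then have "(\<integral>x. \<rho> x * deriv (\<lambda>x. 0) x \<partial>lborel) \<in> variation_integrals \<rho>"
    unfolding variation_integrals_def by (intro CollectI exI[of _ "\<lambda>x. 0"]) simp
  then have "0 \<in> variation_integrals \<rho>"
    by simp
  then show ?thesis
    unfolding var_norm_def using assms by (auto simp: BV_def intro: cSup_upper)
qed

lemma has_field_derivative_scaled_difference:
  fixes g :: "real \<Rightarrow> real"
  assumes "\<And>x. (g has_field_derivative g' x) (at x)"
  shows "((\<lambda>x. c * (g (x + a) - g x)) has_field_derivative c * (g' (x + a) - g' x)) (at x)"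
  by (intro DERIV_cmult DERIV_diff assms) (simp flip: DERIV_shift add: assms)

text \<open>Up to sign, \<open>v x\<close> is the mean of \<open>w\<close> over the segment from
  \<open>x\<close> to \<open>x + a\<close>. It is therefore an admissible test function bounded by
  1, and its derivative is the difference of \<open>w\<close> and its translate divided by
  |a|.\<close>

lemma smooth_translation_bound:
  assumes \<rho>: "\<rho> \<in> BV" and w: "smooth_compact w" and w1: "\<And>x. \<bar>w x\<bar> \<le> 1"
  shows "(\<integral>x. \<rho> x * (w (x + a) - w x) \<partial>lborel) \<le> \<bar>a\<bar> * var_norm \<rho>"
proof (cases "a = 0")
  case True
  show ?thesis by (simp add: True)
next
  case False
  obtain m where m: "\<And>x. m < \<bar>x\<bar> \<Longrightarrow> w x = 0" and sw: "smooth_fun w"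
    using w unfolding smooth_compact_def by blast
  have "\<exists>F. \<forall>x::real. -\<infinity> < ereal x \<longrightarrow> ereal x < \<infinity> \<longrightarrow> (F has_vector_derivative w x) (at x)"
    by (rule einterval_antiderivative)
      (use smooth_fun_continuous[OF sw, of UNIV] in \<open>auto simp: continuous_on_eq_continuous_at\<close>)
  then obtain W where W: "\<And>x. (W has_field_derivative w x) (at x)"
    by (auto simp: has_real_derivative_iff_has_vector_derivative)
  have W_bound: "\<bar>W (x + a) - W x\<bar> \<le> B * \<bar>a\<bar>"
    if "\<And>y. y \<in> closed_segment x (x + a) \<Longrightarrow> \<bar>w y\<bar> \<le> B" for x B
    using field_differentiable_bound[of "closed_segment x (x + a)" W w B "x + a" x] that W
    by (auto intro: DERIV_subset)
  define v where "v x = (1 / \<bar>a\<bar>) * (W (x + a) - W x)" for x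
  have v': "(v has_field_derivative (1 / \<bar>a\<bar>) * (w (x + a) - w x)) (at x)" for x
    unfolding v_def[abs_def] by (rule has_field_derivative_scaled_difference[OF W])
  have sW: "smooth_fun W"
    by (rule smooth_fun_antiderivative[OF sw W])
  have "smooth_fun v"
  proof -
    obtain S where S: "W \<in> S" "\<And>g. g \<in> S \<Longrightarrow> \<exists>g'\<in>S. \<forall>x. (g has_field_derivative g' x) (at x)"
      using sW unfolding smooth_fun_def by blast
    \<comment> \<open>Differentiation commutes with translation, so the scaled differences of
      members of \<open>S\<close> are closed under it.\<close>
    define T where "T = (\<lambda>g x. (1 / \<bar>a\<bar>) * (g (x + a) - g x)) ` S"
    have "\<exists>h'\<in>T. \<forall>x. (h has_field_derivative h' x) (at x)" if h: "h \<in> T" for h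
    proof -
      obtain g where g: "g \<in> S" "h = (\<lambda>x. (1 / \<bar>a\<bar>) * (g (x + a) - g x))"
        using h unfolding T_def by blast
      obtain g' where g': "g' \<in> S" "\<And>x. (g has_field_derivative g' x) (at x)"
        using S(2)[OF g(1)] by blast
      have "(h has_field_derivative (1 / \<bar>a\<bar>) * (g' (x + a) - g' x)) (at x)" for x
        unfolding g(2) by (rule has_field_derivative_scaled_difference[OF g'(2)])
      moreover have "(\<lambda>x. (1 / \<bar>a\<bar>) * (g' (x + a) - g' x)) \<in> T"
        unfolding T_def using g'(1) by (rule imageI)
      ultimately show ?thesis
        by (intro bexI[of _ "\<lambda>x. (1 / \<bar>a\<bar>) * (g' (x + a) - g' x)"]) auto
    qed
    moreover have "v \<in> T" unfolding T_def v_def[abs_def] using S(1) by (rule imageI)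
    ultimately show ?thesis unfolding smooth_fun_def by blast
  qed
  moreover have "v x = 0" if "m + \<bar>a\<bar> < \<bar>x\<bar>" for x
  proof -
    \<comment> \<open>Beyond the support of \<open>w\<close> enlarged by |a| the whole segment of
      averaging misses the support, so \<open>v\<close> has compact support.\<close>
    have "w y = 0" if "y \<in> closed_segment x (x + a)" for y
      using that \<open>m + \<bar>a\<bar> < \<bar>x\<bar>\<close> by (intro m) (auto simp: closed_segment_eq_real_ivl split: if_splits)
    then show ?thesis using W_bound[of x 0] by (simp add: v_def)
  qed
  ultimately have "smooth_compact v"
    unfolding smooth_compact_def by blast
  moreover have "\<bar>v x\<bar> \<le> 1" for x
    using W_bound[of x 1] w1 False by (simp add: v_def abs_mult field_simps)
  ultimately have "(\<integral>x. \<rho> x * deriv v x \<partial>lborel) \<in> variation_integrals \<rho>"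
    unfolding variation_integrals_def using smooth_compact_test_function by blast
  then have "(\<integral>x. \<rho> x * deriv v x \<partial>lborel) \<le> var_norm \<rho>"
    unfolding var_norm_def using \<rho> by (auto simp: BV_def intro: cSup_upper)
  also have "(\<lambda>x. \<rho> x * deriv v x) = (\<lambda>x. (\<rho> x * (w (x + a) - w x)) / \<bar>a\<bar>)"
    using DERIV_imp_deriv[OF v'] by auto
  finally show ?thesis using False by (simp add: field_simps)
qed

lemma integral_mult_translate:
  fixes f g :: "real \<Rightarrow> real"
  shows "(\<integral>x. f x * g (x + a) \<partial>lborel) = (\<integral>x. f (x - a) * g x \<partial>lborel)"
  using lborel_integral_real_affine[of 1 "\<lambda>x. f (x - a) * g x" a] by (simp add: add.commute)

lemma translation_bound:
  fixes g :: "real \<Rightarrow> real"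
  assumes \<rho>: "\<rho> \<in> BV" and g[measurable]: "g \<in> borel_measurable borel" and M: "\<And>x. \<bar>g x\<bar> \<le> M"
  shows "(\<integral>x. \<rho> x * g (x + a) \<partial>lborel) - (\<integral>x. \<rho> x * g x \<partial>lborel) \<le> M * \<bar>a\<bar> * var_norm \<rho>"
proof -
  have \<rho>_int: "integrable lborel \<rho>" using \<rho> by (simp add: BV_def)
  have \<rho>a_int: "integrable lborel (\<lambda>x. \<rho> (x - a))"
    using lborel_integrable_real_affine[OF \<rho>_int, of 1 "-a"] by simp
  have meas[measurable]: "\<rho> \<in> borel_measurable borel" using \<rho>_int by auto
  have int: "integrable lborel (\<lambda>x. \<rho>' x * w x)"
    if "integrable lborel \<rho>'" "w \<in> borel_measurable borel" "\<And>x. \<bar>w x\<bar> \<le> 1" for \<rho>' w :: "real \<Rightarrow> real"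
    using that by (intro Bochner_Integration.integrable_bound[OF that(1)])
      (auto simp: abs_mult mult_left_le)
  have "M \<ge> 0" using M[of 0] by linarith
  have unit: "(\<integral>x. (\<rho> (x - a) - \<rho> x) * w x \<partial>lborel) \<le> \<bar>a\<bar> * var_norm \<rho>"
    if w[measurable]: "w \<in> borel_measurable borel" and w1: "\<And>x. \<bar>w x\<bar> \<le> 1" for w
  proof -
    obtain f where f: "\<And>n. smooth_compact (f n)" "\<And>n x. \<bar>f n x\<bar> \<le> 1"
      and lim: "AE x in lborel. (\<lambda>n. f n x) \<longlonglongrightarrow> w x"
      using smooth_compact_approximation[OF w w1] by blast
    have [measurable]: "f n \<in> borel_measurable borel" for n
      using f(1)[of n] by (intro borel_measurable_continuous_onI smooth_fun_continuous) (simp add: smooth_compact_def)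
    \<comment> \<open>The translation is carried by \<rho>, so the approximants enter at the point x
      alone and the dominating function is independent of n.\<close>
    have "(\<lambda>n. \<integral>x. (\<rho> (x - a) - \<rho> x) * f n x \<partial>lborel) \<longlonglongrightarrow> (\<integral>x. (\<rho> (x - a) - \<rho> x) * w x \<partial>lborel)"
    proof (rule integral_dominated_convergence[where w = "\<lambda>x. \<bar>\<rho> (x - a) - \<rho> x\<bar>"])
      show "AE x in lborel. (\<lambda>n. (\<rho> (x - a) - \<rho> x) * f n x) \<longlonglongrightarrow> (\<rho> (x - a) - \<rho> x) * w x"
        using lim by eventually_elim (intro tendsto_intros)
    qed (use \<rho>_int \<rho>a_int f(2) in \<open>auto simp: abs_mult mult_left_le\<close>)
    moreover have "(\<integral>x. (\<rho> (x - a) - \<rho> x) * f n x \<partial>lborel) \<le> \<bar>a\<bar> * var_norm \<rho>" for n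
    proof -
      have "(\<integral>x. (\<rho> (x - a) - \<rho> x) * f n x \<partial>lborel) =
          (\<integral>x. \<rho> (x - a) * f n x \<partial>lborel) - (\<integral>x. \<rho> x * f n x \<partial>lborel)"
        unfolding left_diff_distrib by (intro Bochner_Integration.integral_diff int \<rho>_int \<rho>a_int f(2)) auto
      \<comment> \<open>Now the translation is moved back onto the approximant, where the bound for
        smooth functions applies.\<close>
      also have "\<dots> = (\<integral>x. \<rho> x * (f n (x + a) - f n x) \<partial>lborel)"
        unfolding right_diff_distrib integral_mult_translate[symmetric]
        by (intro Bochner_Integration.integral_diff[symmetric] int \<rho>_int f(2)) auto
      also have "\<dots> \<le> \<bar>a\<bar> * var_norm \<rho>"
        by (rule smooth_translation_bound[OF \<rho> f])
      finally show ?thesis .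
    qed
    ultimately show ?thesis
      by (intro LIMSEQ_le_const2) auto
  qed
  show ?thesis
  proof (cases "M = 0")
    case True
    then have "g x = 0" for x using M[of x] by simp
    then show ?thesis using True by simp
  next
    case False
    then have "M > 0" using \<open>M \<ge> 0\<close> by simp
    define w where "w x = g x / M" for x
    have w[measurable]: "w \<in> borel_measurable borel" unfolding w_def by simp
    have w1: "\<bar>w x\<bar> \<le> 1" for x using M[of x] \<open>M > 0\<close> by (simp add: w_def)
    have gw: "g = (\<lambda>x. M * w x)" using \<open>M > 0\<close> by (simp add: w_def)
    have "(\<integral>x. (\<rho> (x - a) - \<rho> x) * w x \<partial>lborel) =
        (\<integral>x. \<rho> (x - a) * w x \<partial>lborel) - (\<integral>x. \<rho> x * w x \<partial>lborel)"
      unfolding left_diff_distrib by (intro Bochner_Integration.integral_diff int \<rho>_int \<rho>a_int w1) auto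
    then have "(\<integral>x. \<rho> x * w (x + a) \<partial>lborel) - (\<integral>x. \<rho> x * w x \<partial>lborel) \<le> \<bar>a\<bar> * var_norm \<rho>"
      using unit[OF w w1] by (simp add: integral_mult_translate)
    then have "M * ((\<integral>x. \<rho> x * w (x + a) \<partial>lborel) - (\<integral>x. \<rho> x * w x \<partial>lborel)) \<le> M * (\<bar>a\<bar> * var_norm \<rho>)"
      using \<open>M \<ge> 0\<close> by (rule mult_left_mono)
    then show ?thesis
      unfolding gw mult.left_commute[of _ M] by (simp add: right_diff_distrib mult.assoc)
  qed
qed

section \<open>Translates of product measures\<close>

lemma density_translation_bound:
  fixes g :: "real \<Rightarrow> real"
  assumes \<mu>: "has_density \<mu> \<rho>" and \<rho>: "\<rho> \<in> BV"
    and g[measurable]: "g \<in> borel_measurable borel" and M: "\<And>x. \<bar>g x\<bar> \<le> M"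
  shows "(\<integral>x. g (x + a) \<partial>\<mu>) - (\<integral>x. g x \<partial>\<mu>) \<le> M * \<bar>a\<bar> * var_norm \<rho>"
proof -
  have [measurable]: "\<rho> \<in> borel_measurable borel" and nn: "AE x in lborel. 0 \<le> \<rho> x"
    and \<mu>_eq: "\<mu> = density lborel (\<lambda>x. ennreal (\<rho> x))"
    using \<mu> by (auto simp: has_density_def)
  have "(\<integral>x. f x \<partial>\<mu>) = (\<integral>x. \<rho> x * f x \<partial>lborel)" if [measurable]: "f \<in> borel_measurable borel" for f :: "real \<Rightarrow> real"
    unfolding \<mu>_eq by (subst integral_density) (auto simp: nn)
  then show ?thesis
    using translation_bound[OF \<rho> g M] by simp
qed

text \<open>Points of the product space are \<open>undefined\<close> outside \<Gamma>; shifting only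
  coordinates in \<open>S\<close> keeps them so.\<close>

lemma measurable_shift:
  fixes s :: "'k \<Rightarrow> real"
  assumes "S \<subseteq> \<Gamma>"
  shows "(\<lambda>\<eta> k. if k \<in> S then \<eta> k + s k else \<eta> k) \<in> PiM \<Gamma> (\<lambda>_. borel) \<rightarrow>\<^sub>M PiM \<Gamma> (\<lambda>_. borel)"
  using assms by (intro measurable_PiM_single') (auto simp: space_PiM PiE_def extensional_def)

text \<open>Fubini isolates the coordinate \<open>k\<close>. For each fixed choice of the others the
  one-dimensional bound holds with the same constant, and integration against a probability measure
  preserves it.\<close>

lemma product_coordinate_bound:
  fixes f :: "('k \<Rightarrow> real) \<Rightarrow> real"
  assumes \<mu>: "prob_space \<mu>" "has_density \<mu> \<rho>" and \<rho>: "\<rho> \<in> BV"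
    and \<Gamma>: "finite \<Gamma>" "k \<in> \<Gamma>"
    and f[measurable]: "f \<in> borel_measurable (PiM \<Gamma> (\<lambda>_. borel))" and M: "\<And>x. \<bar>f x\<bar> \<le> M"
  shows "(\<integral>\<eta>. f (\<eta>(k := \<eta> k + a)) \<partial>PiM \<Gamma> (\<lambda>_. \<mu>)) - (\<integral>\<eta>. f \<eta> \<partial>PiM \<Gamma> (\<lambda>_. \<mu>)) \<le> M * \<bar>a\<bar> * var_norm \<rho>"
proof -
  interpret prob_space \<mu> by (rule \<mu>)
  interpret product_sigma_finite "\<lambda>_. \<mu>" by standard
  have sets_\<mu>[measurable_cong, simp]: "sets \<mu> = sets borel"
    using \<mu>(2) by (simp add: has_density_def)
  have sets_P: "sets (PiM J (\<lambda>_. \<mu>)) = sets (PiM J (\<lambda>_. borel :: real measure))" for J :: "'k set"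
    by (intro sets_PiM_cong) auto
  define J where "J = \<Gamma> - {k}"
  have J: "finite J" "k \<notin> J" "\<Gamma> = insert k J" using \<Gamma> by (auto simp: J_def)
  have prob: "prob_space (PiM J' (\<lambda>_. \<mu>))" for J' :: "'k set"
    by (intro prob_space_PiM \<mu>)
  have fin: "finite_measure (PiM J' (\<lambda>_. \<mu>))" for J' :: "'k set"
    using prob[of J'] prob_space.finite_measure by blast
  have meas: "f \<in> borel_measurable (PiM (insert k J) (\<lambda>_. \<mu>))"
    using f unfolding J(3) measurable_cong_sets[OF sets_P refl] .
  have shift_meas: "(\<lambda>\<eta>. f (\<eta>(k := \<eta> k + a))) \<in> borel_measurable (PiM (insert k J) (\<lambda>_. \<mu>))"
  proof -
    have "(\<lambda>\<eta>. \<eta>(k := \<eta> k + a)) = (\<lambda>\<eta> j. if j \<in> {k} then \<eta> j + a else \<eta> j)"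
      by (simp add: fun_eq_iff)
    then have "(\<lambda>\<eta>. \<eta>(k := \<eta> k + a)) \<in> PiM (insert k J) (\<lambda>_. \<mu>) \<rightarrow>\<^sub>M PiM (insert k J) (\<lambda>_. \<mu>)"
      using measurable_shift[of "{k}" "insert k J" "\<lambda>_. a"] by (simp add: measurable_cong_sets[OF sets_P sets_P])
    from measurable_compose[OF this meas] show ?thesis .
  qed
  have int: "integrable N h" if "finite_measure N" "h \<in> borel_measurable N" "\<And>x. \<bar>h x\<bar> \<le> M" for N and h :: "'c \<Rightarrow> real"
    using finite_measure.integrable_const_bound[OF that(1) _ that(2), of M] that(3) by simp
  have slice: "(\<lambda>y. f (x(k := y))) \<in> borel_measurable borel" if "x \<in> space (PiM J (\<lambda>_. \<mu>))" for x
  proof -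
    have "(\<lambda>y. x(k := y)) \<in> \<mu> \<rightarrow>\<^sub>M PiM (insert k J) (\<lambda>_. \<mu>)"
      by (rule measurable_component_update[OF that J(2)])
    from measurable_compose[OF this meas] show ?thesis
      by (simp add: measurable_cong_sets[OF sets_\<mu> refl])
  qed
  have 1: "(\<integral>\<eta>. f \<eta> \<partial>PiM \<Gamma> (\<lambda>_. \<mu>)) = (\<integral>x. (\<integral>y. f (x(k := y)) \<partial>\<mu>) \<partial>PiM J (\<lambda>_. \<mu>))"
    unfolding J(3) by (intro product_integral_insert J int fin meas M)
  have 2: "(\<integral>\<eta>. f (\<eta>(k := \<eta> k + a)) \<partial>PiM \<Gamma> (\<lambda>_. \<mu>)) = (\<integral>x. (\<integral>y. f (x(k := y + a)) \<partial>\<mu>) \<partial>PiM J (\<lambda>_. \<mu>))"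
    unfolding J(3) by (subst product_integral_insert) (auto intro!: J int fin shift_meas M)
  \<comment> \<open>For a non-integrable \<open>h\<close> the integral is 0 by convention, so the
    bound needs no measurability.\<close>
  have abs_le: "\<bar>\<integral>y. h y \<partial>\<mu>\<bar> \<le> M" if "\<And>y. \<bar>h y\<bar> \<le> M" for h :: "real \<Rightarrow> real"
  proof -
    have "0 \<le> M" using that[of 0] by linarith
    show ?thesis
    proof (cases "integrable \<mu> h")
      case True
      have "\<bar>\<integral>y. h y \<partial>\<mu>\<bar> \<le> (\<integral>y. \<bar>h y\<bar> \<partial>\<mu>)" by simp
      also have "\<dots> \<le> M" using True that by (intro integral_le_const) auto
      finally show ?thesis .
    qed (use \<open>0 \<le> M\<close> in \<open>simp add: not_integrable_integral_eq\<close>)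
  qed
  have [measurable]: "case_prod (\<lambda>x y. f (x(k := y))) \<in> borel_measurable (PiM J (\<lambda>_. \<mu>) \<Otimes>\<^sub>M \<mu>)"
    using measurable_compose[OF measurable_add_dim[of k J "\<lambda>_. \<mu>"] meas] by (simp add: split_beta')
  have [measurable]: "case_prod (\<lambda>x y. f (x(k := y + a))) \<in> borel_measurable (PiM J (\<lambda>_. \<mu>) \<Otimes>\<^sub>M \<mu>)"
  proof -
    have "(\<lambda>p. (fst p, snd p + a)) \<in> PiM J (\<lambda>_. \<mu>) \<Otimes>\<^sub>M \<mu> \<rightarrow>\<^sub>M PiM J (\<lambda>_. \<mu>) \<Otimes>\<^sub>M \<mu>"
      by measurable
    from measurable_compose[OF this measurable_compose[OF measurable_add_dim[of k J "\<lambda>_. \<mu>"] meas]]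
    show ?thesis by (simp add: split_beta')
  qed
  have int1: "integrable (PiM J (\<lambda>_. \<mu>)) (\<lambda>x. \<integral>y. f (x(k := y)) \<partial>\<mu>)"
    by (intro int fin abs_le M) measurable
  have int2: "integrable (PiM J (\<lambda>_. \<mu>)) (\<lambda>x. \<integral>y. f (x(k := y + a)) \<partial>\<mu>)"
    by (intro int fin abs_le M) measurable
  have "(\<integral>x. (\<integral>y. f (x(k := y + a)) \<partial>\<mu>) - (\<integral>y. f (x(k := y)) \<partial>\<mu>) \<partial>PiM J (\<lambda>_. \<mu>)) \<le> M * \<bar>a\<bar> * var_norm \<rho>"
  proof (rule prob_space.integral_le_const[OF prob])
    show "AE x in PiM J (\<lambda>_. \<mu>). (\<integral>y. f (x(k := y + a)) \<partial>\<mu>) - (\<integral>y. f (x(k := y)) \<partial>\<mu>) \<le> M * \<bar>a\<bar> * var_norm \<rho>"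
      by (intro AE_I2 density_translation_bound[OF \<mu>(2) \<rho> slice M])
  qed (intro Bochner_Integration.integrable_diff int1 int2)
  then show ?thesis
    unfolding 1 2 by (simp add: Bochner_Integration.integral_diff[OF int2 int1])
qed

text \<open>The coordinates are shifted one at a time and the differences telescope; each step is
  the bound for a single coordinate, applied to a function that has already been shifted in the
  earlier ones.\<close>

lemma product_translation_bound:
  fixes f :: "('k \<Rightarrow> real) \<Rightarrow> real"
  assumes \<mu>: "prob_space \<mu>" "has_density \<mu> \<rho>" and \<rho>: "\<rho> \<in> BV"
    and \<Gamma>: "finite \<Gamma>" "S \<subseteq> \<Gamma>"
    and f: "f \<in> borel_measurable (PiM \<Gamma> (\<lambda>_. borel))" and M: "\<And>x. \<bar>f x\<bar> \<le> M"
  shows "(\<integral>\<eta>. f (\<lambda>k. if k \<in> S then \<eta> k + s k else \<eta> k) \<partial>PiM \<Gamma> (\<lambda>_. \<mu>)) - (\<integral>\<eta>. f \<eta> \<partial>PiM \<Gamma> (\<lambda>_. \<mu>))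
    \<le> M * (\<Sum>k\<in>S. \<bar>s k\<bar>) * var_norm \<rho>"
  using finite_subset[OF \<Gamma>(2,1)] \<Gamma>(2)
proof (induction S rule: finite_induct)
  case empty
  then show ?case by simp
next
  case (insert k S)
  define h where "h \<eta> = f (\<lambda>k. if k \<in> S then \<eta> k + s k else \<eta> k)" for \<eta>
  from measurable_compose[OF measurable_shift f] have h: "h \<in> borel_measurable (PiM \<Gamma> (\<lambda>_. borel))"
    using insert.prems by (simp add: h_def[abs_def])
  have "h (\<eta>(k := \<eta> k + s k)) = f (\<lambda>j. if j \<in> insert k S then \<eta> j + s j else \<eta> j)" for \<eta>
    unfolding h_def by (rule arg_cong[of _ _ f]) (use insert.hyps in auto)
  then have "(\<integral>\<eta>. f (\<lambda>j. if j \<in> insert k S then \<eta> j + s j else \<eta> j) \<partial>PiM \<Gamma> (\<lambda>_. \<mu>)) - (\<integral>\<eta>. h \<eta> \<partial>PiM \<Gamma> (\<lambda>_. \<mu>))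
      \<le> M * \<bar>s k\<bar> * var_norm \<rho>"
    using product_coordinate_bound[OF \<mu> \<rho> \<Gamma>(1) _ h, of k M "s k"] M insert.prems by (simp add: h_def)
  then show ?case
    using insert by (simp add: h_def algebra_simps)
qed

section \<open>Laurent series on the lattice\<close>

lemma sum_exp_int_le:
  assumes \<gamma>: "\<gamma> > 0" and F: "finite F"
  shows "(\<Sum>n\<in>F. exp (- \<gamma> * \<bar>real_of_int n\<bar>)) \<le> 2 / (1 - exp (- \<gamma>))"
proof -
  define q where "q = exp (- \<gamma>)"
  have q: "0 < q" "q < 1" using \<gamma> by (auto simp: q_def)
  have half: "(\<Sum>n\<in>G. q ^ nat \<bar>n\<bar>) \<le> 1 / (1 - q)"
    if "finite G" "inj_on (\<lambda>n. nat \<bar>n\<bar>) G" for G :: "int set"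
  proof -
    have "(\<Sum>n\<in>G. q ^ nat \<bar>n\<bar>) = (\<Sum>n\<in>(\<lambda>n. nat \<bar>n\<bar>) ` G. q ^ n)"
      using that by (simp add: sum.reindex)
    also have "\<dots> \<le> (\<Sum>n. q ^ n)"
      using q that by (intro sum_le_suminf summable_geometric) auto
    finally show ?thesis using q by (simp add: suminf_geometric)
  qed
  have "exp (- \<gamma> * \<bar>real_of_int n\<bar>) = q ^ nat \<bar>n\<bar>" for n
    by (simp add: q_def mult.commute flip: exp_of_nat_mult)
  then have "(\<Sum>n\<in>F. exp (- \<gamma> * \<bar>real_of_int n\<bar>)) = (\<Sum>n\<in>F. q ^ nat \<bar>n\<bar>)" by simp
  also have "\<dots> = (\<Sum>n\<in>(F \<inter> {0..}) \<union> (F \<inter> {..<0}). q ^ nat \<bar>n\<bar>)"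
    by (rule arg_cong[of _ _ "sum _"]) auto
  also have "\<dots> = (\<Sum>n\<in>F \<inter> {0..}. q ^ nat \<bar>n\<bar>) + (\<Sum>n\<in>F \<inter> {..<0}. q ^ nat \<bar>n\<bar>)"
    using F by (intro sum.union_disjoint) auto
  also have "\<dots> \<le> 1 / (1 - q) + 1 / (1 - q)"
    using F by (intro add_mono half) (auto simp: inj_on_def)
  finally show ?thesis by (simp add: q_def)
qed

lemma exp_int_summable:
  assumes "\<gamma> > 0"
  shows "(\<lambda>n. exp (- \<gamma> * \<bar>real_of_int n\<bar>)) summable_on A"
  by (intro nonneg_bounded_partial_sums_imp_summable_on[where C = "2 / (1 - exp (- \<gamma>))"]
      eventually_finite_subsets_at_top_weakI sum_exp_int_le assms) auto

definition int_box :: "nat \<Rightarrow> (int ^ 'd::finite) set"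
  where "int_box r = {k. \<forall>i. \<bar>k $ i\<bar> \<le> int r}"

lemma int_box_eq_image: "int_box r = vec_lambda ` (UNIV \<rightarrow>\<^sub>E {- int r..int r})"
proof (intro equalityI subsetI)
  fix k :: "int ^ 'd" assume "k \<in> int_box r"
  then have "vec_nth k \<in> UNIV \<rightarrow>\<^sub>E {- int r..int r}" "k = vec_lambda (vec_nth k)"
    by (auto simp: int_box_def abs_le_iff minus_le_iff)
  then show "k \<in> vec_lambda ` (UNIV \<rightarrow>\<^sub>E {- int r..int r})" by blast
next
  fix k :: "int ^ 'd" assume "k \<in> vec_lambda ` (UNIV \<rightarrow>\<^sub>E {- int r..int r})"
  then obtain g where "g \<in> UNIV \<rightarrow>\<^sub>E {- int r..int r}" "k = vec_lambda g" by blast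
  then show "k \<in> int_box r"
    by (auto simp: int_box_def abs_le_iff PiE_iff minus_le_iff)
qed

lemma finite_int_box: "finite (int_box r :: (int ^ 'd::finite) set)"
  unfolding int_box_eq_image by (intro finite_imageI finite_PiE) auto

lemma inj_vec_lambda: "inj_on vec_lambda A"
  by (rule inj_onI) (metis vec_lambda_inverse UNIV_I)

lemma card_int_box: "card (int_box r :: (int ^ 'd::finite) set) = (2 * r + 1) ^ CARD('d)"
  unfolding int_box_eq_image
  by (subst card_image[OF inj_vec_lambda], subst card_PiE) (auto simp: nat_add_distrib nat_mult_distrib)

lemma finite_subset_int_box:
  assumes "finite F"
  obtains r where "F \<subseteq> (int_box r :: (int ^ 'd::finite) set)"
proof -
  define r where "r = (\<Sum>k\<in>F. \<Sum>i\<in>UNIV. nat \<bar>k $ i\<bar>)"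
  have "nat \<bar>k $ i\<bar> \<le> r" if "k \<in> F" for k i
  proof -
    have "nat \<bar>k $ i\<bar> \<le> (\<Sum>i\<in>UNIV. nat \<bar>k $ i\<bar>)"
      by (rule member_le_sum) auto
    also have "\<dots> \<le> r"
      unfolding r_def using assms that by (intro member_le_sum) auto
    finally show ?thesis .
  qed
  then have "F \<subseteq> int_box r" by (force simp: int_box_def nat_le_iff)
  then show thesis by (rule that)
qed

lemma exp_lattice_norm:
  "exp (- \<gamma> * real_of_int (lattice_norm k)) = (\<Prod>i\<in>UNIV. exp (- \<gamma> * \<bar>real_of_int (k $ i)\<bar>))"
  by (simp add: lattice_norm_def sum_distrib_left sum_negf exp_sum[symmetric] flip: of_int_abs)

text \<open>A finite set of lattice points lies in a box, and over a box the sum factors into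
  one-dimensional geometric sums, whose bound does not depend on the box.\<close>

lemma exp_lattice_norm_summable:
  assumes \<gamma>: "\<gamma> > 0"
  shows "(\<lambda>k :: int ^ 'd::finite. exp (- \<gamma> * real_of_int (lattice_norm k))) summable_on A"
proof (rule nonneg_bounded_partial_sums_imp_summable_on)
  show "eventually (\<lambda>F. (\<Sum>k\<in>F. exp (- \<gamma> * real_of_int (lattice_norm k))) \<le> (2 / (1 - exp (- \<gamma>))) ^ CARD('d))
      (finite_subsets_at_top A)"
  proof (rule eventually_finite_subsets_at_top_weakI)
    fix F :: "(int ^ 'd) set" assume "finite F"
    then obtain r where r: "F \<subseteq> int_box r" by (rule finite_subset_int_box)
    have "(\<Sum>k\<in>F. exp (- \<gamma> * real_of_int (lattice_norm k)))
        \<le> (\<Sum>k\<in>(int_box r :: (int ^ 'd) set). \<Prod>i\<in>UNIV. exp (- \<gamma> * \<bar>real_of_int (k $ i)\<bar>))"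
      unfolding exp_lattice_norm by (intro sum_mono2 finite_int_box r) (auto intro: prod_nonneg)
    also have "\<dots> = (\<Sum>g\<in>(UNIV \<rightarrow>\<^sub>E {- int r..int r}). \<Prod>i\<in>(UNIV :: 'd set). exp (- \<gamma> * \<bar>real_of_int (g i)\<bar>))"
      unfolding int_box_eq_image by (subst sum.reindex[OF inj_vec_lambda]) (simp add: o_def)
    also have "\<dots> = (\<Prod>i\<in>(UNIV :: 'd set). \<Sum>n\<in>{- int r..int r}. exp (- \<gamma> * \<bar>real_of_int n\<bar>))"
      by (rule prod_sum_PiE[symmetric]) auto
    also have "\<dots> \<le> (\<Prod>i\<in>(UNIV :: 'd set). 2 / (1 - exp (- \<gamma>)))"
      by (intro prod_mono conjI sum_nonneg sum_exp_int_le \<gamma>) auto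
    finally show "(\<Sum>k\<in>F. exp (- \<gamma> * real_of_int (lattice_norm k))) \<le> (2 / (1 - exp (- \<gamma>))) ^ CARD('d)"
      by simp
  qed
qed auto

text \<open>The falling factorial x (x - 1) ... (x - n + 1), for x of either sign: the coefficient
  that n differentiations of w^x produce.\<close>

definition falling :: "int \<Rightarrow> nat \<Rightarrow> int"
  where "falling x n = (\<Prod>j<n. x - int j)"

lemma falling_0: "falling x 0 = 1"
  and falling_Suc: "falling x (Suc n) = falling x n * (x - int n)"
  by (simp_all add: falling_def)

lemma abs_falling_le: "\<bar>falling x n\<bar> \<le> (\<bar>x\<bar> + int n) ^ n"
proof -
  have "\<bar>falling x n\<bar> = (\<Prod>j<n. \<bar>x - int j\<bar>)" by (simp add: falling_def abs_prod)
  also have "\<dots> \<le> (\<Prod>j<n. \<bar>x\<bar> + int n)" by (intro prod_mono) auto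
  finally show ?thesis by simp
qed

lemma power_le_fact_exp:
  fixes y :: real
  assumes "y \<ge> 0"
  shows "y ^ m \<le> fact m * exp y"
proof -
  have "(\<Sum>n\<in>{m}. y ^ n /\<^sub>R fact n) \<le> (\<Sum>n. y ^ n /\<^sub>R fact n)"
    using assms by (intro sum_le_suminf summable_exp_generic) auto
  then show ?thesis
    by (simp add: exp_def field_simps)
qed

lemma power_le_exp_scaled:
  assumes "\<gamma> > 0"
  obtains K where "K > 0" "\<And>n::int. (\<bar>real_of_int n\<bar> + real m) ^ m \<le> K * exp (\<gamma> * \<bar>real_of_int n\<bar>)"
proof -
  have "(\<bar>real_of_int n\<bar> + real m) ^ m \<le> fact m * exp (\<gamma> * real m) / \<gamma> ^ m * exp (\<gamma> * \<bar>real_of_int n\<bar>)" for n :: int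
  proof -
    have exp_split: "exp (\<gamma> * (\<bar>real_of_int n\<bar> + real m)) = exp (\<gamma> * real m) * exp (\<gamma> * \<bar>real_of_int n\<bar>)"
      by (simp add: distrib_left exp_add)
    have "(\<gamma> * (\<bar>real_of_int n\<bar> + real m)) ^ m \<le> fact m * exp (\<gamma> * (\<bar>real_of_int n\<bar> + real m))"
      using assms by (intro power_le_fact_exp) auto
    then have "(\<bar>real_of_int n\<bar> + real m) ^ m * \<gamma> ^ m
        \<le> fact m * exp (\<gamma> * real m) * exp (\<gamma> * \<bar>real_of_int n\<bar>)"
      unfolding power_mult_distrib exp_split by (simp only: mult_ac)
    then show ?thesis
      using assms by (simp only: times_divide_eq_left pos_le_divide_eq zero_less_power)
  qed
  then show thesis
    using assms by (intro that[of "fact m * exp (\<gamma> * real m) / \<gamma> ^ m"]) auto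
qed

lemma falling_exp_summable:
  fixes b :: "int \<Rightarrow> complex"
  assumes "0 < \<gamma>" "\<beta> < \<gamma>" "0 \<le> \<beta>" and b: "\<And>n. norm (b n) \<le> C * exp (- \<gamma> * \<bar>real_of_int n\<bar>)"
  shows "(\<lambda>n. norm (b n * of_int (falling n j)) * exp (\<beta> * \<bar>real_of_int (n - int j)\<bar>)) summable_on (UNIV :: int set)"
proof -
  \<comment> \<open>The margin \<gamma> - \<beta> is halved: one half pays for the polynomial
    factor, the other remains as decay after the growth exp(\<beta>|n|).\<close>
  define \<delta> where "\<delta> = (\<gamma> - \<beta>) / 2"
  have \<delta>: "\<delta> > 0" using assms by (simp add: \<delta>_def)
  obtain K where K: "K > 0" "\<And>n::int. (\<bar>real_of_int n\<bar> + real j) ^ j \<le> K * exp (\<delta> * \<bar>real_of_int n\<bar>)"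
    using power_le_exp_scaled[OF \<delta>, where m = j] by blast
  have C: "C \<ge> 0"
    using order_trans[OF norm_ge_zero b[of 0]] by simp
  have "norm (b n * of_int (falling n j)) * exp (\<beta> * \<bar>real_of_int (n - int j)\<bar>)
      \<le> (C * K * exp (\<beta> * real j)) * exp (- \<delta> * \<bar>real_of_int n\<bar>)" for n
  proof -
    have "\<bar>real_of_int (falling n j)\<bar> \<le> (\<bar>real_of_int n\<bar> + real j) ^ j"
    proof -
      have "real_of_int \<bar>falling n j\<bar> \<le> real_of_int ((\<bar>n\<bar> + int j) ^ j)"
        using abs_falling_le[of n j] by (simp only: of_int_le_iff)
      then show ?thesis by simp
    qed
    also have "\<dots> \<le> K * exp (\<delta> * \<bar>real_of_int n\<bar>)" by (rule K)
    finally have 1: "norm (of_int (falling n j) :: complex) \<le> K * exp (\<delta> * \<bar>real_of_int n\<bar>)" by (simp add: norm_of_int)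
    have 2: "exp (\<beta> * \<bar>real_of_int (n - int j)\<bar>) \<le> exp (\<beta> * real j) * exp (\<beta> * \<bar>real_of_int n\<bar>)"
      using assms by (simp flip: exp_add distrib_left add: mult_left_mono)
    have "norm (b n * of_int (falling n j)) * exp (\<beta> * \<bar>real_of_int (n - int j)\<bar>)
      \<le> ((C * exp (- \<gamma> * \<bar>real_of_int n\<bar>)) * (K * exp (\<delta> * \<bar>real_of_int n\<bar>))) * (exp (\<beta> * real j) * exp (\<beta> * \<bar>real_of_int n\<bar>))"
      using K C by (intro mult_mono 2 order_trans[OF norm_mult_ineq] b 1) auto
    also have "\<dots> = (C * K * exp (\<beta> * real j)) * (exp (- \<gamma> * \<bar>real_of_int n\<bar>) * exp (\<delta> * \<bar>real_of_int n\<bar>) * exp (\<beta> * \<bar>real_of_int n\<bar>))"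
      by (simp add: mult_ac)
    also have "exp (- \<gamma> * \<bar>real_of_int n\<bar>) * exp (\<delta> * \<bar>real_of_int n\<bar>) * exp (\<beta> * \<bar>real_of_int n\<bar>) = exp (- \<delta> * \<bar>real_of_int n\<bar>)"
    proof -
      have "- \<gamma> * \<bar>real_of_int n\<bar> + \<delta> * \<bar>real_of_int n\<bar> + \<beta> * \<bar>real_of_int n\<bar> = - \<delta> * \<bar>real_of_int n\<bar>"
        by (simp add: \<delta>_def field_simps)
      then show ?thesis by (simp only: flip: exp_add)
    qed
    finally show ?thesis .
  qed
  then show ?thesis
    by (intro summable_on_comparison_test[OF
        summable_on_cmult_right[OF exp_int_summable[OF \<delta>], where c = "C * K * exp (\<beta> * real j)"]]) auto
qed

section \<open>Laurent series on an annulus around the unit circle\<close>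

definition annulus :: "real \<Rightarrow> complex set"
  where "annulus \<beta> = {w. exp (- \<beta>) < norm w \<and> norm w < exp \<beta>}"

lemma open_annulus: "open (annulus \<beta>)"
  unfolding annulus_def by (intro open_Collect_conj open_Collect_less continuous_intros)

text \<open>The annulus is symmetric in the logarithm of the modulus, so one exponential bound
  serves positive and negative powers alike.\<close>

lemma norm_powi_le_exp:
  assumes "w \<in> annulus \<beta>"
  shows "norm (w powi p) \<le> exp (\<beta> * \<bar>real_of_int p\<bar>)"
proof -
  have pos: "norm w > 0" using assms by (auto simp: annulus_def intro: less_trans[OF exp_gt_zero])
  have "ln (norm w) < \<beta>" "- \<beta> < ln (norm w)"
    using assms pos ln_less_cancel_iff[of "norm w" "exp \<beta>"] ln_less_cancel_iff[of "exp (- \<beta>)" "norm w"]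
    by (auto simp: annulus_def)
  then have "\<bar>ln (norm w)\<bar> * \<bar>real_of_int p\<bar> \<le> \<beta> * \<bar>real_of_int p\<bar>"
    by (intro mult_right_mono) auto
  then have "real_of_int p * ln (norm w) \<le> \<beta> * \<bar>real_of_int p\<bar>"
    using abs_ge_self[of "real_of_int p * ln (norm w)"] by (simp add: abs_mult mult.commute)
  then have "norm w powr real_of_int p \<le> exp (\<beta> * \<bar>real_of_int p\<bar>)"
    using pos by (simp add: powr_def)
  then show ?thesis
    using pos by (simp add: norm_power_int powr_real_of_int')
qed

text \<open>The finite partial sums converge uniformly on a disc along the net of finite subsets, so
  the theorem on uniform limits of holomorphic functions yields the derivative. Convergence of the
  differentiated series is part of its conclusion. The index type is arbitrary, so lattice sums can
  be differentiated in one coordinate.\<close>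

lemma termwise_derivative:
  fixes c :: "'k \<Rightarrow> complex" and p :: "'k \<Rightarrow> int"
  assumes sum: "(\<lambda>k. norm (c k) * exp (\<beta> * \<bar>real_of_int (p k)\<bar>)) summable_on A"
    and w: "w \<in> annulus \<beta>"
  shows "((\<lambda>w. \<Sum>\<^sub>\<infinity>k\<in>A. c k * w powi p k) has_field_derivative
    (\<Sum>\<^sub>\<infinity>k\<in>A. c k * of_int (p k) * w powi (p k - 1))) (at w)"
proof -
  define f where "f F w = (\<Sum>k\<in>F. c k * w powi p k)" for F w
  define f' where "f' F w = (\<Sum>k\<in>F. c k * of_int (p k) * w powi (p k - 1))" for F w
  obtain r where r: "r > 0" "cball w r \<subseteq> annulus \<beta>"
    using open_annulus w open_contains_cball by blast
  have nz: "z \<noteq> 0" if "z \<in> cball w r" for z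
  proof -
    have "z \<in> annulus \<beta>" using r(2) that by blast
    then show ?thesis by (auto simp: annulus_def)
  qed
  have der: "(f F has_field_derivative f' F z) (at z)" if "z \<in> cball w r" for F z
    unfolding f_def f'_def
    using nz[OF that] by (intro DERIV_sum) (auto intro!: derivative_eq_intros simp: mult_ac)
  have ul: "uniform_limit (cball w r) f (\<lambda>w. \<Sum>\<^sub>\<infinity>k\<in>A. c k * w powi p k) (finite_subsets_at_top A)"
    unfolding f_def
  proof (rule Weierstrass_m_test_general[OF _ sum])
    fix k z assume "z \<in> cball w r"
    then show "norm (c k * z powi p k) \<le> norm (c k) * exp (\<beta> * \<bar>real_of_int (p k)\<bar>)"
      unfolding norm_mult using r by (intro mult_left_mono norm_powi_le_exp) auto
  qed
  have "eventually (\<lambda>F. continuous_on (cball w r) (f F) \<and>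
      (\<forall>z\<in>ball w r. (f F has_field_derivative f' F z) (at z))) (finite_subsets_at_top A)"
    using der by (intro always_eventually allI conjI continuous_at_imp_continuous_on)
      (auto intro!: DERIV_isCont der)
  from has_complex_derivative_uniform_limit[OF this ul _ r(1)]
  obtain g' where g': "\<And>z. z \<in> ball w r \<Longrightarrow>
      ((\<lambda>w. \<Sum>\<^sub>\<infinity>k\<in>A. c k * w powi p k) has_field_derivative g' z) (at z) \<and>
      ((\<lambda>F. f' F z) \<longlongrightarrow> g' z) (finite_subsets_at_top A)"
    by auto
  then have "((\<lambda>k. c k * of_int (p k) * w powi (p k - 1)) has_sum g' w) A"
    using r by (simp add: has_sum_def f'_def)
  then show ?thesis
    using g'[of w] r by (simp add: infsumI)
qed

lemma contour_integral_powi_unit_circle: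
  "((\<lambda>w. w powi j) has_contour_integral (if j = - 1 then 2 * of_real pi * \<i> else 0)) (circlepath 0 1)"
proof (cases "j = - 1")
  case True
  have "((\<lambda>w. 1 / (w - 0)) has_contour_integral 2 * of_real pi * \<i>) (circlepath 0 1)"
    using Cauchy_integral_circlepath_simple[of "\<lambda>_. 1" 0 1 0] by simp
  then show ?thesis using True by (simp add: power_int_minus divide_inverse)
next
  case False
  have "((\<lambda>w. w powi j) has_contour_integral 0) (circlepath 0 1)"
  proof (rule Cauchy_theorem_primitive[where S = "- {0}" and f = "\<lambda>w. w powi (j + 1) / of_int (j + 1)"])
    fix x :: complex assume "x \<in> - {0}"
    moreover have "of_int (j + 1) \<noteq> (0 :: complex)" using False by (metis add_eq_0_iff2 of_int_eq_0_iff)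
    ultimately show "((\<lambda>w. w powi (j + 1) / of_int (j + 1)) has_field_derivative x powi j) (at x within - {0})"
      by (auto intro!: derivative_eq_intros)
  qed auto
  then show ?thesis using False by simp
qed

text \<open>The moments are the derivatives at 1 of the Laurent series \<open>G 0\<close>, which
  therefore vanishes on the connected annulus by the identity theorem. Its coefficients are
  recovered by contour integrals over the unit circle.\<close>

lemma laurent_coefficients_eq_0:
  fixes b :: "int \<Rightarrow> complex"
  assumes \<gamma>: "\<gamma> > 0" and b: "\<And>n. norm (b n) \<le> C * exp (- \<gamma> * \<bar>real_of_int n\<bar>)"
    and moments: "\<And>j. (\<Sum>\<^sub>\<infinity>n. b n * of_int (falling n j)) = 0"
  shows "b m = 0"
proof -
  define \<beta> where "\<beta> = \<gamma> / 2"
  define G where "G j w = (\<Sum>\<^sub>\<infinity>n. b n * of_int (falling n j) * w powi (n - int j))" for j w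
  have sum: "(\<lambda>n. norm (b n * of_int (falling n j)) * exp (\<beta> * \<bar>real_of_int (n - int j)\<bar>)) summable_on UNIV" for j
    using \<gamma> by (intro falling_exp_summable[OF \<gamma> _ _ b]) (auto simp: \<beta>_def)
  have G': "(G j has_field_derivative G (Suc j) w) (at w)" if "w \<in> annulus \<beta>" for j w
    using termwise_derivative[OF sum that]
    by (simp add: G_def[abs_def] falling_Suc mult.assoc diff_diff_eq add.commute)
  have deriv_G: "(deriv ^^ j) (G 0) w = G j w" if "w \<in> annulus \<beta>" for j w
    using that
  proof (induction j arbitrary: w)
    case (Suc j)
    have "eventually (\<lambda>w. (deriv ^^ j) (G 0) w = G j w) (nhds w)"
      using Suc open_annulus eventually_nhds by blast
    then show ?case
      using DERIV_imp_deriv[OF G'[OF Suc.prems]] by (simp add: deriv_cong_ev)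
  qed simp
  have 1: "1 \<in> annulus \<beta>" using \<gamma> by (simp add: annulus_def \<beta>_def)
  have G0: "G 0 w = 0" if "w \<in> annulus \<beta>" for w
  proof (rule holomorphic_fun_eq_0_on_connected[OF _ open_annulus _ _ 1 that])
    show "G 0 holomorphic_on annulus \<beta>"
      using G' open_annulus by (auto simp: holomorphic_on_open)
    show "connected (annulus \<beta>)"
      using connected_annulus[of "exp (- \<beta>)" "0 :: complex" "exp \<beta>"] by (simp add: annulus_def)
    show "(deriv ^^ n) (G 0) 1 = 0" for n
      using moments by (simp add: deriv_G[OF 1] G_def)
  qed
  \<comment> \<open>Partial sums of \<open>G 0 w\<close> times w^(-m - 1); among their terms only n
    = m contributes to the contour integral.\<close>
  define f where "f F w = (\<Sum>n\<in>F. b n * w powi (n - m - 1))" for F w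
  have "(\<lambda>n. norm (b n)) summable_on UNIV"
    by (rule summable_on_comparison_test[OF summable_on_cmult_right[OF exp_int_summable[OF \<gamma>], where c = C]])
      (use b in auto)
  then have ul: "uniform_limit (sphere 0 1) f (\<lambda>w. \<Sum>\<^sub>\<infinity>n. b n * w powi (n - m - 1)) (finite_subsets_at_top UNIV)"
    unfolding f_def by (intro Weierstrass_m_test_general) (auto simp: norm_mult norm_power_int)
  have "(\<Sum>\<^sub>\<infinity>n. b n * w powi (n - m - 1)) = 0" if "w \<in> sphere 0 1" for w
  proof -
    have "w \<noteq> 0" "w \<in> annulus \<beta>" using that \<gamma> by (auto simp: annulus_def \<beta>_def)
    have "(\<Sum>\<^sub>\<infinity>n. b n * w powi (n - m - 1)) = (\<Sum>\<^sub>\<infinity>n. (b n * w powi n) * w powi (- m - 1))"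
    proof (intro infsum_cong)
      fix n
      have e: "n - m - 1 = n + (- m - 1)" by simp
      show "b n * w powi (n - m - 1) = b n * w powi n * w powi (- m - 1)"
        unfolding e using \<open>w \<noteq> 0\<close> by (subst power_int_add) (simp_all add: mult.assoc)
    qed
    also have "\<dots> = G 0 w * w powi (- m - 1)"
      using \<open>w \<noteq> 0\<close> by (simp add: G_def infsum_cmult_left' falling_0)
    finally show ?thesis using G0[OF \<open>w \<in> annulus \<beta>\<close>] by simp
  qed
  then have ul0: "uniform_limit (sphere 0 1) f (\<lambda>w. 0) (finite_subsets_at_top UNIV)"
    using ul by (subst uniform_limit_cong'[where g = f and i = "\<lambda>w. \<Sum>\<^sub>\<infinity>n. b n * w powi (n - m - 1)"]) auto
  have fint: "(f F has_contour_integral (\<Sum>n\<in>F. b n * (if n = m then 2 * of_real pi * \<i> else 0))) (circlepath 0 1)"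
    if "finite F" for F
    unfolding f_def
  proof (intro has_contour_integral_sum that)
    fix n
    have "n - m - 1 = - 1 \<longleftrightarrow> n = m" by auto
    then show "((\<lambda>w. b n * w powi (n - m - 1)) has_contour_integral
        b n * (if n = m then 2 * of_real pi * \<i> else 0)) (circlepath 0 1)"
      using has_contour_integral_lmul[OF contour_integral_powi_unit_circle[of "n - m - 1"], of "b n"]
      by (simp only:)
  qed
  have lim: "((\<lambda>F. contour_integral (circlepath 0 1) (f F)) \<longlongrightarrow> contour_integral (circlepath 0 1) (\<lambda>w. 0))
      (finite_subsets_at_top UNIV)"
  proof (rule contour_integral_uniform_limit(2)[where B = "2 * pi"])
    show "eventually (\<lambda>F. f F contour_integrable_on circlepath 0 1) (finite_subsets_at_top UNIV)"
      using fint by (intro eventually_finite_subsets_at_top_weakI) (auto simp: contour_integrable_on_def)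
  qed (use ul0 in \<open>auto simp: vector_derivative_circlepath norm_mult\<close>)
  have "eventually (\<lambda>F. contour_integral (circlepath 0 1) (f F) = b m * (2 * of_real pi * \<i>)) (finite_subsets_at_top UNIV)"
    unfolding eventually_finite_subsets_at_top
  proof (intro exI[of _ "{m}"] conjI allI impI)
    fix F assume F: "finite F \<and> {m} \<subseteq> F \<and> F \<subseteq> UNIV"
    then have "contour_integral (circlepath 0 1) (f F) = (\<Sum>n\<in>F. b n * (if n = m then 2 * of_real pi * \<i> else 0))"
      using fint contour_integral_unique by blast
    also have "\<dots> = (\<Sum>n\<in>F. if n = m then b m * (2 * of_real pi * \<i>) else 0)"
      by (intro sum.cong) auto
    finally show "contour_integral (circlepath 0 1) (f F) = b m * (2 * of_real pi * \<i>)" using F by simp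
  qed auto
  then have "((\<lambda>F. contour_integral (circlepath 0 1) (f F)) \<longlongrightarrow> b m * (2 * of_real pi * \<i>)) (finite_subsets_at_top UNIV)"
    by (rule tendsto_eventually)
  from tendsto_unique[OF _ this lim] show ?thesis by simp
qed

section \<open>Moments of the single-site potential\<close>

definition exp_decay :: "real \<Rightarrow> real \<Rightarrow> (int ^ 'd::finite \<Rightarrow> real) \<Rightarrow> bool"
  where "exp_decay C \<alpha> u \<longleftrightarrow> (\<forall>k. \<bar>u k\<bar> \<le> C * exp (- \<alpha> * real_of_int (lattice_norm k)))"

lemma infsum_complex_of_real:
  assumes "f summable_on A"
  shows "(\<Sum>\<^sub>\<infinity>x\<in>A. complex_of_real (f x)) = of_real (\<Sum>\<^sub>\<infinity>x\<in>A. f x)"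
  by (intro infsumI has_sum_of_real has_sum_infsum assms)

lemma lattice_norm_minus: "lattice_norm (- k) = lattice_norm k"
  by (simp add: lattice_norm_def)

text \<open>The product majorizes all factors that \<open>n i\<close> differentiations in each
  coordinate \<open>i\<close> produce on the polyannulus of width \<beta>; a single exponential rate
  still survives. With \<beta> = 0 it bounds the moments.\<close>

lemma weighted_decay:
  fixes u :: "int ^ 'd::finite \<Rightarrow> real"
  assumes "0 \<le> \<beta>" "\<beta> < \<alpha>" "exp_decay C \<alpha> u"
  obtains K where "K \<ge> 0" "\<And>k. \<bar>u (- k)\<bar> *
      (\<Prod>i\<in>UNIV. (\<bar>real_of_int (k $ i)\<bar> + real (n i)) ^ n i * exp (\<beta> * (\<bar>real_of_int (k $ i)\<bar> + real (n i))))
    \<le> K * exp (- ((\<alpha> - \<beta>) / 2) * real_of_int (lattice_norm k))"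
proof -
  \<comment> \<open>Half of the margin \<alpha> - \<beta> is spent on the polynomial factors, half
    is kept as decay.\<close>
  define \<gamma> where "\<gamma> = (\<alpha> - \<beta>) / 2"
  have \<gamma>: "\<gamma> > 0" using assms by (simp add: \<gamma>_def)
  have "\<exists>K. \<forall>i. K i > 0 \<and> (\<forall>m::int. (\<bar>real_of_int m\<bar> + real (n i)) ^ n i \<le> K i * exp (\<gamma> * \<bar>real_of_int m\<bar>))"
  proof (rule choice, intro allI)
    fix i
    show "\<exists>K. K > 0 \<and> (\<forall>m::int. (\<bar>real_of_int m\<bar> + real (n i)) ^ n i \<le> K * exp (\<gamma> * \<bar>real_of_int m\<bar>))"
      using power_le_exp_scaled[OF \<gamma>, where m = "n i"] by blast
  qed
  then obtain K where K: "\<And>i. K i > 0"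
      "\<And>i (m::int). (\<bar>real_of_int m\<bar> + real (n i)) ^ n i \<le> K i * exp (\<gamma> * \<bar>real_of_int m\<bar>)"
    by blast
  have C: "C \<ge> 0"
    using assms(3)[unfolded exp_decay_def, rule_format, of 0] by (simp add: lattice_norm_def)
  define L where "L = C * (\<Prod>i\<in>UNIV. K i * exp (\<beta> * real (n i)))"
  show thesis
  proof (rule that[of L])
    show "L \<ge> 0" unfolding L_def using C K(1) by (intro mult_nonneg_nonneg prod_nonneg) (auto intro: less_imp_le)
    fix k
    have "\<bar>u (- k)\<bar> \<le> C * exp (- \<alpha> * real_of_int (lattice_norm k))"
      using assms(3) by (metis exp_decay_def lattice_norm_minus)
    moreover have "(\<Prod>i\<in>UNIV. (\<bar>real_of_int (k $ i)\<bar> + real (n i)) ^ n i * exp (\<beta> * (\<bar>real_of_int (k $ i)\<bar> + real (n i))))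
        \<le> (\<Prod>i\<in>UNIV. K i * exp (\<beta> * real (n i)) * exp ((\<gamma> + \<beta>) * \<bar>real_of_int (k $ i)\<bar>))"
    proof (intro prod_mono conjI)
      fix i
      have "(\<bar>real_of_int (k $ i)\<bar> + real (n i)) ^ n i * exp (\<beta> * (\<bar>real_of_int (k $ i)\<bar> + real (n i)))
          \<le> K i * exp (\<gamma> * \<bar>real_of_int (k $ i)\<bar>) * exp (\<beta> * (\<bar>real_of_int (k $ i)\<bar> + real (n i)))"
        by (intro mult_right_mono K) auto
      also have "\<dots> = K i * exp (\<beta> * real (n i)) * exp ((\<gamma> + \<beta>) * \<bar>real_of_int (k $ i)\<bar>)"
        by (simp add: distrib_left distrib_right exp_add)
      finally show "(\<bar>real_of_int (k $ i)\<bar> + real (n i)) ^ n i * exp (\<beta> * (\<bar>real_of_int (k $ i)\<bar> + real (n i)))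
          \<le> K i * exp (\<beta> * real (n i)) * exp ((\<gamma> + \<beta>) * \<bar>real_of_int (k $ i)\<bar>)" .
    qed auto
    ultimately have "\<bar>u (- k)\<bar> *
        (\<Prod>i\<in>UNIV. (\<bar>real_of_int (k $ i)\<bar> + real (n i)) ^ n i * exp (\<beta> * (\<bar>real_of_int (k $ i)\<bar> + real (n i))))
      \<le> (C * exp (- \<alpha> * real_of_int (lattice_norm k))) *
        (\<Prod>i\<in>UNIV. K i * exp (\<beta> * real (n i)) * exp ((\<gamma> + \<beta>) * \<bar>real_of_int (k $ i)\<bar>))"
      using C by (intro mult_mono) (auto intro!: prod_nonneg)
    also have "\<dots> = L * (exp (- \<alpha> * real_of_int (lattice_norm k)) * (\<Prod>i\<in>UNIV. exp ((\<gamma> + \<beta>) * \<bar>real_of_int (k $ i)\<bar>)))"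
      by (simp add: L_def prod.distrib)
    also have "exp (- \<alpha> * real_of_int (lattice_norm k)) * (\<Prod>i\<in>UNIV. exp ((\<gamma> + \<beta>) * \<bar>real_of_int (k $ i)\<bar>))
        = exp (- \<gamma> * real_of_int (lattice_norm k))"
      unfolding exp_lattice_norm prod.distrib[symmetric]
    proof (intro prod.cong refl)
      fix i
      have "- \<alpha> * \<bar>real_of_int (k $ i)\<bar> + (\<gamma> + \<beta>) * \<bar>real_of_int (k $ i)\<bar> = - \<gamma> * \<bar>real_of_int (k $ i)\<bar>"
        by (simp add: \<gamma>_def field_simps)
      then show "exp (- \<alpha> * \<bar>real_of_int (k $ i)\<bar>) * exp ((\<gamma> + \<beta>) * \<bar>real_of_int (k $ i)\<bar>) = exp (- \<gamma> * \<bar>real_of_int (k $ i)\<bar>)"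
        by (simp only: flip: exp_add)
    qed
    finally show "\<bar>u (- k)\<bar> *
        (\<Prod>i\<in>UNIV. (\<bar>real_of_int (k $ i)\<bar> + real (n i)) ^ n i * exp (\<beta> * (\<bar>real_of_int (k $ i)\<bar> + real (n i))))
      \<le> L * exp (- ((\<alpha> - \<beta>) / 2) * real_of_int (lattice_norm k))"
      by (simp add: \<gamma>_def)
  qed
qed

lemma weighted_decay_summable:
  fixes u :: "int ^ 'd::finite \<Rightarrow> real"
  assumes "0 \<le> \<beta>" "\<beta> < \<alpha>" "exp_decay C \<alpha> u"
  shows "(\<lambda>k. \<bar>u (- k)\<bar> * (\<Prod>i\<in>UNIV. (\<bar>real_of_int (k $ i)\<bar> + real (n i)) ^ n i *
    exp (\<beta> * (\<bar>real_of_int (k $ i)\<bar> + real (n i))))) summable_on A"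
proof -
  obtain K where K: "K \<ge> 0" "\<And>k. \<bar>u (- k)\<bar> *
      (\<Prod>i\<in>UNIV. (\<bar>real_of_int (k $ i)\<bar> + real (n i)) ^ n i * exp (\<beta> * (\<bar>real_of_int (k $ i)\<bar> + real (n i))))
    \<le> K * exp (- ((\<alpha> - \<beta>) / 2) * real_of_int (lattice_norm k))"
    using weighted_decay[OF assms, of n] by blast
  have "(\<alpha> - \<beta>) / 2 > 0" using assms by simp
  from exp_lattice_norm_summable[OF this] show ?thesis
    by (intro summable_on_comparison_test[OF summable_on_cmult_right[where c = K], OF _ K(2)])
      (auto intro!: mult_nonneg_nonneg prod_nonneg)
qed

section \<open>Derivatives of the generating function\<close>

lemma abs_falling_le_real: "\<bar>real_of_int (falling x m)\<bar> \<le> (\<bar>real_of_int x\<bar> + real m) ^ m"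
proof -
  have "real_of_int \<bar>falling x m\<bar> \<le> real_of_int ((\<bar>x\<bar> + int m) ^ m)"
    using abs_falling_le by (simp only: of_int_le_iff)
  then show ?thesis by simp
qed

text \<open>The summand of \<open>gen_fun\<close> differentiated \<open>n i\<close> times in each
  coordinate \<open>i\<close>. The orders form a function, so that one more derivative is a function
  update.\<close>

definition laurent_term :: "(int ^ 'd::finite \<Rightarrow> real) \<Rightarrow> ('d \<Rightarrow> nat) \<Rightarrow> complex ^ 'd \<Rightarrow> int ^ 'd \<Rightarrow> complex"
  where "laurent_term u n z k = of_real (u (- k)) *
    (\<Prod>i\<in>UNIV. of_int (falling (k $ i) (n i)) * (z $ i) powi (k $ i - int (n i)))"

definition laurent_sum :: "(int ^ 'd::finite \<Rightarrow> real) \<Rightarrow> ('d \<Rightarrow> nat) \<Rightarrow> complex ^ 'd \<Rightarrow> complex"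
  where "laurent_sum u n z = (\<Sum>\<^sub>\<infinity>k. laurent_term u n z k)"

definition polyannulus :: "real \<Rightarrow> (complex ^ 'd::finite) set"
  where "polyannulus \<beta> = {z. \<forall>i. z $ i \<in> annulus \<beta>}"

lemma norm_laurent_factor_le:
  assumes "w \<in> annulus \<beta>" "\<beta> \<ge> 0"
  shows "norm (of_int (falling x m) * w powi (x - int m)) \<le>
    (\<bar>real_of_int x\<bar> + real m) ^ m * exp (\<beta> * (\<bar>real_of_int x\<bar> + real m))"
proof -
  have "exp (\<beta> * \<bar>real_of_int (x - int m)\<bar>) \<le> exp (\<beta> * (\<bar>real_of_int x\<bar> + real m))"
    using assms(2) by (auto intro!: mult_left_mono)
  then show ?thesis
    unfolding norm_mult norm_of_int
    by (intro mult_mono abs_falling_le_real order_trans[OF norm_powi_le_exp[OF assms(1)]]) auto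
qed

text \<open>With the other coordinates of \<open>z\<close> frozen, their factors join the
  coefficient \<open>c k\<close>, and a Laurent sum in one variable indexed by lattice points
  remains.\<close>

lemma laurent_sum_partial_derivative:
  assumes "0 < \<beta>" "\<beta> < \<alpha>" "exp_decay C \<alpha> u" and z: "z \<in> polyannulus \<beta>"
  shows "((\<lambda>w. laurent_sum u n (\<chi> j. if j = i then w else z $ j)) has_field_derivative
    laurent_sum u (n(i := Suc (n i))) z) (at (z $ i))"
proof -
  define P where "P k = (\<Prod>j\<in>UNIV - {i}. of_int (falling (k $ j) (n j)) * (z $ j) powi (k $ j - int (n j)))" for k
  define c where "c k = of_real (u (- k)) * (of_int (falling (k $ i) (n i)) * P k)" for k
  have zi: "z $ i \<in> annulus \<beta>" for i using z by (simp add: polyannulus_def)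
  have eq: "laurent_term u n (\<chi> j. if j = i then w else z $ j) k = c k * w powi (k $ i - int (n i))" for w k
    unfolding laurent_term_def c_def P_def
    by (subst prod.remove[of UNIV i]) (auto simp: mult_ac intro!: prod.cong)
  have eq': "laurent_term u (n(i := Suc (n i))) z k =
      c k * of_int (k $ i - int (n i)) * (z $ i) powi (k $ i - int (n i) - 1)" for k
  proof -
    have e: "k $ i - int (Suc (n i)) = k $ i - int (n i) - 1" by simp
    then show ?thesis
      unfolding laurent_term_def c_def P_def
      by (subst prod.remove[of UNIV i]) (auto simp: falling_Suc mult_ac e simp del: of_nat_Suc intro!: prod.cong)
  qed
  have sum: "(\<lambda>k. norm (c k) * exp (\<beta> * \<bar>real_of_int (k $ i - int (n i))\<bar>)) summable_on UNIV"
  proof (rule summable_on_comparison_test[OF weighted_decay_summable[OF _ assms(2,3)]])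
    fix k
    let ?b = "\<lambda>j. (\<bar>real_of_int (k $ j)\<bar> + real (n j)) ^ n j * exp (\<beta> * (\<bar>real_of_int (k $ j)\<bar> + real (n j)))"
    have "norm (P k) \<le> (\<Prod>j\<in>UNIV - {i}. ?b j)"
      unfolding P_def prod_norm[symmetric] using assms(1)
      by (intro prod_mono conjI norm_laurent_factor_le zi) auto
    moreover have "norm (of_int (falling (k $ i) (n i)) :: complex) * exp (\<beta> * \<bar>real_of_int (k $ i - int (n i))\<bar>) \<le> ?b i"
      unfolding norm_of_int using assms(1) by (intro mult_mono abs_falling_le_real) (auto intro!: mult_left_mono)
    ultimately have "norm (P k) * (norm (of_int (falling (k $ i) (n i)) :: complex) * exp (\<beta> * \<bar>real_of_int (k $ i - int (n i))\<bar>))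
        \<le> (\<Prod>j\<in>UNIV - {i}. ?b j) * ?b i"
      by (rule mult_mono) (auto intro!: prod_nonneg)
    also have "\<dots> = (\<Prod>j\<in>UNIV. ?b j)"
      by (subst prod.remove[of UNIV i]) auto
    finally have "\<bar>u (- k)\<bar> * (norm (P k) * (norm (of_int (falling (k $ i) (n i)) :: complex) * exp (\<beta> * \<bar>real_of_int (k $ i - int (n i))\<bar>)))
        \<le> \<bar>u (- k)\<bar> * (\<Prod>j\<in>UNIV. ?b j)"
      by (intro mult_left_mono) auto
    then show "norm (c k) * exp (\<beta> * \<bar>real_of_int (k $ i - int (n i))\<bar>) \<le> \<bar>u (- k)\<bar> * (\<Prod>j\<in>UNIV. ?b j)"
      by (simp add: c_def norm_mult mult_ac)
  qed (use assms in auto)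
  show ?thesis
    using termwise_derivative[OF sum zi] unfolding laurent_sum_def eq eq' .
qed

text \<open>The equation for \<open>f\<close> is assumed on the whole polyannulus because a
  derivative depends on a neighbourhood; the conclusion holds at each of its points again, so the
  lemma can be iterated.\<close>

lemma partial_deriv_laurent_sum:
  assumes "0 < \<beta>" "\<beta> < \<alpha>" "exp_decay C \<alpha> u"
    and f: "\<And>z. z \<in> polyannulus \<beta> \<Longrightarrow> f z = laurent_sum u n z" and z: "z \<in> polyannulus \<beta>"
  shows "partial_deriv i f z = laurent_sum u (n(i := Suc (n i))) z"
proof -
  have "eventually (\<lambda>w. w \<in> annulus \<beta>) (nhds (z $ i))"
    using z open_annulus by (intro eventually_nhds_in_open) (auto simp: polyannulus_def)
  then have "eventually (\<lambda>w. f (\<chi> j. if j = i then w else z $ j) = laurent_sum u n (\<chi> j. if j = i then w else z $ j)) (nhds (z $ i))"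
    by eventually_elim (use z in \<open>auto intro!: f simp: polyannulus_def\<close>)
  then have "partial_deriv i f z = deriv (\<lambda>w. laurent_sum u n (\<chi> j. if j = i then w else z $ j)) (z $ i)"
    unfolding partial_deriv_def by (intro deriv_cong_ev) auto
  then show ?thesis
    using DERIV_imp_deriv[OF laurent_sum_partial_derivative[OF assms(1-3) z]] by simp
qed

lemma partial_deriv_funpow_laurent_sum:
  assumes "0 < \<beta>" "\<beta> < \<alpha>" "exp_decay C \<alpha> u"
    and f: "\<And>z. z \<in> polyannulus \<beta> \<Longrightarrow> f z = laurent_sum u n z" and "z \<in> polyannulus \<beta>"
  shows "(partial_deriv i ^^ m) f z = laurent_sum u (n(i := n i + m)) z"
  using assms(5)
proof (induction m arbitrary: z)
  case 0
  then show ?case by (simp add: f)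
next
  case (Suc m)
  have "(n(i := n i + m))(i := Suc ((n(i := n i + m)) i)) = n(i := n i + Suc m)"
    by simp
  then show ?case
    using partial_deriv_laurent_sum[OF assms(1-3) Suc.IH Suc.prems, of i] by (simp only: funpow.simps o_apply)
qed

lemma fold_partial_deriv_laurent_sum:
  assumes "0 < \<beta>" "\<beta> < \<alpha>" "exp_decay C \<alpha> u"
    and "\<And>z. z \<in> polyannulus \<beta> \<Longrightarrow> f z = laurent_sum u n z" and "z \<in> polyannulus \<beta>" "distinct is"
  shows "fold (\<lambda>i. partial_deriv i ^^ (I $ i)) is f z = laurent_sum u (\<lambda>i. if i \<in> set is then n i + I $ i else n i) z"
  using assms(4-)
proof (induction "is" arbitrary: f n)
  case Nil
  then show ?case by simp
next
  case (Cons i "is")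
  define n' where "n' = n(i := n i + I $ i)"
  have "fold (\<lambda>i. partial_deriv i ^^ (I $ i)) is ((partial_deriv i ^^ (I $ i)) f) z =
      laurent_sum u (\<lambda>j. if j \<in> set is then n' j + I $ j else n' j) z"
  proof (rule Cons.IH)
    show "(partial_deriv i ^^ (I $ i)) f z = laurent_sum u n' z" if "z \<in> polyannulus \<beta>" for z
      unfolding n'_def by (rule partial_deriv_funpow_laurent_sum[OF assms(1-3) Cons.prems(1) that])
  qed (use Cons.prems in auto)
  also have "(\<lambda>j. if j \<in> set is then n' j + I $ j else n' j) = (\<lambda>j. if j \<in> set (i # is) then n j + I $ j else n j)"
    using Cons.prems(3) by (auto simp: n'_def fun_eq_iff)
  finally show ?case by simp
qed

section \<open>Factorial moments determine the potential\<close>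

definition moment :: "(int ^ 'd::finite \<Rightarrow> real) \<Rightarrow> ('d \<Rightarrow> nat) \<Rightarrow> real"
  where "moment u n = (\<Sum>\<^sub>\<infinity>k. u (- k) * (\<Prod>i\<in>UNIV. real_of_int (falling (k $ i) (n i))))"

lemma moment_term_summable:
  fixes u :: "int ^ 'd::finite \<Rightarrow> real"
  assumes "\<alpha> > 0" "exp_decay C \<alpha> u"
  shows "(\<lambda>k. norm (u (- k) * (\<Prod>i\<in>T. real_of_int (falling (k $ i) (n i))))) summable_on A"
proof (rule Infinite_Sum.abs_summable_on_comparison_test'[OF weighted_decay_summable[OF _ assms]])
  fix k
  define n' where "n' i = (if i \<in> T then n i else 0)" for i
  have "\<bar>\<Prod>i\<in>T. real_of_int (falling (k $ i) (n i))\<bar> = (\<Prod>i\<in>UNIV. \<bar>real_of_int (falling (k $ i) (n' i))\<bar>)"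
    unfolding abs_prod by (intro prod.mono_neutral_cong_left) (auto simp: n'_def falling_0)
  also have "\<dots> \<le> (\<Prod>i\<in>UNIV. (\<bar>real_of_int (k $ i)\<bar> + real (n' i)) ^ n' i * exp (0 * (\<bar>real_of_int (k $ i)\<bar> + real (n' i))))"
    by (intro prod_mono) (auto simp: abs_falling_le_real)
  finally show "norm (u (- k) * (\<Prod>i\<in>T. real_of_int (falling (k $ i) (n i)))) \<le>
    \<bar>u (- k)\<bar> * (\<Prod>i\<in>UNIV. (\<bar>real_of_int (k $ i)\<bar> + real (if i \<in> T then n i else 0)) ^ (if i \<in> T then n i else 0) *
      exp (0 * (\<bar>real_of_int (k $ i)\<bar> + real (if i \<in> T then n i else 0))))"
    by (auto simp: abs_mult n'_def intro!: mult_left_mono)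
qed auto

text \<open>At the point 1 all powers in the differentiated series equal 1 and only the falling
  factorials remain. The result does not see the order of the coordinates.\<close>

lemma multi_deriv_gen_fun:
  assumes "\<alpha> > 0" "exp_decay C \<alpha> u"
  shows "multi_deriv I (gen_fun u) 1 = of_real (moment u (($) I))"
proof -
  \<comment> \<open>\<open>coordinates\<close> is a choice; finiteness of the index type supplies an
    enumeration for it.\<close>
  have "\<exists>is. distinct is \<and> set is = (UNIV :: 'a set)"
    using finite_distinct_list[of "UNIV :: 'a set"] by auto
  then have coord: "distinct (coordinates :: 'a list)" "set (coordinates :: 'a list) = UNIV"
    unfolding coordinates_def by (metis (mono_tags, lifting) someI_ex)+
  have "gen_fun u = laurent_sum u (\<lambda>_. 0)"
    by (simp add: gen_fun_def laurent_sum_def laurent_term_def falling_0 fun_eq_iff)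
  moreover have "1 \<in> polyannulus (\<alpha> / 2)"
    using assms(1) by (simp add: polyannulus_def annulus_def)
  ultimately have "multi_deriv I (gen_fun u) 1 = laurent_sum u (($) I) 1"
    unfolding multi_deriv_def using assms
    by (subst fold_partial_deriv_laurent_sum[where \<beta> = "\<alpha> / 2" and n = "\<lambda>_. 0"]) (auto simp: coord)
  also have "laurent_term u (($) I) 1 =
      (\<lambda>k. of_real (u (- k) * (\<Prod>i\<in>UNIV. real_of_int (falling (k $ i) (I $ i)))))"
    by (simp add: laurent_term_def fun_eq_iff)
  then have "laurent_sum u (($) I) 1 = of_real (moment u (($) I))"
    unfolding laurent_sum_def moment_def
    by (simp only: infsum_complex_of_real[OF abs_summable_summable[OF moment_term_summable[OF assms]]])
  finally show ?thesis .
qed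

text \<open>Coordinates are frozen one by one. For a new coordinate \<open>i\<close> the sum over
  the slice with \<open>k $ i = t\<close> is a sequence \<open>b t\<close>; its factorial moments in
  \<open>t\<close> vanish by the induction hypothesis and it decays exponentially, so every
  \<open>b t\<close> is 0 by uniqueness of Laurent coefficients.\<close>

lemma partial_moments_vanish:
  fixes u :: "int ^ 'd::finite \<Rightarrow> real"
  assumes \<alpha>: "\<alpha> > 0" and u: "exp_decay C \<alpha> u" and moments: "\<And>n. moment u n = 0"
    and "finite S"
  shows "(\<Sum>\<^sub>\<infinity>k\<in>{k. \<forall>j\<in>S. k $ j = m j}. u (- k) * (\<Prod>i\<in>- S. real_of_int (falling (k $ i) (n i)))) = 0"
  using assms(4)
proof (induction S arbitrary: m n rule: finite_induct)
  case empty
  then show ?case using moments[of n] by (simp add: moment_def)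
next
  case (insert i S)
  define T where "T = - insert i S"
  define f where "f k = u (- k) * (\<Prod>j\<in>T. real_of_int (falling (k $ j) (n j)))" for k
  define K where "K t = {k. (\<forall>j\<in>S. k $ j = m j) \<and> k $ i = t}" for t
  define b where "b t = (\<Sum>\<^sub>\<infinity>k\<in>K t. f k)" for t
  have f_sum: "(\<lambda>k. norm (f k)) summable_on A" for A
    unfolding f_def by (rule moment_term_summable[OF \<alpha> u])
  define n' where "n' j = (if j \<in> T then n j else 0)" for j
  obtain L where L: "L \<ge> 0" "\<And>k. \<bar>u (- k)\<bar> *
      (\<Prod>i\<in>UNIV. (\<bar>real_of_int (k $ i)\<bar> + real (n' i)) ^ n' i * exp (0 * (\<bar>real_of_int (k $ i)\<bar> + real (n' i))))
    \<le> L * exp (- ((\<alpha> - 0) / 2) * real_of_int (lattice_norm k))"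
    using weighted_decay[OF _ \<alpha> u, of n'] by blast
  \<comment> \<open>The terms decay at rate \<alpha>/2 = 2\<gamma>: one \<gamma> yields decay of
    \<open>b t\<close> in t, the other makes the sum over the slice converge uniformly in t.\<close>
  define \<gamma> where "\<gamma> = \<alpha> / 4"
  have \<gamma>: "\<gamma> > 0" using \<alpha> by (simp add: \<gamma>_def)
  have f_le: "norm (f k) \<le> L * exp (- (2 * \<gamma>) * real_of_int (lattice_norm k))" for k
  proof -
    have "\<bar>\<Prod>i\<in>T. real_of_int (falling (k $ i) (n i))\<bar> = (\<Prod>i\<in>UNIV. \<bar>real_of_int (falling (k $ i) (n' i))\<bar>)"
      unfolding abs_prod by (intro prod.mono_neutral_cong_left) (auto simp: n'_def falling_0)
    also have "\<dots> \<le> (\<Prod>i\<in>UNIV. (\<bar>real_of_int (k $ i)\<bar> + real (n' i)) ^ n' i * exp (0 * (\<bar>real_of_int (k $ i)\<bar> + real (n' i))))"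
      by (intro prod_mono) (auto simp: abs_falling_le_real)
    finally have "norm (f k) \<le> \<bar>u (- k)\<bar> *
      (\<Prod>i\<in>UNIV. (\<bar>real_of_int (k $ i)\<bar> + real (n' i)) ^ n' i * exp (0 * (\<bar>real_of_int (k $ i)\<bar> + real (n' i))))"
      by (auto simp: f_def abs_mult intro!: mult_left_mono)
    also note L(2)[of k]
    finally show ?thesis by (simp add: \<gamma>_def)
  qed
  define D where "D = (\<Sum>\<^sub>\<infinity>k. exp (- \<gamma> * real_of_int (lattice_norm (k :: int ^ 'd))))"
  have "\<bar>b t\<bar> \<le> (L * D) * exp (- \<gamma> * \<bar>real_of_int t\<bar>)" for t
  proof -
    have "\<bar>b t\<bar> \<le> (\<Sum>\<^sub>\<infinity>k\<in>K t. norm (f k))"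
      unfolding b_def using norm_infsum_bound[OF f_sum] by simp
    also have "\<dots> \<le> (\<Sum>\<^sub>\<infinity>k\<in>(UNIV :: (int ^ 'd) set). (L * exp (- \<gamma> * \<bar>real_of_int t\<bar>)) * exp (- \<gamma> * real_of_int (lattice_norm k)))"
    proof (rule infsum_mono_neutral)
      fix k assume "k \<in> K t \<inter> UNIV"
      then have "\<bar>t\<bar> \<le> lattice_norm k"
        unfolding lattice_norm_def K_def by (auto intro: member_le_sum)
      then have "\<bar>real_of_int t\<bar> \<le> real_of_int (lattice_norm k)"
        by (simp flip: of_int_abs)
      then have "\<gamma> * \<bar>real_of_int t\<bar> \<le> \<gamma> * real_of_int (lattice_norm k)"
        using \<gamma> by (intro mult_left_mono) auto
      then have "exp (- (2 * \<gamma>) * real_of_int (lattice_norm k)) \<le> exp (- \<gamma> * \<bar>real_of_int t\<bar>) * exp (- \<gamma> * real_of_int (lattice_norm k))"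
        by (simp flip: exp_add)
      then have "L * exp (- (2 * \<gamma>) * real_of_int (lattice_norm k)) \<le> L * (exp (- \<gamma> * \<bar>real_of_int t\<bar>) * exp (- \<gamma> * real_of_int (lattice_norm k)))"
        using L(1) by (rule mult_left_mono)
      then show "norm (f k) \<le> (L * exp (- \<gamma> * \<bar>real_of_int t\<bar>)) * exp (- \<gamma> * real_of_int (lattice_norm k))"
        using f_le[of k] by (simp add: mult.assoc)
    next
      show "(\<lambda>k. norm (f k)) summable_on K t" by (rule f_sum)
      show "(\<lambda>k :: int ^ 'd. (L * exp (- \<gamma> * \<bar>real_of_int t\<bar>)) * exp (- \<gamma> * real_of_int (lattice_norm k))) summable_on UNIV"
        by (intro summable_on_cmult_right exp_lattice_norm_summable \<gamma>)
    qed (use L(1) in auto)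
    also have "\<dots> = (L * D) * exp (- \<gamma> * \<bar>real_of_int t\<bar>)"
      by (simp add: infsum_cmult_right' D_def mult_ac)
    finally show ?thesis .
  qed
  then have b_le: "norm (complex_of_real (b t)) \<le> (L * D) * exp (- \<gamma> * \<bar>real_of_int t\<bar>)" for t
    by simp
  have moments_b: "(\<Sum>\<^sub>\<infinity>t. complex_of_real (b t) * of_int (falling t q)) = 0" for q
  proof -
    define g where "g k = f k * real_of_int (falling (k $ i) q)" for k
    have g_eq: "g k = u (- k) * (\<Prod>j\<in>- S. real_of_int (falling (k $ j) ((n(i := q)) j)))" for k
    proof -
      have "- S = insert i T" "i \<notin> T" using insert.hyps by (auto simp: T_def)
      then have "(\<Prod>j\<in>- S. real_of_int (falling (k $ j) ((n(i := q)) j))) =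
          real_of_int (falling (k $ i) q) * (\<Prod>j\<in>T. real_of_int (falling (k $ j) ((n(i := q)) j)))"
        by simp
      also have "(\<Prod>j\<in>T. real_of_int (falling (k $ j) ((n(i := q)) j))) = (\<Prod>j\<in>T. real_of_int (falling (k $ j) (n j)))"
        using \<open>i \<notin> T\<close> by (intro prod.cong) auto
      finally show ?thesis by (simp add: g_def f_def)
    qed
    have g_sum: "g summable_on A" for A
      unfolding g_eq using abs_summable_summable[OF moment_term_summable[OF \<alpha> u]] by blast
    \<comment> \<open>The slices \<open>K t\<close> partition the index set of the induction
      hypothesis, so its sum becomes an iterated one.\<close>
    have bij: "bij_betw (\<lambda>k. (k $ i, k)) {k. \<forall>j\<in>S. k $ j = m j} (Sigma UNIV K)"
      by (rule bij_betwI[where g = snd]) (auto simp: K_def)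
    have "(\<lambda>(t, k). g k) summable_on Sigma UNIV K"
      using summable_on_reindex_bij_betw[OF bij, of "\<lambda>(t, k). g k"] g_sum by simp
    from infsum_Sigma'_banach[OF this]
    have "(\<Sum>\<^sub>\<infinity>t. \<Sum>\<^sub>\<infinity>k\<in>K t. g k) = (\<Sum>\<^sub>\<infinity>(t, k)\<in>Sigma UNIV K. g k)" .
    also have "\<dots> = (\<Sum>\<^sub>\<infinity>k\<in>{k. \<forall>j\<in>S. k $ j = m j}. g k)"
      using infsum_reindex_bij_betw[OF bij, of "\<lambda>(t, k). g k"] by simp
    also have "\<dots> = 0"
      unfolding g_eq by (rule insert.IH)
    finally have "(\<Sum>\<^sub>\<infinity>t. \<Sum>\<^sub>\<infinity>k\<in>K t. g k) = 0" .
    moreover have "(\<Sum>\<^sub>\<infinity>k\<in>K t. g k) = b t * real_of_int (falling t q)" for t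
    proof -
      have "(\<Sum>\<^sub>\<infinity>k\<in>K t. g k) = (\<Sum>\<^sub>\<infinity>k\<in>K t. f k * real_of_int (falling t q))"
        by (intro infsum_cong) (auto simp: g_def K_def)
      then show ?thesis by (simp add: b_def infsum_cmult_left')
    qed
    ultimately have 0: "(\<Sum>\<^sub>\<infinity>t. b t * real_of_int (falling t q)) = 0" by simp
    have "(\<lambda>t. norm (complex_of_real (b t) * of_int (falling t q)) * exp (0 * \<bar>real_of_int (t - int q)\<bar>)) summable_on UNIV"
      by (rule falling_exp_summable[OF \<gamma> \<gamma> _ b_le]) auto
    then have "(\<lambda>t. norm (b t * real_of_int (falling t q))) summable_on UNIV"
      by (simp add: norm_mult abs_mult)
    then have "(\<lambda>t. b t * real_of_int (falling t q)) summable_on UNIV"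
      by (rule abs_summable_summable)
    from infsum_complex_of_real[OF this] 0 show ?thesis by simp
  qed
  have "complex_of_real (b (m i)) = 0"
    by (rule laurent_coefficients_eq_0[OF \<gamma> b_le moments_b])
  moreover have "K (m i) = {k. \<forall>j\<in>insert i S. k $ j = m j}"
    by (auto simp: K_def)
  ultimately show ?case by (simp add: b_def f_def T_def)
qed

text \<open>With all coordinates frozen at those of \<open>- k\<close> the slice is a single point
  and the product is empty, so the sum is \<open>u k\<close> itself.\<close>

lemma moments_determine:
  fixes u :: "int ^ 'd::finite \<Rightarrow> real"
  assumes "\<alpha> > 0" "exp_decay C \<alpha> u" "\<And>n. moment u n = 0"
  shows "u = (\<lambda>k. 0)"
proof
  fix k :: "int ^ 'd"
  have "{l. \<forall>j\<in>UNIV. l $ j = (- k) $ j} = {- k}"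
    by (auto simp: vec_eq_iff)
  then show "u k = 0"
    using partial_moments_vanish[OF assms, where S = UNIV and m = "($) (- k)"] by simp
qed

text \<open>Among the indices with a nonzero moment, one of least total degree qualifies, since
  \<open>mi_less\<close> strictly lowers the total degree.\<close>

lemma leading_index_exists:
  assumes "\<alpha> > 0" "exp_decay C \<alpha> u" "u \<noteq> (\<lambda>k. 0)"
  shows "\<exists>I. leading_index u I"
proof -
  obtain n where n: "moment u n \<noteq> 0"
    using moments_determine[OF assms(1,2)] assms(3) by blast
  define I where "I = (\<chi> i. n i)"
  have "moment u (($) I) \<noteq> 0" using n by (simp add: I_def vec_lambda_beta[abs_def])
  then obtain J where "moment u (($) J) \<noteq> 0" "\<And>J'. moment u (($) J') \<noteq> 0 \<Longrightarrow> mi_norm J \<le> mi_norm J'"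
    using ex_has_least_nat[of "\<lambda>J. moment u (($) J) \<noteq> 0" I mi_norm] by blast
  then show ?thesis
    unfolding leading_index_def c_const_def multi_deriv_gen_fun[OF assms(1,2)] mi_less_def
    by (intro exI[of _ J]) (auto, meson linorder_not_le)
qed

section \<open>Covering the cube by monomial weights\<close>

text \<open>The coefficients \<open>s j\<close> may depend on \<open>x\<close>, but the leading one
  is 1. This is why the convolution of the monomial with \<open>u\<close> turns out independent of
  \<open>x\<close>.\<close>

lemma shifted_power_falling:
  "\<exists>s. s n = (1 :: real) \<and> (\<forall>k. (real_of_int x + real_of_int k) ^ n = (\<Sum>j\<le>n. s j * real_of_int (falling k j)))"
proof (induction n)
  case 0
  then show ?case by (auto simp: falling_0 intro: exI[of _ "\<lambda>_. 1"])
next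
  case (Suc n)
  then obtain s where s: "s n = 1" "\<And>k. (real_of_int x + real_of_int k) ^ n = (\<Sum>j\<le>n. s j * real_of_int (falling k j))"
    by blast
  \<comment> \<open>The recursion follows from k = (k - j) + j: multiplying the falling factorial of
    order j by x + k gives the one of order j + 1 plus x + j times itself.\<close>
  define s' where "s' j = (if j = 0 then 0 else s (j - 1)) + (if j \<le> n then s j * (real_of_int x + real j) else 0)" for j
  have "(real_of_int x + real_of_int k) ^ Suc n = (\<Sum>j\<le>Suc n. s' j * real_of_int (falling k j))" for k
  proof -
    define f where "f j = real_of_int (falling k j)" for j
    have f_Suc: "f j * (real_of_int x + real_of_int k) = f (Suc j) + f j * (real_of_int x + real j)" for j
      by (simp add: f_def falling_Suc algebra_simps)
    have "(real_of_int x + real_of_int k) ^ Suc n = (\<Sum>j\<le>n. s j * (f j * (real_of_int x + real_of_int k)))"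
      unfolding power_Suc2 s(2) sum_distrib_right f_def by (simp add: mult.assoc)
    also have "\<dots> = (\<Sum>j\<le>n. s j * f (Suc j)) + (\<Sum>j\<le>n. s j * (real_of_int x + real j) * f j)"
      unfolding f_Suc by (simp add: algebra_simps sum.distrib)
    also have "(\<Sum>j\<le>n. s j * f (Suc j)) = (\<Sum>j\<le>Suc n. (if j = 0 then 0 else s (j - 1)) * f j)"
      by (subst sum.atMost_Suc_shift) simp
    also have "(\<Sum>j\<le>n. s j * (real_of_int x + real j) * f j) = (\<Sum>j\<le>Suc n. (if j \<le> n then s j * (real_of_int x + real j) else 0) * f j)"
      by simp
    finally show ?thesis
      by (simp only: s'_def f_def distrib_right sum.distrib)
  qed
  moreover have "s' (Suc n) = 1" by (simp add: s'_def s)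
  ultimately show ?case by blast
qed

text \<open>Only the top-order term of the expansion in falling factorials meets a nonzero moment.\<close>

lemma monomial_convolution:
  fixes u :: "int ^ 'd::finite \<Rightarrow> real"
  assumes \<alpha>: "\<alpha> > 0" and u: "exp_decay C \<alpha> u"
    and vanish: "\<And>J. mi_less J I \<Longrightarrow> moment u (($) J) = 0"
  shows "((\<lambda>k. (\<Prod>i\<in>UNIV. real_of_int (k $ i) ^ (I $ i)) * u (x - k)) has_sum moment u (($) I)) UNIV"
proof -
  have "\<exists>s. \<forall>i. s i (I $ i) = (1 :: real) \<and>
      (\<forall>k. (real_of_int (x $ i) + real_of_int k) ^ (I $ i) = (\<Sum>j\<le>I $ i. s i j * real_of_int (falling k j)))"
    using shifted_power_falling by (intro choice allI)
  then obtain s where s1: "\<And>i. s i (I $ i) = 1"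
    and s: "\<And>i k. (real_of_int (x $ i) + real_of_int k) ^ (I $ i) = (\<Sum>j\<le>I $ i. s i j * real_of_int (falling k j))"
    by blast
  define P where "P = PiE UNIV (\<lambda>i. {..I $ i})"
  have finP: "finite P" unfolding P_def by (intro finite_PiE) auto
  define F where "F g k = (\<Prod>i\<in>UNIV. s i (g i)) * (u (- k) * (\<Prod>i\<in>UNIV. real_of_int (falling (k $ i) (g i))))" for g k
  have expand: "(\<Prod>i\<in>UNIV. real_of_int ((x + k) $ i) ^ (I $ i)) * u (- k) = (\<Sum>g\<in>P. F g k)" for k
  proof -
    have "(\<Prod>i\<in>UNIV. real_of_int ((x + k) $ i) ^ (I $ i)) = (\<Prod>i\<in>UNIV. \<Sum>j\<le>I $ i. s i j * real_of_int (falling (k $ i) j))"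
      by (simp add: s)
    also have "\<dots> = (\<Sum>g\<in>P. \<Prod>i\<in>UNIV. s i (g i) * real_of_int (falling (k $ i) (g i)))"
      unfolding P_def by (rule prod_sum_PiE) auto
    finally show ?thesis
      by (simp add: F_def sum_distrib_right sum_distrib_left prod.distrib mult_ac)
  qed
  have F: "((\<lambda>k. F g k) has_sum (\<Prod>i\<in>UNIV. s i (g i)) * moment u g) UNIV" for g
    unfolding F_def moment_def
    by (intro has_sum_cmult_right has_sum_infsum abs_summable_summable[OF moment_term_summable[OF \<alpha> u]])
  have "((\<lambda>k. \<Sum>g\<in>Q. F g k) has_sum (\<Sum>g\<in>Q. (\<Prod>i\<in>UNIV. s i (g i)) * moment u g)) UNIV"
    if "finite Q" for Q
    using that by (induction rule: finite_induct) (simp_all add: F has_sum_add)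
  from this[OF finP]
  have "((\<lambda>k. \<Sum>g\<in>P. F g k) has_sum (\<Sum>g\<in>P. (\<Prod>i\<in>UNIV. s i (g i)) * moment u g)) UNIV" .
  moreover have val: "(\<Sum>g\<in>P. (\<Prod>i\<in>UNIV. s i (g i)) * moment u g) = (\<Sum>g\<in>P. if g = ($) I then moment u (($) I) else 0)"
  proof (intro sum.cong refl)
    fix g assume g: "g \<in> P"
    show "(\<Prod>i\<in>UNIV. s i (g i)) * moment u g = (if g = ($) I then moment u (($) I) else 0)"
    proof (cases "g = ($) I")
      case True
      then show ?thesis by (simp add: s1)
    next
      case False
      have le: "g i \<le> I $ i" for i using g by (auto simp: P_def PiE_iff)
      obtain i where "g i \<noteq> I $ i" using False by (auto simp: fun_eq_iff)
      then have "g i < I $ i" using le[of i] by simp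
      then have "(\<Sum>i\<in>UNIV. g i) < (\<Sum>i\<in>UNIV. I $ i)"
        using le by (intro sum_strict_mono_ex1) auto
      then have "mi_less (\<chi> i. g i) I"
        using le by (simp add: mi_less_def mi_norm_def)
      from vanish[OF this] False show ?thesis by (simp add: vec_lambda_inverse)
    qed
  qed
  moreover have "($) I \<in> P" by (simp add: P_def PiE_iff)
  ultimately have "((\<lambda>k. (\<Prod>i\<in>UNIV. real_of_int ((x + k) $ i) ^ (I $ i)) * u (x - (x + k))) has_sum moment u (($) I)) UNIV"
  proof -
    have "(\<lambda>k. (\<Prod>i\<in>UNIV. real_of_int ((x + k) $ i) ^ (I $ i)) * u (x - (x + k))) = (\<lambda>k. \<Sum>g\<in>P. F g k)"
      using expand by (simp add: fun_eq_iff)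
    then show ?thesis
      using \<open>((\<lambda>k. \<Sum>g\<in>P. F g k) has_sum _) UNIV\<close> finP \<open>($) I \<in> P\<close> val by (simp only: sum.delta if_True)
  qed
  moreover have "bij_betw (\<lambda>k. x + k) UNIV UNIV"
    by (rule bij_betwI[where g = "\<lambda>k. k - x"]) auto
  ultimately show ?thesis
    using has_sum_reindex_bij_betw[of "\<lambda>k. x + k" UNIV UNIV "\<lambda>k. (\<Prod>i\<in>UNIV. real_of_int (k $ i) ^ (I $ i)) * u (x - k)"]
    by blast
qed

section \<open>Lattice points in boxes and shells, and the tail of the convolution\<close>

definition sup_norm :: "int ^ 'd::finite \<Rightarrow> nat"
  where "sup_norm k = Max (range (\<lambda>i. nat \<bar>k $ i\<bar>))"

lemma abs_le_sup_norm: "\<bar>k $ i\<bar> \<le> int (sup_norm k)"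
proof -
  have "nat \<bar>k $ i\<bar> \<le> sup_norm k" unfolding sup_norm_def by (intro Max_ge) auto
  then show ?thesis by simp
qed

lemma sup_norm_attained: obtains i where "\<bar>k $ i\<bar> = int (sup_norm k)"
proof -
  have "sup_norm k \<in> range (\<lambda>i. nat \<bar>k $ i\<bar>)" unfolding sup_norm_def by (intro Max_in) auto
  then show thesis using that by fastforce
qed

text \<open>A shell is estimated by the full box that contains it; the loss is polynomial in r and
  is absorbed later by the exponential decay.\<close>

lemma sum_shells_le:
  fixes F :: "(int ^ 'd::finite) set"
  assumes "finite F" "\<And>r. h r \<ge> (0 :: real)"
  shows "(\<Sum>k\<in>F. h (sup_norm k)) \<le> (\<Sum>r\<in>sup_norm ` F. real (2 * r + 1) ^ CARD('d) * h r)"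
proof -
  have "(\<Sum>k\<in>F. h (sup_norm k)) = (\<Sum>r\<in>sup_norm ` F. \<Sum>k\<in>{k\<in>F. sup_norm k = r}. h (sup_norm k))"
    by (rule sum.image_gen[OF assms(1)])
  also have "\<dots> = (\<Sum>r\<in>sup_norm ` F. real (card {k\<in>F. sup_norm k = r}) * h r)"
    by (intro sum.cong) auto
  also have "\<dots> \<le> (\<Sum>r\<in>sup_norm ` F. real (2 * r + 1) ^ CARD('d) * h r)"
  proof (intro sum_mono mult_right_mono assms)
    fix r
    have "{k\<in>F. sup_norm k = r} \<subseteq> int_box r"
      using abs_le_sup_norm by (auto simp: int_box_def)
    then have "card {k\<in>F. sup_norm k = r} \<le> (2 * r + 1) ^ CARD('d)"
      using card_mono[OF finite_int_box] by (simp only: card_int_box)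
    then have "real (card {k\<in>F. sup_norm k = r}) \<le> real ((2 * r + 1) ^ CARD('d))"
      by (simp only: of_nat_le_iff)
    then show "real (card {k\<in>F. sup_norm k = r}) \<le> real (2 * r + 1) ^ CARD('d)"
      by (simp only: of_nat_power)
  qed
  finally show ?thesis .
qed

lemma cube_eq_int_box:
  assumes "R \<ge> 0"
  shows "cube R = int_box (nat \<lfloor>R\<rfloor>)"
proof -
  have "\<bar>real_of_int m\<bar> \<le> R \<longleftrightarrow> \<bar>m\<bar> \<le> int (nat \<lfloor>R\<rfloor>)" for m
    using assms by (simp add: le_floor_iff)
  then show ?thesis by (simp add: cube_def int_box_def)
qed

lemma finite_cube: "R \<ge> 0 \<Longrightarrow> finite (cube R)"
  by (simp add: cube_eq_int_box finite_int_box)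

lemma card_cube_le:
  assumes "R \<ge> 0"
  shows "real (card (cube R :: (int ^ 'd::finite) set)) \<le> (2 * R + 1) ^ CARD('d)"
proof -
  have "real (card (cube R :: (int ^ 'd) set)) = (2 * real (nat \<lfloor>R\<rfloor>) + 1) ^ CARD('d)"
    by (simp add: cube_eq_int_box[OF assms] card_int_box add.commute)
  also have "\<dots> \<le> (2 * R + 1) ^ CARD('d)"
    using assms by (intro power_mono) auto
  finally show ?thesis .
qed

text \<open>The threshold gives 2m \<le> \<alpha> sqrt r, and ln r \<le> sqrt r; hence m ln r \<le>
  m sqrt r \<le> \<alpha> r / 2.\<close>

lemma power_le_exp_half:
  assumes "\<alpha> > 0" "r > 0" "r \<ge> 8 * (real m)\<^sup>2 / \<alpha>\<^sup>2"
  shows "r ^ m \<le> exp (\<alpha> * r / 2)"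
proof -
  define y where "y = sqrt r"
  have y: "y > 0" "y\<^sup>2 = r" using assms by (auto simp: y_def)
  have "8 * (real m)\<^sup>2 \<le> r * \<alpha>\<^sup>2"
    using assms by (simp add: pos_divide_le_eq)
  then have "(2 * real m)\<^sup>2 \<le> (\<alpha> * y)\<^sup>2"
    by (simp add: power_mult_distrib y mult.commute) (use zero_le_power2[of "real m"] in linarith)
  then have 1: "2 * real m \<le> \<alpha> * y"
    by (rule power2_le_imp_le) (use assms y in simp)
  have "ln (y / 2) \<le> y / 2 - 1" using y by (intro ln_le_minus_one) auto
  moreover have "ln (2::real) \<le> 1" using ln_le_minus_one[of 2] by simp
  ultimately have "ln y \<le> y / 2" using y by (simp add: ln_div)
  moreover have "ln r = 2 * ln y" using y by (simp add: ln_realpow flip: y(2))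
  ultimately have "real m * ln r \<le> real m * y" by (intro mult_left_mono) auto
  also have "\<dots> \<le> (\<alpha> * y / 2) * y" using 1 y by (intro mult_right_mono) auto
  also have "\<dots> = \<alpha> * r / 2" by (simp flip: y(2) add: power2_eq_square)
  finally have "exp (real m * ln r) \<le> exp (\<alpha> * r / 2)" by simp
  then show ?thesis using assms by (simp add: exp_of_nat_mult)
qed

lemma geometric_tail_le:
  fixes q :: real
  assumes "0 < q" "q < 1" "finite G" "\<And>r. r \<in> G \<Longrightarrow> r0 \<le> r"
  shows "(\<Sum>r\<in>G. q ^ r) \<le> q ^ r0 / (1 - q)"
proof -
  have inj: "inj_on (\<lambda>r. r - r0) G" using assms(4) by (auto simp: inj_on_def dest: eq_diff_iff)
  have "(\<Sum>r\<in>G. q ^ r) = (\<Sum>r\<in>G. q ^ r0 * q ^ (r - r0))"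
    using assms(4) by (intro sum.cong) (auto simp flip: power_add)
  also have "\<dots> = q ^ r0 * (\<Sum>r\<in>(\<lambda>r. r - r0) ` G. q ^ r)"
    by (simp add: sum.reindex[OF inj] sum_distrib_left)
  also have "(\<Sum>r\<in>(\<lambda>r. r - r0) ` G. q ^ r) \<le> (\<Sum>r. q ^ r)"
    using assms by (intro sum_le_suminf summable_geometric) auto
  then have "q ^ r0 * (\<Sum>r\<in>(\<lambda>r. r - r0) ` G. q ^ r) \<le> q ^ r0 * (1 / (1 - q))"
    using assms by (intro mult_left_mono) (auto simp: suminf_geometric)
  finally show ?thesis by simp
qed

text \<open>Outside the cube a point k of sup norm r has weight at most r^N, with N the total
  degree, and meets \<open>u\<close> with at most C exp(\<alpha> l - \<alpha> r). Half of the decay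
  absorbs the r^N and the shell size, and a geometric series of ratio exp(-\<alpha>/2)
  remains.\<close>

lemma monomial_tail_bound:
  fixes u :: "int ^ 'd::finite \<Rightarrow> real"
  assumes \<alpha>: "\<alpha> > 0" and C: "C > 0" and u: "exp_decay C \<alpha> u"
    and l: "l \<ge> 0" and x: "x \<in> cube l"
    and R: "R \<ge> 8 * (real CARD('d) + real (mi_norm I))\<^sup>2 / \<alpha>\<^sup>2"
    and F: "finite F" "F \<subseteq> - cube R"
  shows "(\<Sum>k\<in>F. \<bar>(\<Prod>i\<in>UNIV. real_of_int (k $ i) ^ (I $ i)) * u (x - k)\<bar>)
    \<le> 3 ^ CARD('d) * C * exp (\<alpha> * l - \<alpha> * R / 2) / (1 - exp (- \<alpha> / 2))"
proof -
  define N where "N = mi_norm I"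
  define q where "q = exp (- \<alpha> / 2)"
  have q: "0 < q" "q < 1" using \<alpha> by (auto simp: q_def)
  have q_power: "q ^ r = exp (- \<alpha> / 2 * real r)" for r
    unfolding q_def exp_of_nat_mult[symmetric] by (simp only: mult.commute)
  define h where "h r = C * exp (\<alpha> * l) * (real r ^ N * exp (- \<alpha> * real r))" for r
  have R_pos: "R > 0"
  proof -
    have "0 < 8 * (real CARD('d) + real (mi_norm I))\<^sup>2 / \<alpha>\<^sup>2"
      using \<alpha> by (intro divide_pos_pos mult_pos_pos zero_less_power add_pos_nonneg) auto
    then show ?thesis using R by linarith
  qed
  have term_le: "\<bar>(\<Prod>i\<in>UNIV. real_of_int (k $ i) ^ (I $ i)) * u (x - k)\<bar> \<le> h (sup_norm k)" for k
  proof -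
    have "(\<Prod>i\<in>UNIV. \<bar>real_of_int (k $ i)\<bar> ^ (I $ i)) \<le> (\<Prod>i\<in>UNIV. real (sup_norm k) ^ (I $ i))"
    proof (intro prod_mono conjI power_mono)
      show "\<bar>real_of_int (k $ i)\<bar> \<le> real (sup_norm k)" for i
        using abs_le_sup_norm[of k i] by linarith
    qed auto
    also have "\<dots> = real (sup_norm k) ^ N"
      by (simp add: N_def mi_norm_def power_sum)
    finally have 1: "\<bar>\<Prod>i\<in>UNIV. real_of_int (k $ i) ^ (I $ i)\<bar> \<le> real (sup_norm k) ^ N"
      by (simp add: abs_prod power_abs)
    \<comment> \<open>One coordinate of largest modulus suffices to bound the distance of
      \<open>x\<close> and \<open>k\<close> from below.\<close>
    obtain i where i: "\<bar>k $ i\<bar> = int (sup_norm k)" by (rule sup_norm_attained)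
    have "\<bar>(x - k) $ i\<bar> \<le> lattice_norm (x - k)"
      unfolding lattice_norm_def by (rule member_le_sum) auto
    moreover have "\<bar>real_of_int (x $ i)\<bar> \<le> l" using x by (simp add: cube_def)
    ultimately have "real (sup_norm k) - l \<le> real_of_int (lattice_norm (x - k))"
      using i by simp
    then have "- \<alpha> * real_of_int (lattice_norm (x - k)) \<le> - \<alpha> * (real (sup_norm k) - l)"
      using \<alpha> by (intro mult_left_mono_neg) auto
    then have "exp (- \<alpha> * real_of_int (lattice_norm (x - k))) \<le> exp (\<alpha> * l) * exp (- \<alpha> * real (sup_norm k))"
      by (simp add: algebra_simps flip: exp_add)
    then have "C * exp (- \<alpha> * real_of_int (lattice_norm (x - k))) \<le> C * (exp (\<alpha> * l) * exp (- \<alpha> * real (sup_norm k)))"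
      using C by (intro mult_left_mono) auto
    then have "\<bar>u (x - k)\<bar> \<le> C * (exp (\<alpha> * l) * exp (- \<alpha> * real (sup_norm k)))"
      using u unfolding exp_decay_def by (meson order_trans)
    with 1 have "\<bar>\<Prod>i\<in>UNIV. real_of_int (k $ i) ^ (I $ i)\<bar> * \<bar>u (x - k)\<bar>
        \<le> real (sup_norm k) ^ N * (C * (exp (\<alpha> * l) * exp (- \<alpha> * real (sup_norm k))))"
      by (rule mult_mono) auto
    then show ?thesis by (simp add: h_def abs_mult mult_ac)
  qed
  have large: "R < real r" if r: "r \<in> sup_norm ` F" for r
  proof -
    obtain k :: "int ^ 'd" where k: "k \<notin> cube R" "r = sup_norm k" using r F(2) by blast
    then obtain i where "\<not> \<bar>real_of_int (k $ i)\<bar> \<le> R" by (auto simp: cube_def)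
    then show ?thesis using abs_le_sup_norm[of k i] k by linarith
  qed
  have shell: "real (2 * r + 1) ^ CARD('d) * h r \<le> (3 ^ CARD('d) * C * exp (\<alpha> * l)) * q ^ r"
    if r: "r \<in> sup_norm ` F" for r
  proof -
    \<comment> \<open>For integers r \<ge> 1 one has 2r + 1 \<le> 3r, which is the origin of the
      factor 3^d in R.\<close>
    have "r > 0" using large[OF r] R_pos by (auto intro: gr0I)
    then have "real (2 * r + 1) ^ CARD('d) \<le> (3 * real r) ^ CARD('d)"
      by (intro power_mono) auto
    then have "real (2 * r + 1) ^ CARD('d) * real r ^ N \<le> 3 ^ CARD('d) * real r ^ (CARD('d) + N)"
      by (simp add: power_mult_distrib power_add mult.assoc[symmetric] mult_right_mono)
    also have "real r ^ (CARD('d) + N) \<le> exp (\<alpha> * real r / 2)"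
      using \<alpha> \<open>r > 0\<close> large[OF r] R by (intro power_le_exp_half) (auto simp: N_def)
    finally have "real (2 * r + 1) ^ CARD('d) * real r ^ N * exp (- \<alpha> * real r) \<le> 3 ^ CARD('d) * exp (\<alpha> * real r / 2) * exp (- \<alpha> * real r)"
      by (intro mult_right_mono) auto
    also have "\<dots> = 3 ^ CARD('d) * q ^ r"
    proof -
      have "\<alpha> * real r / 2 + - \<alpha> * real r = - \<alpha> / 2 * real r" by (simp add: field_simps)
      then show ?thesis by (simp only: mult.assoc q_power flip: exp_add)
    qed
    finally have "(C * exp (\<alpha> * l)) * (real (2 * r + 1) ^ CARD('d) * real r ^ N * exp (- \<alpha> * real r)) \<le> (C * exp (\<alpha> * l)) * (3 ^ CARD('d) * q ^ r)"
      using C by (intro mult_left_mono) auto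
    then show ?thesis by (simp add: h_def mult_ac)
  qed
  define r0 where "r0 = nat \<lceil>R\<rceil>"
  have "r0 \<le> r" if "r \<in> sup_norm ` F" for r
    using large[OF that] by (simp add: r0_def ceiling_le_iff nat_le_iff)
  then have geo: "(\<Sum>r\<in>sup_norm ` F. q ^ r) \<le> q ^ r0 / (1 - q)"
    using F q by (intro geometric_tail_le) auto
  have "q ^ r0 = exp (- \<alpha> / 2 * real r0)" by (rule q_power)
  also have "\<dots> \<le> exp (- \<alpha> * R / 2)"
  proof -
    have "R \<le> real r0" by (simp add: r0_def) linarith
    then have "\<alpha> * R \<le> \<alpha> * real r0" using \<alpha> by (intro mult_left_mono) auto
    then show ?thesis by simp
  qed
  finally have q_r0: "q ^ r0 \<le> exp (- \<alpha> * R / 2)" .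
  have "(\<Sum>k\<in>F. \<bar>(\<Prod>i\<in>UNIV. real_of_int (k $ i) ^ (I $ i)) * u (x - k)\<bar>) \<le> (\<Sum>k\<in>F. h (sup_norm k))"
    by (intro sum_mono term_le)
  also have "\<dots> \<le> (\<Sum>r\<in>sup_norm ` F. real (2 * r + 1) ^ CARD('d) * h r)"
    using C by (intro sum_shells_le F) (simp add: h_def)
  also have "\<dots> \<le> (\<Sum>r\<in>sup_norm ` F. (3 ^ CARD('d) * C * exp (\<alpha> * l)) * q ^ r)"
    by (intro sum_mono shell)
  also have "\<dots> = (3 ^ CARD('d) * C * exp (\<alpha> * l)) * (\<Sum>r\<in>sup_norm ` F. q ^ r)"
    by (simp add: sum_distrib_left)
  also have "\<dots> \<le> (3 ^ CARD('d) * C * exp (\<alpha> * l)) * (exp (- \<alpha> * R / 2) / (1 - q))"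
    using C q q_r0 by (intro mult_left_mono order_trans[OF geo] divide_right_mono) auto
  also have "\<dots> = 3 ^ CARD('d) * C * exp (\<alpha> * l - \<alpha> * R / 2) / (1 - exp (- \<alpha> / 2))"
  proof -
    have "exp (\<alpha> * l) * exp (- \<alpha> * R / 2) = exp (\<alpha> * l - \<alpha> * R / 2)"
      by (simp flip: exp_add)
    then show ?thesis
      by (simp only: q_def times_divide_eq_right mult.assoc)
  qed
  finally show ?thesis .
qed

text \<open>On all of \<int>^d the weighted sum equals the constant c exactly. R is chosen so that
  the terms outside \<Gamma> contribute at most |c|/2 for every \<open>x\<close> in the inner
  cube.\<close>

lemma monomial_covering:
  fixes u :: "int ^ 'd::finite \<Rightarrow> real"
  assumes \<alpha>: "\<alpha> > 0" and C: "C > 0" and u: "exp_decay C \<alpha> u" and I: "leading_index u I" and l: "l > 0"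
  defines "R \<equiv> R_const u I C \<alpha> l"
  obtains t where "\<And>k. k \<in> cube R \<Longrightarrow> \<bar>t k\<bar> \<le> R ^ mi_norm I"
    and "\<And>x. x \<in> cube l \<Longrightarrow> cmod (c_const u I) / 2 \<le> (\<Sum>k\<in>cube R. t k * u (x - k))"
proof -
  define c where "c = moment u (($) I)"
  have c_const: "c_const u I = of_real c"
    by (simp add: c_const_def c_def multi_deriv_gen_fun[OF \<alpha> u])
  have c_nz: "c \<noteq> 0" using I c_const by (simp add: leading_index_def)
  have vanish: "moment u (($) J) = 0" if "mi_less J I" for J
    using I that by (simp add: leading_index_def multi_deriv_gen_fun[OF \<alpha> u])
  \<comment> \<open>\<open>L\<close> is the argument of the logarithm in R; the tail bound equals L
    |c|/2 times exp(\<alpha> l - \<alpha> R/2).\<close>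
  define L where "L = 2 * 3 ^ CARD('d) * C / (\<bar>c\<bar> * (1 - exp (- \<alpha> / 2)))"
  have q: "1 - exp (- \<alpha> / 2) > 0" using \<alpha> by simp
  have L: "L > 0" unfolding L_def using C c_nz q by (intro divide_pos_pos mult_pos_pos) auto
  have R1: "R \<ge> 2 * l + 2 / \<alpha> * ln L"
    by (simp add: R_def R_const_def c_const L_def)
  have R2: "R \<ge> 8 * (real CARD('d) + real (mi_norm I))\<^sup>2 / \<alpha>\<^sup>2"
    by (simp add: R_def R_const_def)
  have R_nn: "R \<ge> 0" by (rule order_trans[OF _ R2]) simp
  define w where "w k = (\<Prod>i\<in>UNIV. real_of_int (k $ i) ^ (I $ i))" for k :: "int ^ 'd"
  have w_le: "\<bar>w k\<bar> \<le> R ^ mi_norm I" if "k \<in> cube R" for k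
  proof -
    have "\<bar>w k\<bar> = (\<Prod>i\<in>UNIV. \<bar>real_of_int (k $ i)\<bar> ^ (I $ i))"
      by (simp add: w_def abs_prod power_abs)
    also have "\<dots> \<le> (\<Prod>i\<in>UNIV. R ^ (I $ i))"
      using that by (intro prod_mono conjI power_mono) (auto simp: cube_def)
    finally show ?thesis by (simp add: mi_norm_def power_sum)
  qed
  have cover: "\<bar>c - (\<Sum>k\<in>cube R. w k * u (x - k))\<bar> \<le> \<bar>c\<bar> / 2" if x: "x \<in> cube l" for x
  proof -
    have hs: "((\<lambda>k. w k * u (x - k)) has_sum c) UNIV"
      unfolding w_def c_def by (rule monomial_convolution[OF \<alpha> u vanish])
    then have summ: "(\<lambda>k. w k * u (x - k)) summable_on A" for A
      using has_sum_imp_summable summable_on_subset_banach by blast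
    have abs_summ: "(\<lambda>k. norm (w k * u (x - k))) summable_on A" for A
      by (rule summable_on_iff_abs_summable_on_real[THEN iffD1, OF summ])
    have "c = infsum (\<lambda>k. w k * u (x - k)) (cube R \<union> - cube R)"
      using infsumI[OF hs] by simp
    also have "\<dots> = (\<Sum>k\<in>cube R. w k * u (x - k)) + infsum (\<lambda>k. w k * u (x - k)) (- cube R)"
      by (subst infsum_Un_disjoint) (auto simp: finite_cube[OF R_nn] summ)
    finally have "\<bar>c - (\<Sum>k\<in>cube R. w k * u (x - k))\<bar> = norm (infsum (\<lambda>k. w k * u (x - k)) (- cube R))"
      by simp
    also have "\<dots> \<le> infsum (\<lambda>k. norm (w k * u (x - k))) (- cube R)"
      by (rule norm_infsum_bound[OF abs_summ])
    also have "\<dots> \<le> 3 ^ CARD('d) * C * exp (\<alpha> * l - \<alpha> * R / 2) / (1 - exp (- \<alpha> / 2))"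
    proof (rule infsum_le_finite_sums[OF abs_summ])
      fix F :: "(int ^ 'd) set" assume "finite F" "F \<subseteq> - cube R"
      from monomial_tail_bound[OF \<alpha> C u _ x R2 this] l
      show "(\<Sum>k\<in>F. norm (w k * u (x - k))) \<le> 3 ^ CARD('d) * C * exp (\<alpha> * l - \<alpha> * R / 2) / (1 - exp (- \<alpha> / 2))"
        by (simp add: w_def)
    qed
    also have "\<dots> = L * \<bar>c\<bar> / 2 * exp (\<alpha> * l - \<alpha> * R / 2)"
    proof -
      have "b * e / D = 2 * b / (\<bar>c\<bar> * D) * \<bar>c\<bar> / 2 * e" if "D > 0" for b D e :: real
        using c_nz that by (simp add: field_simps)
      from this[OF q, of "3 ^ CARD('d) * C"] show ?thesis
        by (simp only: L_def mult.assoc)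
    qed
    also have "exp (\<alpha> * l - \<alpha> * R / 2) \<le> 1 / L"
    proof -
      \<comment> \<open>R \<ge> 2l + (2/\<alpha>) ln L says precisely that the exponential is at
        most 1/L, which leaves |c|/2 for the tail.\<close>
      have "\<alpha> * (2 * l + 2 / \<alpha> * ln L) \<le> \<alpha> * R" using R1 \<alpha> by (intro mult_left_mono) auto
      then have "\<alpha> * l - \<alpha> * R / 2 \<le> - ln L" using \<alpha> by (simp add: distrib_left)
      then have "exp (\<alpha> * l - \<alpha> * R / 2) \<le> exp (- ln L)" by simp
      also have "\<dots> = 1 / L" using L by (simp add: exp_minus divide_inverse)
      finally show ?thesis .
    qed
    then have "L * \<bar>c\<bar> / 2 * exp (\<alpha> * l - \<alpha> * R / 2) \<le> L * \<bar>c\<bar> / 2 * (1 / L)"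
      using L by (intro mult_left_mono) auto
    finally show ?thesis using L by simp
  qed
  show thesis
  \<comment> \<open>c is real but may be negative; its sign turns the weights into a positive
    covering.\<close>
  proof (rule that[of "\<lambda>k. sgn c * w k"])
    show "\<bar>sgn c * w k\<bar> \<le> R ^ mi_norm I" if "k \<in> cube R" for k
      using w_le[OF that] c_nz by (simp add: abs_mult abs_sgn_eq)
    fix x :: "int ^ 'd" assume x: "x \<in> cube l"
    have "(\<Sum>k\<in>cube R. sgn c * w k * u (x - k)) = sgn c * (\<Sum>k\<in>cube R. w k * u (x - k))"
      by (simp add: sum_distrib_left mult.assoc)
    then show "cmod (c_const u I) / 2 \<le> (\<Sum>k\<in>cube R. sgn c * w k * u (x - k))"
      using cover[OF x] c_nz by (simp add: c_const sgn_if abs_if split: if_splits)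
  qed
qed

text \<open>R is the maximum of 2l + a and b with \<open>a\<close>, \<open>b\<close> independent of
  l. The linear bound turns powers of R into powers of 2l + 1 with a constant independent of
  l.\<close>

lemma R_const_linear_bound:
  assumes "\<alpha> > 0"
  obtains K where "K \<ge> 1" "\<And>l. l > 0 \<Longrightarrow> 0 \<le> R_const u I C \<alpha> l" "\<And>l. l > 0 \<Longrightarrow> R_const u I C \<alpha> l \<le> K * (2 * l + 1)"
proof -
  define a where "a = 2 / \<alpha> * ln (2 * 3 ^ CARD('a) * C / (cmod (c_const u I) * (1 - exp (- \<alpha> / 2))))"
  define b where "b = 8 * (real CARD('a) + real (mi_norm I))\<^sup>2 / \<alpha>\<^sup>2"
  have b: "b \<ge> 0" by (simp add: b_def)
  have R: "R_const u I C \<alpha> l = max (2 * l + a) b" for l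
    by (simp add: R_const_def a_def b_def)
  define K where "K = 1 + \<bar>a\<bar> + b"
  show thesis
  proof (rule that[of K])
    fix l :: real assume l: "l > 0"
    have "K * 1 \<le> K * (2 * l + 1)" "1 * (2 * l) \<le> K * (2 * l)"
      using l b by (intro mult_mono; simp add: K_def)+
    then show "R_const u I C \<alpha> l \<le> K * (2 * l + 1)"
      unfolding R using b by (auto simp: K_def algebra_simps max_def)
    show "0 \<le> R_const u I C \<alpha> l" unfolding R using b by simp
  qed (use b in \<open>simp add: K_def\<close>)
qed

section \<open>The Wegner estimate\<close>

text \<open>The operator as a function of its potential alone, so that potentials can be compared
  without reference to coupling constants.\<close>

definition restricted_schroedinger ::
    "(int ^ 'd::finite) set \<Rightarrow> (int ^ 'd \<Rightarrow> real) \<Rightarrow> (int ^ 'd \<Rightarrow> complex) \<Rightarrow> (int ^ 'd \<Rightarrow> complex)"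
  where "restricted_schroedinger X V \<psi> =
    truncate_to X (\<lambda>x. h0 (truncate_to X \<psi>) x + of_real (V x) * truncate_to X \<psi> x)"

lemma alloy_restricted_eq: "alloy_restricted X u \<omega> = restricted_schroedinger X (alloy_potential u \<omega>)"
  by (simp add: fun_eq_iff alloy_restricted_def alloy_hamiltonian_def restricted_schroedinger_def)

lemma truncate_to_l2_space: "\<psi> \<in> l2_space X \<Longrightarrow> truncate_to X \<psi> = \<psi>"
  by (auto simp: truncate_to_def l2_space_def)

lemma finite_neighbours: "finite {y. lattice_norm (x - y) = 1}"
proof (rule finite_subset)
  show "{y. lattice_norm (x - y) = 1} \<subseteq> (\<lambda>k. x - k) ` int_box 1"
  proof
    fix y assume "y \<in> {y. lattice_norm (x - y) = 1}"
    then have "lattice_norm (x - y) = 1" by simp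
    moreover have "\<bar>(x - y) $ i\<bar> \<le> lattice_norm (x - y)" for i
      unfolding lattice_norm_def by (rule member_le_sum) auto
    ultimately have "x - y \<in> int_box 1" by (simp add: int_box_def)
    then show "y \<in> (\<lambda>k. x - k) ` int_box 1"
      by (rule rev_image_eqI) simp
  qed
qed (simp add: finite_int_box)

text \<open>Neighbours outside \<open>X\<close> count in the diagonal term only, as the functions
  vanish there. The remaining double sum is symmetric in the lattice points, which yields
  hermiticity.\<close>

lemma l2_inner_h0:
  assumes X: "finite X" and "\<phi> \<in> l2_space X" "\<psi> \<in> l2_space X"
  shows "l2_inner X \<phi> (h0 \<psi>) = (\<Sum>x\<in>X. of_nat (card {y. lattice_norm (x - y) = 1}) * (cnj (\<phi> x) * \<psi> x))
    - (\<Sum>x\<in>X. \<Sum>y\<in>X. if lattice_norm (x - y) = 1 then cnj (\<phi> x) * \<psi> y else 0)"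
proof -
  have "cnj (\<phi> x) * h0 \<psi> x = of_nat (card {y. lattice_norm (x - y) = 1}) * (cnj (\<phi> x) * \<psi> x)
      - (\<Sum>y\<in>X. if lattice_norm (x - y) = 1 then cnj (\<phi> x) * \<psi> y else 0)" for x
  proof -
    have "(\<Sum>y\<in>{y. lattice_norm (x - y) = 1}. \<psi> y) = (\<Sum>y\<in>{y. lattice_norm (x - y) = 1} \<inter> X. \<psi> y)"
      using assms(3) finite_neighbours by (intro sum.mono_neutral_right) (auto simp: l2_space_def)
    also have "\<dots> = (\<Sum>y\<in>X. if lattice_norm (x - y) = 1 then \<psi> y else 0)"
      using X by (subst Int_commute) (simp add: sum.inter_restrict)
    finally have "h0 \<psi> x = of_nat (card {y. lattice_norm (x - y) = 1}) * \<psi> x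
        - (\<Sum>y\<in>X. if lattice_norm (x - y) = 1 then \<psi> y else 0)"
      by (simp add: h0_def sum_subtractf)
    then show ?thesis
      by (simp add: right_diff_distrib sum_distrib_left if_distrib mult.left_commute cong: if_cong)
  qed
  then show ?thesis
    by (simp add: l2_inner_def sum_subtractf)
qed

lemma lattice_norm_minus_commute: "lattice_norm (x - y) = lattice_norm (y - x)"
  using lattice_norm_minus[of "x - y"] by simp

lemma l2_inner_restricted_schroedinger:
  assumes "\<psi> \<in> l2_space X"
  shows "l2_inner X \<phi> (restricted_schroedinger X V \<psi>) =
    l2_inner X \<phi> (h0 \<psi>) + (\<Sum>x\<in>X. of_real (V x) * (cnj (\<phi> x) * \<psi> x))"
  using assms by (simp add: restricted_schroedinger_def truncate_to_l2_space)
    (simp add: l2_inner_def truncate_to_def distrib_left sum.distrib mult.left_commute)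

lemma l2_hermitian_restricted_schroedinger:
  assumes X: "finite X"
  shows "l2_hermitian X (restricted_schroedinger X V)"
  unfolding l2_hermitian_def
proof (intro conjI ballI allI)
  fix \<psi> assume "\<psi> \<in> l2_space X"
  show "restricted_schroedinger X V \<psi> \<in> l2_space X"
    by (simp add: restricted_schroedinger_def l2_space_def truncate_to_def)
next
  fix \<phi> \<psi> c assume "\<phi> \<in> l2_space X" "\<psi> \<in> l2_space X"
  moreover from this have "(\<lambda>x. \<phi> x + c * \<psi> x) \<in> l2_space X" by (simp add: l2_space_def)
  moreover have "h0 (\<lambda>x. \<phi> x + c * \<psi> x) x = h0 \<phi> x + c * h0 \<psi> x" for x
    by (simp add: h0_def sum_distrib_left flip: sum.distrib) (simp add: algebra_simps)
  ultimately show "restricted_schroedinger X V (\<lambda>x. \<phi> x + c * \<psi> x) =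
      (\<lambda>x. restricted_schroedinger X V \<phi> x + c * restricted_schroedinger X V \<psi> x)"
    by (simp add: restricted_schroedinger_def truncate_to_l2_space)
      (auto simp: truncate_to_def fun_eq_iff algebra_simps)
next
  fix \<phi> \<psi> assume \<phi>: "\<phi> \<in> l2_space X" and \<psi>: "\<psi> \<in> l2_space X"
  have "l2_inner X (restricted_schroedinger X V \<phi>) \<psi> = cnj (l2_inner X \<psi> (restricted_schroedinger X V \<phi>))"
    by (simp add: cnj_l2_inner)
  also have "\<dots> = l2_inner X \<phi> (restricted_schroedinger X V \<psi>)"
    unfolding l2_inner_restricted_schroedinger[OF \<phi>] l2_inner_restricted_schroedinger[OF \<psi>]
      l2_inner_h0[OF X \<phi> \<psi>] l2_inner_h0[OF X \<psi> \<phi>]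
    by (subst (2) sum.swap) (simp add: mult.commute lattice_norm_minus_commute if_distrib cong: if_cong)
  finally show "l2_inner X \<phi> (restricted_schroedinger X V \<psi>) = l2_inner X (restricted_schroedinger X V \<phi>) \<psi>" ..
qed

section \<open>The eigenvalue count as a function of the potential\<close>

definition spectral_count :: "(int ^ 'd::finite) set \<Rightarrow> (int ^ 'd \<Rightarrow> real) \<Rightarrow> real set \<Rightarrow> real"
  where "spectral_count X V I = Re (op_trace X (spectral_projection X (restricted_schroedinger X V) I))"

text \<open>A single family \<nu> serves all sets \<open>I\<close> at once; this is what makes
  differences, monotonicity and gaps of the count accessible.\<close>

lemma spectral_count_eq_card:
  assumes "finite X"
  obtains \<nu> where "\<And>I. spectral_count X V I = real (card {j\<in>X. \<nu> j \<in> I})"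
proof -
  note A = l2_hermitian_restricted_schroedinger[OF assms, of V]
  obtain e \<nu> where e: "eigenbasis X (restricted_schroedinger X V) e \<nu> X"
    by (rule eigenbasis_exists[OF assms A])
  show thesis
    by (rule that[of \<nu>]) (simp add: spectral_count_def trace_spectral_projection_eq_card[OF assms A e])
qed

text \<open>The kinetic parts of the two quadratic forms coincide, so a pointwise inequality of the
  potentials is the form inequality of the Weyl comparison.\<close>

lemma spectral_count_shift:
  assumes X: "finite X" and le: "\<And>x. x \<in> X \<Longrightarrow> V' x \<le> V x - d" and "b - d < a"
  shows "spectral_count X V {..b} \<le> spectral_count X V' {..<a}"
proof -
  note A = l2_hermitian_restricted_schroedinger[OF X]
  obtain e \<nu> where e: "eigenbasis X (restricted_schroedinger X V) e \<nu> X"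
    by (rule eigenbasis_exists[OF X A])
  obtain e' \<nu>' where e': "eigenbasis X (restricted_schroedinger X V') e' \<nu>' X"
    by (rule eigenbasis_exists[OF X A])
  have "card {j\<in>X. \<nu> j \<le> b} \<le> card {j\<in>X. \<nu>' j < a}"
  proof (rule weyl_counting[OF X A A e e' _ assms(3)])
    fix \<psi> assume \<psi>: "\<psi> \<in> l2_space X"
    have Re_V: "Re (\<Sum>x\<in>X. of_real (U x) * (cnj (\<psi> x) * \<psi> x)) = (\<Sum>x\<in>X. U x * (cmod (\<psi> x))\<^sup>2)" for U
      by (simp add: mult.commute[of "cnj _"] complex_norm_square[symmetric] del: of_real_power)
    have "(\<Sum>x\<in>X. V' x * (cmod (\<psi> x))\<^sup>2) \<le> (\<Sum>x\<in>X. (V x - d) * (cmod (\<psi> x))\<^sup>2)"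
      by (intro sum_mono mult_right_mono le) auto
    then show "Re (l2_inner X \<psi> (restricted_schroedinger X V' \<psi>))
        \<le> Re (l2_inner X \<psi> (restricted_schroedinger X V \<psi>)) - d * Re (l2_inner X \<psi> \<psi>)"
      unfolding l2_inner_restricted_schroedinger[OF \<psi>] plus_complex.sel Re_V l2_inner_self Re_complex_of_real
      by (simp add: left_diff_distrib sum_subtractf sum_distrib_left)
  qed
  then show ?thesis
    by (simp add: spectral_count_def trace_spectral_projection_eq_card[OF X A e]
        trace_spectral_projection_eq_card[OF X A e'])
qed

lemma spectral_count_nonneg:
  assumes "finite X" shows "0 \<le> spectral_count X V I"
proof -
  obtain \<nu> where \<nu>: "\<And>I. spectral_count X V I = real (card {j\<in>X. \<nu> j \<in> I})"
    using spectral_count_eq_card[OF assms] by blast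
  show ?thesis by (simp add: \<nu>)
qed

lemma spectral_count_le_card:
  assumes "finite X" shows "spectral_count X V I \<le> real (card X)"
proof -
  obtain \<nu> where \<nu>: "\<And>I. spectral_count X V I = real (card {j\<in>X. \<nu> j \<in> I})"
    using spectral_count_eq_card[OF assms] by blast
  show ?thesis unfolding \<nu> using assms by (simp add: card_mono)
qed

lemma spectral_count_diff:
  assumes X: "finite X" and "I \<subseteq> J"
  shows "spectral_count X V (J - I) = spectral_count X V J - spectral_count X V I"
proof -
  obtain \<nu> where \<nu>: "\<And>I. spectral_count X V I = real (card {j\<in>X. \<nu> j \<in> I})"
    using spectral_count_eq_card[OF X] by blast
  have "{j\<in>X. \<nu> j \<in> J - I} = {j\<in>X. \<nu> j \<in> J} - {j\<in>X. \<nu> j \<in> I}" by auto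
  moreover have "{j\<in>X. \<nu> j \<in> I} \<subseteq> {j\<in>X. \<nu> j \<in> J}" using assms by auto
  ultimately show ?thesis
    unfolding \<nu> using X by (simp add: card_Diff_subset of_nat_diff card_mono)
qed

lemma spectral_count_mono:
  assumes "finite X" "I \<subseteq> J"
  shows "spectral_count X V I \<le> spectral_count X V J"
  using spectral_count_diff[OF assms, of V] spectral_count_nonneg[OF assms(1), of V "J - I"] by simp

lemma finite_set_gap_below:
  fixes S :: "real set"
  assumes "finite S"
  obtains e where "e > 0" "\<And>x. x \<in> S \<Longrightarrow> x < a \<Longrightarrow> x \<le> a - e"
proof -
  \<comment> \<open>The element 1 keeps \<open>T\<close> nonempty when no member of \<open>S\<close>
    lies below \<open>a\<close>.\<close>
  define T where "T = insert 1 ((\<lambda>x. a - x) ` {x\<in>S. x < a})"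
  have T: "finite T" "T \<noteq> {}" using assms by (auto simp: T_def)
  have "Min T > 0" using T by (auto simp: T_def)
  moreover have "x \<le> a - Min T" if "x \<in> S" "x < a" for x
  proof -
    have "Min T \<le> a - x" using T that by (intro Min_le) (auto simp: T_def)
    then show ?thesis by simp
  qed
  ultimately show thesis by (rule that)
qed

lemma open_pointwise_less:
  fixes c :: "'a \<Rightarrow> real"
  assumes "finite X"
  shows "open {V. \<forall>x\<in>X. V x < c x}"
proof -
  have "{V. \<forall>x\<in>X. V x < c x} = (\<Inter>x\<in>X. {V. V x < c x})" by auto
  also have "open \<dots>"
    using assms by (intro open_INT ballI open_Collect_less continuous_intros continuous_on_product_coordinates)
  finally show ?thesis .
qed

lemma open_pointwise_greater:
  fixes c :: "'a \<Rightarrow> real"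
  assumes "finite X"
  shows "open {V. \<forall>x\<in>X. c x < V x}"
proof -
  have "{V. \<forall>x\<in>X. c x < V x} = (\<Inter>x\<in>X. {V. c x < V x})" by auto
  also have "open \<dots>"
    using assms by (intro open_INT ballI open_Collect_less continuous_intros continuous_on_product_coordinates)
  finally show ?thesis .
qed

text \<open>By the Weyl inequality, counting below a level is lower semicontinuous in the potential, and
  counting up to a level is upper semicontinuous.\<close>

lemma spectral_count_lessThan_measurable:
  assumes X: "finite X"
  shows "(\<lambda>V. spectral_count X V {..<a}) \<in> borel_measurable borel"
proof (rule borel_measurableI_greater)
  fix c :: real
  have "open {V. c < spectral_count X V {..<a}}"
  proof (rule open_subopen[THEN iffD2], intro ballI)
    fix V assume V: "V \<in> {V. c < spectral_count X V {..<a}}"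
    obtain \<nu> where \<nu>: "\<And>I. spectral_count X V I = real (card {j\<in>X. \<nu> j \<in> I})"
      using spectral_count_eq_card[OF X] by blast
    obtain e where e: "e > 0" "\<And>x. x \<in> \<nu> ` X \<Longrightarrow> x < a \<Longrightarrow> x \<le> a - e"
      using finite_set_gap_below[of "\<nu> ` X" a] X by blast
    have "{j\<in>X. \<nu> j \<in> {..<a}} = {j\<in>X. \<nu> j \<in> {..a - e}}"
      using e by fastforce
    then have eq: "spectral_count X V {..<a} = spectral_count X V {..a - e}"
      by (simp only: \<nu>)
    define T where "T = {V'. \<forall>x\<in>X. V' x < V x + e / 2}"
    have "spectral_count X V {..a - e} \<le> spectral_count X V' {..<a}" if "V' \<in> T" for V'
      using that e(1) by (intro spectral_count_shift[OF X, where d = "- (e / 2)"]) (auto simp: T_def less_imp_le)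
    moreover have "open T" "V \<in> T"
      unfolding T_def using e(1) by (auto intro: open_pointwise_less[OF X])
    ultimately show "\<exists>T. open T \<and> V \<in> T \<and> T \<subseteq> {V. c < spectral_count X V {..<a}}"
      using V eq by (intro exI[of _ T]) fastforce
  qed
  then show "{V \<in> space borel. c < spectral_count X V {..<a}} \<in> sets borel" by simp
qed

lemma spectral_count_atMost_measurable:
  assumes X: "finite X"
  shows "(\<lambda>V. spectral_count X V {..b}) \<in> borel_measurable borel"
proof (rule borel_measurableI_less)
  fix c :: real
  have "open {V. spectral_count X V {..b} < c}"
  proof (rule open_subopen[THEN iffD2], intro ballI)
    fix V assume V: "V \<in> {V. spectral_count X V {..b} < c}"
    obtain \<nu> where \<nu>: "\<And>I. spectral_count X V I = real (card {j\<in>X. \<nu> j \<in> I})"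
      using spectral_count_eq_card[OF X] by blast
    \<comment> \<open>The gap above \<open>b\<close> is the gap below \<open>- b\<close> of the
      reflected eigenvalues.\<close>
    obtain e where e: "e > 0" "\<And>x. x \<in> uminus ` \<nu> ` X \<Longrightarrow> x < - b \<Longrightarrow> x \<le> - b - e"
      using finite_set_gap_below[of "uminus ` \<nu> ` X" "- b"] X by blast
    have "{j\<in>X. \<nu> j \<in> {..b}} = {j\<in>X. \<nu> j \<in> {..<b + e}}"
      using e by fastforce
    then have eq: "spectral_count X V {..b} = spectral_count X V {..<b + e}"
      by (simp only: \<nu>)
    define T where "T = {V'. \<forall>x\<in>X. V x - e / 2 < V' x}"
    have "spectral_count X V' {..b} \<le> spectral_count X V {..<b + e}" if "V' \<in> T" for V'
      using that e(1) by (intro spectral_count_shift[OF X, where d = "- (e / 2)"]) (force simp: T_def)+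
    moreover have "open T" "V \<in> T"
      unfolding T_def using e(1) by (auto intro: open_pointwise_greater[OF X])
    ultimately show "\<exists>T. open T \<and> V \<in> T \<and> T \<subseteq> {V. spectral_count X V {..b} < c}"
      using V eq by (intro exI[of _ T]) fastforce
  qed
  then show "{V \<in> space borel. spectral_count X V {..b} < c} \<in> sets borel" by simp
qed

text \<open>Every interval is a difference of two down-sets, and each of these is an open or a
  closed half-line; the four kinds of bounded intervals are thus treated together.\<close>

lemma spectral_count_interval_measurable:
  assumes X: "finite X" and I: "is_interval I" "bounded I" "I \<noteq> {}"
  shows "(\<lambda>V. spectral_count X V I) \<in> borel_measurable borel"
proof -
  define L where "L = {x. \<forall>y\<in>I. x < y}"
  define U where "U = {x. \<exists>y\<in>I. x \<le> y}"
  have I_eq: "I = U - L"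
  proof (intro equalityI subsetI)
    fix x assume "x \<in> U - L"
    then obtain y z where "y \<in> I" "x \<le> y" "z \<in> I" "z \<le> x"
      unfolding U_def L_def by (auto simp: not_less)
    then show "x \<in> I" using I(1) unfolding is_interval_1 by blast
  qed (auto simp: U_def L_def)
  have LU: "L \<subseteq> U" using I(3) by (auto simp: L_def U_def less_imp_le)
  have bdd: "bdd_above I" "bdd_below I" using I(2) by (auto simp: bounded_imp_bdd_above bounded_imp_bdd_below)
  have U: "U = {..Sup I} \<or> U = {..<Sup I}"
  proof (cases "Sup I \<in> I")
    case True
    then have "U = {..Sup I}" using bdd by (auto simp: U_def intro: order_trans cSup_upper)
    then show ?thesis ..
  next
    case False
    then have "y < Sup I" if "y \<in> I" for y using cSup_upper[OF that bdd(1)] that by (cases "y = Sup I") auto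
    moreover have "\<exists>y\<in>I. x \<le> y" if "x < Sup I" for x
      using less_cSupD[OF I(3) that] by (auto intro: less_imp_le)
    ultimately have "U = {..<Sup I}" by (force simp: U_def)
    then show ?thesis ..
  qed
  have L: "L = {..Inf I} \<or> L = {..<Inf I}"
  proof (cases "Inf I \<in> I")
    case True
    then have "L = {..<Inf I}" using bdd by (auto simp: L_def intro: less_le_trans cInf_lower)
    then show ?thesis ..
  next
    case False
    then have "Inf I < y" if "y \<in> I" for y using cInf_lower[OF that bdd(2)] that by (cases "y = Inf I") auto
    moreover have "x \<le> Inf I" if "\<forall>y\<in>I. x < y" for x
      using that I(3) by (intro cInf_greatest) (auto intro: less_imp_le)
    ultimately have "L = {..Inf I}" by (force simp: L_def)
    then show ?thesis ..
  qed
  have "(\<lambda>V. spectral_count X V U - spectral_count X V L) \<in> borel_measurable borel"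
    using U L spectral_count_lessThan_measurable[OF X] spectral_count_atMost_measurable[OF X]
    by (intro borel_measurable_diff) auto
  then show ?thesis
    by (subst I_eq) (simp only: spectral_count_diff[OF X LU])
qed

lemma alloy_potential_override:
  fixes u :: "int ^ 'd::finite \<Rightarrow> real"
  assumes \<Gamma>: "finite \<Gamma>" and u: "(\<lambda>k. \<bar>u k\<bar>) summable_on UNIV"
    and \<omega>: "\<And>k. k \<notin> \<Gamma> \<Longrightarrow> \<bar>\<omega> k\<bar> \<le> B"
  shows "alloy_potential u (override_on \<omega> \<eta> \<Gamma>) x =
    (\<Sum>k\<in>\<Gamma>. \<eta> k * u (x - k)) + (\<Sum>\<^sub>\<infinity>k\<in>- \<Gamma>. \<omega> k * u (x - k))"
proof -
  have bij: "bij_betw (\<lambda>k. x - k) UNIV UNIV"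
    by (rule bij_betwI[where g = "\<lambda>k. x - k"]) auto
  have "(\<lambda>k. \<bar>u (x - k)\<bar>) summable_on UNIV"
    using summable_on_reindex_bij_betw[OF bij, of "\<lambda>k. \<bar>u k\<bar>"] u by simp
  then have "(\<lambda>k. \<bar>u (x - k)\<bar>) summable_on - \<Gamma>"
    by (rule summable_on_subset_banach) simp
  then have "(\<lambda>k. B * \<bar>u (x - k)\<bar>) summable_on - \<Gamma>"
    by (rule summable_on_cmult_right)
  then have "(\<lambda>k. norm (\<omega> k * u (x - k))) summable_on - \<Gamma>"
    by (rule Infinite_Sum.abs_summable_on_comparison_test')
      (auto simp: abs_mult intro!: mult_right_mono \<omega>)
  then have 1: "(\<lambda>k. \<omega> k * u (x - k)) summable_on - \<Gamma>"
    by (rule abs_summable_summable)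
  have eq1: "override_on \<omega> \<eta> \<Gamma> k * u (x - k) = \<omega> k * u (x - k)" if "k \<in> - \<Gamma>" for k
    using that by simp
  have 2: "(\<lambda>k. override_on \<omega> \<eta> \<Gamma> k * u (x - k)) summable_on - \<Gamma>"
    using 1 by (subst summable_on_cong[OF eq1])
  have "alloy_potential u (override_on \<omega> \<eta> \<Gamma>) x = infsum (\<lambda>k. override_on \<omega> \<eta> \<Gamma> k * u (x - k)) (\<Gamma> \<union> - \<Gamma>)"
    by (simp add: alloy_potential_def)
  also have "\<dots> = infsum (\<lambda>k. override_on \<omega> \<eta> \<Gamma> k * u (x - k)) \<Gamma> + infsum (\<lambda>k. override_on \<omega> \<eta> \<Gamma> k * u (x - k)) (- \<Gamma>)"
    using 2 \<Gamma> by (intro infsum_Un_disjoint) auto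
  also have "infsum (\<lambda>k. override_on \<omega> \<eta> \<Gamma> k * u (x - k)) (- \<Gamma>) = infsum (\<lambda>k. \<omega> k * u (x - k)) (- \<Gamma>)"
    using eq1 by (intro infsum_cong) auto
  also have "infsum (\<lambda>k. override_on \<omega> \<eta> \<Gamma> k * u (x - k)) \<Gamma> = (\<Sum>k\<in>\<Gamma>. \<eta> k * u (x - k))"
    using \<Gamma> by (simp add: override_on_def)
  finally show ?thesis .
qed

text \<open>The lattice is countable, so measurability into the space of potentials can be checked
  at each lattice point, where the potential is affine in finitely many coupling constants.\<close>

lemma alloy_potential_measurable:
  fixes u :: "int ^ 'd::finite \<Rightarrow> real"
  assumes \<Gamma>: "finite \<Gamma>" and u: "(\<lambda>k. \<bar>u k\<bar>) summable_on UNIV"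
    and \<omega>: "\<And>k. k \<notin> \<Gamma> \<Longrightarrow> \<bar>\<omega> k\<bar> \<le> B"
  shows "(\<lambda>\<eta>. alloy_potential u (override_on \<omega> \<eta> \<Gamma>)) \<in> borel_measurable (PiM \<Gamma> (\<lambda>_. borel))"
  by (rule measurable_coordinatewise_then_product)
    (auto simp: alloy_potential_override[OF assms])

lemma interval_length_le_measure:
  fixes I :: "real set"
  assumes "is_interval I" "bounded I" "I \<noteq> {}"
  shows "Sup I - Inf I \<le> measure lborel I"
proof -
  have bdd: "bdd_above I" "bdd_below I" using assms(2) by (auto simp: bounded_imp_bdd_above bounded_imp_bdd_below)
  have "Inf I \<le> Sup I" by (rule cInf_le_cSup[OF assms(3) bdd])
  have sub: "{Inf I<..<Sup I} \<subseteq> I"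
  proof
    fix x assume x: "x \<in> {Inf I<..<Sup I}"
    obtain y where "y \<in> I" "y < x" using x cInf_lessD[OF assms(3)] by auto
    moreover obtain z where "z \<in> I" "x < z" using x less_cSupD[OF assms(3)] by auto
    ultimately show "x \<in> I" using assms(1) unfolding is_interval_1 by (meson less_imp_le)
  qed
  \<comment> \<open>A non-measurable set would have measure 0; \<open>I\<close> differs from the
    open interval at most by its end points.\<close>
  have "I \<in> sets borel"
  proof -
    have "I - {Inf I<..<Sup I} \<subseteq> {Inf I, Sup I}"
      using cSup_upper[OF _ bdd(1)] cInf_lower[OF _ bdd(2)] by (force simp: le_less)
    then have "finite (I - {Inf I<..<Sup I})" by (rule finite_subset) simp
    then have "I - {Inf I<..<Sup I} \<in> sets borel" by (intro borel_closed finite_imp_closed)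
    then have "{Inf I<..<Sup I} \<union> (I - {Inf I<..<Sup I}) \<in> sets borel" by (intro sets.Un) auto
    moreover have "{Inf I<..<Sup I} \<union> (I - {Inf I<..<Sup I}) = I" using sub by blast
    ultimately show ?thesis by simp
  qed
  moreover have "emeasure lborel I < \<infinity>"
    using assms(2) by (rule emeasure_bounded_finite)
  ultimately have "measure lborel {Inf I<..<Sup I} \<le> measure lborel I"
    using sub by (intro measure_mono_fmeasurable) (auto simp: fmeasurable_def)
  then show ?thesis using \<open>Inf I \<le> Sup I\<close> by simp
qed

text \<open>This isolates the probabilistic argument from the construction of the weights: any
  \<open>t\<close> whose combination of translates is at least \<delta> on \<open>X\<close> will do,
  at the price of the sum of the |t k|.\<close>

lemma wegner_estimate_of_covering:
  fixes u :: "int ^ 'd::finite \<Rightarrow> real"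
  assumes X: "finite X" and \<Gamma>: "finite \<Gamma>" and u: "(\<lambda>k. \<bar>u k\<bar>) summable_on UNIV"
    and \<mu>: "prob_space \<mu>" "has_density \<mu> \<rho>" and \<rho>: "\<rho> \<in> BV"
    and \<omega>: "\<And>k. k \<notin> \<Gamma> \<Longrightarrow> \<bar>\<omega> k\<bar> \<le> B"
    and I: "is_interval I" "bounded I"
    and \<delta>: "\<delta> > 0" and cover: "\<And>x. x \<in> X \<Longrightarrow> \<delta> \<le> (\<Sum>k\<in>\<Gamma>. t k * u (x - k))"
  defines "N \<equiv> \<lambda>\<eta>. spectral_count X (alloy_potential u (override_on \<omega> \<eta> \<Gamma>)) I"
  shows "integrable (PiM \<Gamma> (\<lambda>_. \<mu>)) N"
    and "(\<integral>\<eta>. N \<eta> \<partial>PiM \<Gamma> (\<lambda>_. \<mu>))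
      \<le> real (card X) * (measure lborel I / \<delta>) * (\<Sum>k\<in>\<Gamma>. \<bar>t k\<bar>) * var_norm \<rho>"
proof -
  define P where "P = PiM \<Gamma> (\<lambda>_. \<mu>)"
  define V where "V \<eta> = alloy_potential u (override_on \<omega> \<eta> \<Gamma>)" for \<eta>
  have sets_P: "sets P = sets (PiM \<Gamma> (\<lambda>_. borel))"
    unfolding P_def using \<mu>(2) by (intro sets_PiM_cong) (auto simp: has_density_def)
  have prob: "prob_space P" unfolding P_def by (intro prob_space_PiM \<mu>)
  interpret prob_space P by (rule prob)
  have int: "integrable P (\<lambda>\<eta>. spectral_count X (V' \<eta>) J)"
    if "(\<lambda>\<eta>. spectral_count X (V' \<eta>) J) \<in> borel_measurable (PiM \<Gamma> (\<lambda>_. borel))" for V' J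
    using that spectral_count_nonneg[OF X] spectral_count_le_card[OF X]
    by (intro integrable_const_bound[where B = "real (card X)"]) (auto simp: measurable_cong_sets[OF sets_P refl])
  have V_eq: "V \<eta> x = (\<Sum>k\<in>\<Gamma>. \<eta> k * u (x - k)) + (\<Sum>\<^sub>\<infinity>k\<in>- \<Gamma>. \<omega> k * u (x - k))" for \<eta> x
    unfolding V_def by (rule alloy_potential_override[OF \<Gamma> u \<omega>])
  have V_meas: "V \<in> borel_measurable (PiM \<Gamma> (\<lambda>_. borel))"
    unfolding V_def by (rule alloy_potential_measurable[OF \<Gamma> u \<omega>])
  have bound_nn: "0 \<le> real (card X) * (measure lborel I / \<delta>) * (\<Sum>k\<in>\<Gamma>. \<bar>t k\<bar>) * var_norm \<rho>"
    using \<delta> var_norm_nonneg[OF \<rho>] by (intro mult_nonneg_nonneg sum_nonneg divide_nonneg_pos) auto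
  have "integrable P N \<and> (\<integral>\<eta>. N \<eta> \<partial>P) \<le> real (card X) * (measure lborel I / \<delta>) * (\<Sum>k\<in>\<Gamma>. \<bar>t k\<bar>) * var_norm \<rho>"
  proof (cases "I = {}")
    case True
    \<comment> \<open>The empty set is split off because its \<open>Inf\<close> and
      \<open>Sup\<close> carry no information.\<close>
    have "N = (\<lambda>_. 0)"
      unfolding N_def True spectral_count_def spectral_projection_def op_trace_def l2_inner_def by simp
    then show ?thesis using bound_nn by simp
  next
    case False
    define a b where "a = Inf I" and "b = Sup I"
    have bdd: "bdd_above I" "bdd_below I" using I(2) by (auto simp: bounded_imp_bdd_above bounded_imp_bdd_below)
    have "a \<le> b" unfolding a_def b_def by (rule cInf_le_cSup[OF False bdd])
    have I_sub: "I \<subseteq> {..b} - {..<a}"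
    proof
      fix x assume "x \<in> I"
      then show "x \<in> {..b} - {..<a}"
        using cSup_upper[OF _ bdd(1), of x] cInf_lower[OF _ bdd(2), of x] by (simp add: a_def b_def not_less)
    qed
    have N_int: "integrable P N"
      unfolding N_def V_def[symmetric]
      by (intro int measurable_compose[OF V_meas spectral_count_interval_measurable[OF X I False]])
    define f where "f \<eta> = spectral_count X (V \<eta>) {..<a}" for \<eta>
    have f_meas: "f \<in> borel_measurable (PiM \<Gamma> (\<lambda>_. borel))"
      unfolding f_def by (rule measurable_compose[OF V_meas spectral_count_lessThan_measurable[OF X]])
    \<comment> \<open>The comparison of counts needs the strict inequality b - s \<delta> < a, hence
      s above (b - a)/\<delta>; the value itself is reached afterwards by a limit from the right.
      This also covers intervals consisting of one point.\<close>
    have bound: "(\<integral>\<eta>. N \<eta> \<partial>P) \<le> (real (card X) * (\<Sum>k\<in>\<Gamma>. \<bar>t k\<bar>) * var_norm \<rho>) * s"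
      if s: "s > (b - a) / \<delta>" for s
    proof -
      have s_pos: "s > 0" using s \<delta> \<open>a \<le> b\<close> by (meson diff_ge_0_iff_ge divide_nonneg_pos le_less_trans)
      define \<tau> where "\<tau> \<eta> = (\<lambda>k. if k \<in> \<Gamma> then \<eta> k + (- s * t k) else \<eta> k)" for \<eta> :: "int ^ 'd \<Rightarrow> real"
      have f\<tau>_meas: "(\<lambda>\<eta>. f (\<tau> \<eta>)) \<in> borel_measurable (PiM \<Gamma> (\<lambda>_. borel))"
        unfolding \<tau>_def by (rule measurable_compose[OF measurable_shift f_meas]) simp
      have "N \<eta> \<le> f (\<tau> \<eta>) - f \<eta>" for \<eta>
      proof -
        have "V (\<tau> \<eta>) x \<le> V \<eta> x - s * \<delta>" if "x \<in> X" for x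
        proof -
          have "V (\<tau> \<eta>) x = V \<eta> x - s * (\<Sum>k\<in>\<Gamma>. t k * u (x - k))"
            by (simp add: V_eq \<tau>_def algebra_simps sum_subtractf sum_distrib_left)
          moreover have "s * \<delta> \<le> s * (\<Sum>k\<in>\<Gamma>. t k * u (x - k))"
            using s_pos cover[OF that] by (intro mult_left_mono) auto
          ultimately show ?thesis by simp
        qed
        then have "spectral_count X (V \<eta>) {..b} \<le> f (\<tau> \<eta>)"
          unfolding f_def using s \<delta> by (intro spectral_count_shift[OF X]) (auto simp: field_simps)
        moreover have "N \<eta> \<le> spectral_count X (V \<eta>) ({..b} - {..<a})"
          unfolding N_def V_def[symmetric] by (rule spectral_count_mono[OF X I_sub])
        moreover have "spectral_count X (V \<eta>) ({..b} - {..<a}) = spectral_count X (V \<eta>) {..b} - f \<eta>"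
          unfolding f_def using \<open>a \<le> b\<close> by (intro spectral_count_diff[OF X]) auto
        ultimately show ?thesis by simp
      qed
      then have "(\<integral>\<eta>. N \<eta> \<partial>P) \<le> (\<integral>\<eta>. f (\<tau> \<eta>) - f \<eta> \<partial>P)"
        using f_meas f\<tau>_meas unfolding f_def by (intro integral_mono N_int Bochner_Integration.integrable_diff int)
      also have "\<dots> = (\<integral>\<eta>. f (\<tau> \<eta>) \<partial>P) - (\<integral>\<eta>. f \<eta> \<partial>P)"
        using f_meas f\<tau>_meas unfolding f_def by (intro Bochner_Integration.integral_diff int)
      \<comment> \<open>The translated function \<open>f\<close> takes values between 0 and
        \<open>card X\<close>, which is the origin of this factor.\<close>
      also have "\<dots> \<le> real (card X) * (\<Sum>k\<in>\<Gamma>. \<bar>- s * t k\<bar>) * var_norm \<rho>"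
        unfolding P_def \<tau>_def
        using spectral_count_nonneg[OF X] spectral_count_le_card[OF X]
        by (intro product_translation_bound[OF \<mu> \<rho> \<Gamma> subset_refl f_meas]) (simp add: f_def)
      also have "\<dots> = (real (card X) * (\<Sum>k\<in>\<Gamma>. \<bar>t k\<bar>) * var_norm \<rho>) * s"
        using s_pos by (simp add: abs_mult sum_distrib_left[symmetric])
      finally show ?thesis .
    qed
    define Q where "Q = real (card X) * (\<Sum>k\<in>\<Gamma>. \<bar>t k\<bar>) * var_norm \<rho>"
    have Q: "Q \<ge> 0" unfolding Q_def using var_norm_nonneg[OF \<rho>] by (intro mult_nonneg_nonneg sum_nonneg) auto
    have "(\<integral>\<eta>. N \<eta> \<partial>P) \<le> Q * ((b - a) / \<delta>)"
    proof (rule tendsto_lowerbound)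
      show "((\<lambda>s. Q * s) \<longlongrightarrow> Q * ((b - a) / \<delta>)) (at_right ((b - a) / \<delta>))"
        by (intro tendsto_intros)
      show "eventually (\<lambda>s. (\<integral>\<eta>. N \<eta> \<partial>P) \<le> Q * s) (at_right ((b - a) / \<delta>))"
        using bound by (auto simp: eventually_at_filter Q_def)
    qed simp
    also have "\<dots> \<le> Q * (measure lborel I / \<delta>)"
      using interval_length_le_measure[OF I False] Q \<delta>
      by (intro mult_left_mono divide_right_mono) (auto simp: a_def b_def)
    finally show ?thesis using N_int by (simp add: Q_def mult_ac)
  qed
  then show "integrable (PiM \<Gamma> (\<lambda>_. \<mu>)) N"
    "(\<integral>\<eta>. N \<eta> \<partial>PiM \<Gamma> (\<lambda>_. \<mu>)) \<le> real (card X) * (measure lborel I / \<delta>) * (\<Sum>k\<in>\<Gamma>. \<bar>t k\<bar>) * var_norm \<rho>"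
    unfolding P_def by blast+
qed

theorem theorem2p3:
  fixes u :: "int ^ 'd::finite \<Rightarrow> real" and C \<alpha> :: real
  assumes "(\<lambda>k. \<bar>u k\<bar>) summable_on UNIV"
    and "u \<noteq> (\<lambda>k. 0)"
    and "C > 0" and "\<alpha> > 0"
    and "\<And>k. \<bar>u k\<bar> \<le> C * exp (- \<alpha> * real_of_int (lattice_norm k))"
  shows "(\<exists>I\<^sub>0. leading_index u I\<^sub>0) \<and>
    (\<forall>I\<^sub>0. leading_index u I\<^sub>0 \<longrightarrow>
      (\<exists>C\<^sub>W>0. \<forall>(\<mu> :: real measure) (\<rho> :: real \<Rightarrow> real) (l :: real) (I :: real set) (\<omega> :: int ^ 'd \<Rightarrow> real).
        prob_space \<mu> \<longrightarrow> bounded (measure_support \<mu>) \<longrightarrow> has_density \<mu> \<rho> \<longrightarrow> \<rho> \<in> BV \<longrightarrow>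
        l > 0 \<longrightarrow> is_interval I \<longrightarrow> bounded I \<longrightarrow>
        (let \<Gamma> = cube (R_const u I\<^sub>0 C \<alpha> l) in
          (\<forall>k\<in>-\<Gamma>. \<omega> k \<in> measure_support \<mu>) \<longrightarrow>
          integrable (PiM \<Gamma> (\<lambda>_. \<mu>)) (\<lambda>\<eta>. trace_spectral_projection u l I (override_on \<omega> \<eta> \<Gamma>)) \<and>
          partial_expectation \<mu> \<Gamma> (trace_spectral_projection u l I) \<omega>
            \<le> C\<^sub>W * var_norm \<rho> * measure lborel I * (2 * l + 1) ^ (2 * CARD('d) + mi_norm I\<^sub>0))))"
proof (intro conjI allI impI)
  have decay: "exp_decay C \<alpha> u"
    using assms(5) by (simp add: exp_decay_def)
  show "\<exists>I\<^sub>0. leading_index u I\<^sub>0"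
    by (rule leading_index_exists[OF assms(4) decay assms(2)])
  fix I\<^sub>0 assume I\<^sub>0: "leading_index u I\<^sub>0"
  define c where "c = cmod (c_const u I\<^sub>0)"
  have c: "c > 0" using I\<^sub>0 by (simp add: c_def leading_index_def)
  obtain K where K: "K \<ge> 1" "\<And>l. l > 0 \<Longrightarrow> 0 \<le> R_const u I\<^sub>0 C \<alpha> l"
      "\<And>l. l > 0 \<Longrightarrow> R_const u I\<^sub>0 C \<alpha> l \<le> K * (2 * l + 1)"
    using R_const_linear_bound[OF assms(4), of u I\<^sub>0 C] by blast
  \<comment> \<open>The factor 2/c is 1/\<delta> for the covering constant \<delta> = c/2;
    \<open>(2 * K + 1) ^ CARD('d)\<close> comes from the number of sites in \<Gamma>, and the power
    of \<open>K\<close> from the size of the weights.\<close>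
  define C\<^sub>W where "C\<^sub>W = 2 / c * (2 * K + 1) ^ CARD('d) * K ^ mi_norm I\<^sub>0"
  have "C\<^sub>W > 0" unfolding C\<^sub>W_def using c K(1) by (intro mult_pos_pos zero_less_power divide_pos_pos) auto
  moreover have "integrable (PiM \<Gamma> (\<lambda>_. \<mu>)) (\<lambda>\<eta>. trace_spectral_projection u l I (override_on \<omega> \<eta> \<Gamma>)) \<and>
      partial_expectation \<mu> \<Gamma> (trace_spectral_projection u l I) \<omega>
        \<le> C\<^sub>W * var_norm \<rho> * measure lborel I * (2 * l + 1) ^ (2 * CARD('d) + mi_norm I\<^sub>0)"
    if \<mu>: "prob_space \<mu>" "bounded (measure_support \<mu>)" "has_density \<mu> \<rho>" and \<rho>: "\<rho> \<in> BV"
      and l: "l > 0" and I: "is_interval I" "bounded I"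
      and \<Gamma>_def: "\<Gamma> = cube (R_const u I\<^sub>0 C \<alpha> l)" and \<omega>: "\<forall>k\<in>-\<Gamma>. \<omega> k \<in> measure_support \<mu>"
    for \<mu> \<rho> l I \<omega> \<Gamma>
  proof -
    define R where "R = R_const u I\<^sub>0 C \<alpha> l"
    define m where "m = 2 * l + 1"
    have m: "m \<ge> 1" using l by (simp add: m_def)
    have R: "0 \<le> R" "R \<le> K * m" using K(2,3)[OF l] by (simp_all add: R_def m_def)
    have \<Gamma>: "finite \<Gamma>" unfolding \<Gamma>_def by (intro finite_cube K(2) l)
    have X: "finite (cube l :: (int ^ 'd) set)" using l by (intro finite_cube) simp
    obtain t where t: "\<And>k. k \<in> \<Gamma> \<Longrightarrow> \<bar>t k\<bar> \<le> R ^ mi_norm I\<^sub>0"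
      and cover: "\<And>x. x \<in> cube l \<Longrightarrow> c / 2 \<le> (\<Sum>k\<in>\<Gamma>. t k * u (x - k))"
      using monomial_covering[OF assms(4,3) decay I\<^sub>0 l] unfolding \<Gamma>_def R_def c_def by blast
    obtain B where B: "\<And>x. x \<in> measure_support \<mu> \<Longrightarrow> \<bar>x\<bar> \<le> B"
      using \<mu>(2) by (auto simp: bounded_iff)
    have \<omega>B: "\<bar>\<omega> k\<bar> \<le> B" if "k \<notin> \<Gamma>" for k using \<omega> B that by auto
    have tr: "trace_spectral_projection u l I \<omega>' = spectral_count (cube l) (alloy_potential u \<omega>') I" for \<omega>'
      by (simp add: trace_spectral_projection_def spectral_count_def alloy_restricted_eq)
    have \<delta>: "c / 2 > 0" using c by simp
    note wegner = wegner_estimate_of_covering[OF X \<Gamma> assms(1) \<mu>(1,3) \<rho> \<omega>B I \<delta> cover]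
    have card_X: "real (card (cube l :: (int ^ 'd) set)) \<le> m ^ CARD('d)"
      unfolding m_def using l by (intro card_cube_le) simp
    have "(\<Sum>k\<in>\<Gamma>. \<bar>t k\<bar>) \<le> real (card \<Gamma>) * R ^ mi_norm I\<^sub>0"
      using t by (intro sum_bounded_above) auto
    also have "\<dots> \<le> ((2 * K + 1) * m) ^ CARD('d) * (K * m) ^ mi_norm I\<^sub>0"
    proof (intro mult_mono power_mono R)
      have "real (card \<Gamma>) \<le> (2 * R + 1) ^ CARD('d)"
        unfolding \<Gamma>_def R_def by (intro card_cube_le K(2) l)
      also have "\<dots> \<le> ((2 * K + 1) * m) ^ CARD('d)"
        using R m by (intro power_mono) (auto simp: algebra_simps)
      finally show "real (card \<Gamma>) \<le> ((2 * K + 1) * m) ^ CARD('d)" .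
    qed (use R K m in auto)
    finally have sum_t: "(\<Sum>k\<in>\<Gamma>. \<bar>t k\<bar>) \<le> ((2 * K + 1) * m) ^ CARD('d) * (K * m) ^ mi_norm I\<^sub>0" .
    have "partial_expectation \<mu> \<Gamma> (trace_spectral_projection u l I) \<omega>
        \<le> real (card (cube l :: (int ^ 'd) set)) * (measure lborel I / (c / 2)) * (\<Sum>k\<in>\<Gamma>. \<bar>t k\<bar>) * var_norm \<rho>"
      unfolding partial_expectation_def tr by (rule wegner(2))
    also have "\<dots> \<le> m ^ CARD('d) * (measure lborel I / (c / 2)) * (((2 * K + 1) * m) ^ CARD('d) * (K * m) ^ mi_norm I\<^sub>0) * var_norm \<rho>"
      using c m K(1) var_norm_nonneg[OF \<rho>]
      by (intro mult_right_mono mult_mono card_X sum_t mult_nonneg_nonneg sum_nonneg) auto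
    \<comment> \<open>The powers of m = 2l + 1 are d from the inner cube, d from \<Gamma>, and the
      total degree of the index from the weights.\<close>
    also have "\<dots> = C\<^sub>W * var_norm \<rho> * measure lborel I * m ^ (2 * CARD('d) + mi_norm I\<^sub>0)"
    proof -
      have "x * (M / (c / 2)) * ((A * x) * (B * y)) * v = 2 / c * A * B * v * M * (x * x * y)" for x y A B v M
        by simp
      moreover have "m ^ (2 * CARD('d) + mi_norm I\<^sub>0) = m ^ CARD('d) * m ^ CARD('d) * m ^ mi_norm I\<^sub>0"
        by (simp add: power_add mult_2)
      ultimately show ?thesis
        by (simp only: C\<^sub>W_def power_mult_distrib)
    qed
    finally show ?thesis
      using wegner(1) by (simp add: tr m_def)
  qed
  ultimately show "\<exists>C\<^sub>W>0. \<forall>(\<mu> :: real measure) (\<rho> :: real \<Rightarrow> real) (l :: real) (I :: real set) (\<omega> :: int ^ 'd \<Rightarrow> real).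
        prob_space \<mu> \<longrightarrow> bounded (measure_support \<mu>) \<longrightarrow> has_density \<mu> \<rho> \<longrightarrow> \<rho> \<in> BV \<longrightarrow>
        l > 0 \<longrightarrow> is_interval I \<longrightarrow> bounded I \<longrightarrow>
        (let \<Gamma> = cube (R_const u I\<^sub>0 C \<alpha> l) in
          (\<forall>k\<in>-\<Gamma>. \<omega> k \<in> measure_support \<mu>) \<longrightarrow>
          integrable (PiM \<Gamma> (\<lambda>_. \<mu>)) (\<lambda>\<eta>. trace_spectral_projection u l I (override_on \<omega> \<eta> \<Gamma>)) \<and>
          partial_expectation \<mu> \<Gamma> (trace_spectral_projection u l I) \<omega>
            \<le> C\<^sub>W * var_norm \<rho> * measure lborel I * (2 * l + 1) ^ (2 * CARD('d) + mi_norm I\<^sub>0))"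
    unfolding Let_def by (intro exI[of _ C\<^sub>W] conjI allI impI) blast+
qed

end
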